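(* Let $A=\bigoplus_{t\in T}A^{(t)}$ be a finite dimensional $T$-graded-simple algebra over a field $F$ of characteristic $0$ for a right zero band $T$. Suppose $A/J(A) \cong M_2(F)$. Let $\pi\colon A\to A/J(A)$ be the natural epimorphism, $I_t:=\pi(A^{(t)})$, $T_0 := \{ t\in T \mid \dim I_t=2 \}$, $T_1 := \{ t\in T \mid I_t = A/J(A) \}$, and let $\sim$ be the equivalence relation $t_1\sim t_2\iff I_{t_1}=I_{t_2}$; denote by $\bar t$ the $\sim$-class in $T_0$ of $t\in T_0$. Suppose also that either $T_0=\varnothing$ or $$|\bar t_0| \leqslant \sum_{\bar t \in T_0/{\sim},\ \bar t \ne \bar t_0} |\bar t| \quad\text{for all }\bar t_0 \in T_0/{\sim}.$$ Then there exist $C > 0$ and $r\in \mathbb R$ such that $$C n^r (\dim A)^n \leqslant c^{T\text{-}\mathrm{gr}}_n(A) \leqslant (\dim A)^{n+1}\quad\text{for all }n\in\mathbb N.$$ In particular, $\lim_{n\to\infty}\sqrt[n]{c^{T\text{-}\mathrm{gr}}_n(A)} =\dim A$.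
   Context: Algebras are associative, not necessarily unital; $J(A)$ is the Jacobson radical. A right zero band is a semigroup $T$ with $st=t$ for all $s,t\in T$. $T$-graded means $A=\bigoplus_{t\in T}A^{(t)}$ (subspaces) with $A^{(s)}A^{(t)}\subseteq A^{(st)}$; $A$ is $T$-graded-simple if $A^2\ne0$ and $0$ and $A$ are the only two-sided ideals $I$ with $I=\bigoplus_t (I\cap A^{(t)})$. Graded codimensions: let $F\langle X^{T\text{-}\mathrm{gr}}\rangle$ be the free associative algebra without $1$ on variables $x_i^{(t)}$, $i\in\mathbb N$, $t\in T$. A polynomial $f(x_{i_1}^{(t_1)},\ldots,x_{i_s}^{(t_s)})$ is a graded polynomial identity of $A$ if it vanishes under all substitutions of elements of $A^{(t_j)}$ for $x_{i_j}^{(t_j)}$; $\operatorname{Id}^{T\text{-}\mathrm{gr}}(A)$ is the set of these. With $P_n^{T\text{-}\mathrm{gr}}=\langle x_{\sigma(1)}^{(t_1)}\cdots x_{\sigma(n)}^{(t_n)}\mid t_i\in T,\ \sigma\in S_n\rangle_F$, one sets $c_n^{T\text{-}\mathrm{gr}}(A)=\dim\bigl(P_n^{T\text{-}\mathrm{gr}}/(P_n^{T\text{-}\mathrm{gr}}\cap\operatorname{Id}^{T\text{-}\mathrm{gr}}(A))\bigr)$. *)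

theory Defs
  imports
    "Jordan_Normal_Form.VS_Connect"
    "HOL-Library.Poly_Mapping"
    "HOL-Combinatorics.Permutations"
begin

section \<open>Quotients of vector spaces and algebras\<close>

definition coset :: "'a::ab_group_add set \<Rightarrow> 'a \<Rightarrow> 'a set"
  where "coset W x = {x + w | w. w \<in> W}"

text \<open>
  The quotient \<open>U/W\<close> of subspaces \<open>W \<subseteq> U\<close> of the vector space with scalar multiplication
  \<open>scale\<close>. The carrier depends on \<open>U\<close>, so the quotient is a record in the style of
  \<^theory>\<open>HOL-Algebra.Module\<close>, and the dimension used for it is
  \<^const>\<open>vectorspace.dim\<close>. Each union below ranges over representatives and consists of
  a single coset.
\<close>
definition quotient_space ::
    "('f::field \<Rightarrow> 'a::ab_group_add \<Rightarrow> 'a) \<Rightarrow> 'a set \<Rightarrow> 'a set \<Rightarrow> ('f, 'a set) module"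
  where "quotient_space scale U W =
    \<lparr>carrier = coset W ` U,
     mult = undefined,
     one = undefined,
     zero = W,
     add = (\<lambda>X Y. \<Union>x\<in>X. \<Union>y\<in>Y. coset W (x + y)),
     smult = (\<lambda>c X. \<Union>x\<in>X. coset W (scale c x))\<rparr>"

text \<open>The quotient algebra \<open>A/J\<close>. Algebras need not have a unit, so the field \<open>one\<close> remains
  unspecified.\<close>
definition quotient_algebra ::
    "('f::field \<Rightarrow> 'a::ring \<Rightarrow> 'a) \<Rightarrow> 'a set \<Rightarrow> ('f, 'a set) module"
  where "quotient_algebra scale J =
    (quotient_space scale UNIV J)\<lparr>mult := (\<lambda>X Y. \<Union>x\<in>X. \<Union>y\<in>Y. coset J (x * y))\<rparr>"

abbreviation module_dim :: "('f::field, 'v) module \<Rightarrow> nat"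
  where "module_dim V \<equiv> vectorspace.dim class_ring V"

definition iso_matrix_algebra :: "('f::field, 'v) module \<Rightarrow> nat \<Rightarrow> bool"
  where "iso_matrix_algebra Q k \<longleftrightarrow>
    (\<exists>h. bij_betw h (carrier Q) (carrier_mat k k) \<and>
      (\<forall>x\<in>carrier Q. \<forall>y\<in>carrier Q. h (x \<oplus>\<^bsub>Q\<^esub> y) = h x + h y) \<and>
      (\<forall>x\<in>carrier Q. \<forall>y\<in>carrier Q. h (x \<otimes>\<^bsub>Q\<^esub> y) = h x * h y) \<and>
      (\<forall>c. \<forall>x\<in>carrier Q. h (c \<odot>\<^bsub>Q\<^esub> x) = c \<cdot>\<^sub>m h x))"


section \<open>Non-unital algebras\<close>

locale nonunital_algebra = vector_space scale
  for scale :: "'f::field \<Rightarrow> 'a::ring \<Rightarrow> 'a" +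
  assumes scale_mult_left: "scale c x * y = scale c (x * y)"
    and scale_mult_right: "x * scale c y = scale c (x * y)"
begin

definition left_ideal :: "'a set \<Rightarrow> bool"
  where "left_ideal L \<longleftrightarrow> subspace L \<and> (\<forall>a. \<forall>x\<in>L. a * x \<in> L)"

definition two_sided_ideal :: "'a set \<Rightarrow> bool"
  where "two_sided_ideal I \<longleftrightarrow> subspace I \<and> (\<forall>a. \<forall>x\<in>I. a * x \<in> I \<and> x * a \<in> I)"

definition modular_maximal_left_ideal :: "'a set \<Rightarrow> bool"
  where "modular_maximal_left_ideal L \<longleftrightarrow>
    left_ideal L \<and> L \<noteq> UNIV \<and>
    (\<forall>L'. left_ideal L' \<and> L \<subseteq> L' \<longrightarrow> L' = L \<or> L' = UNIV) \<and>
    (\<exists>e. \<forall>a. a - a * e \<in> L)"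

text \<open>Without a unit, only the modular (also called regular) maximal left ideals are
  intersected; if there are none, the radical is the whole algebra.\<close>
definition jacobson_radical :: "'a set"
  where "jacobson_radical = \<Inter>{L. modular_maximal_left_ideal L}"

text \<open>\<open>W\<close> is the internal direct sum of the subspaces \<open>V t\<close>: summation is a bijection from the
  finitely supported families \<open>f\<close> with \<open>f t \<in> V t\<close> onto \<open>W\<close>.\<close>
definition direct_sum :: "('t \<Rightarrow> 'a set) \<Rightarrow> 'a set \<Rightarrow> bool"
  where "direct_sum V W \<longleftrightarrow>
    (\<forall>t. subspace (V t)) \<and>
    bij_betw (\<lambda>f. \<Sum>t | f t \<noteq> 0. f t) {f. finite {t. f t \<noteq> 0} \<and> (\<forall>t. f t \<in> V t)} W"

definition grading :: "('t::semigroup_mult \<Rightarrow> 'a set) \<Rightarrow> bool"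
  where "grading A \<longleftrightarrow>
    direct_sum A UNIV \<and> (\<forall>s t. \<forall>x\<in>A s. \<forall>y\<in>A t. x * y \<in> A (s * t))"

definition graded_simple :: "('t::semigroup_mult \<Rightarrow> 'a set) \<Rightarrow> bool"
  where "graded_simple A \<longleftrightarrow>
    (\<exists>x y :: 'a. x * y \<noteq> 0) \<and>
    (\<forall>I. two_sided_ideal I \<and> direct_sum (\<lambda>t. I \<inter> A t) I \<longrightarrow> I = {0} \<or> I = UNIV)"

end


section \<open>Graded polynomial identities and graded codimensions\<close>

text \<open>The free monoid, written additively because \<^type>\<open>poly_mapping\<close> multiplies by
  convolution over a \<^class>\<open>monoid_add\<close>.\<close>
datatype 'x monomial = Monomial (letters: "'x list")

instantiation monomial :: (type) monoid_add
begin

definition zero_monomial :: "'a monomial"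
  where "0 = Monomial []"

definition plus_monomial :: "'a monomial \<Rightarrow> 'a monomial \<Rightarrow> 'a monomial"
  where "v + w = Monomial (letters v @ letters w)"

instance
  by standard (simp_all add: zero_monomial_def plus_monomial_def)

end

text \<open>The free associative algebra with \<open>1\<close>. The letter \<open>(t, i)\<close> is the variable
  \<open>x\<^sub>i\<close> of degree \<open>t\<close>.\<close>
type_synonym ('t, 'f) graded_poly = "('t \<times> nat) monomial \<Rightarrow>\<^sub>0 'f"

definition free_algebra :: "('t, 'f::field) graded_poly set"
  where "free_algebra = {f. Poly_Mapping.lookup f 0 = 0}"

definition poly_scale :: "'f::field \<Rightarrow> ('t, 'f) graded_poly \<Rightarrow> ('t, 'f) graded_poly"
  where "poly_scale c = Poly_Mapping.map ((*) c)"

definition var :: "'t \<Rightarrow> nat \<Rightarrow> ('t, 'f::field) graded_poly"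
  where "var t i = Poly_Mapping.single (Monomial [(t, i)]) 1"

text \<open>The value at the empty word is irrelevant: it is only used for \<open>f \<in> free_algebra\<close>.\<close>
fun subst_letters :: "('x \<Rightarrow> 'a::ring) \<Rightarrow> 'x list \<Rightarrow> 'a"
  where
    "subst_letters \<rho> [] = 0"
  | "subst_letters \<rho> [x] = \<rho> x"
  | "subst_letters \<rho> (x # y # xs) = \<rho> x * subst_letters \<rho> (y # xs)"

definition subst_poly ::
    "('f::field \<Rightarrow> 'a::ring \<Rightarrow> 'a) \<Rightarrow> ('t \<times> nat \<Rightarrow> 'a) \<Rightarrow> ('t, 'f) graded_poly \<Rightarrow> 'a"
  where "subst_poly scale \<rho> f =
    (\<Sum>w\<in>Poly_Mapping.keys f. scale (Poly_Mapping.lookup f w) (subst_letters \<rho> (letters w)))"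

definition graded_identities ::
    "('f::field \<Rightarrow> 'a::ring \<Rightarrow> 'a) \<Rightarrow> ('t \<Rightarrow> 'a set) \<Rightarrow> ('t, 'f) graded_poly set"
  where "graded_identities scale A =
    {f \<in> free_algebra. \<forall>\<rho>. (\<forall>t i. \<rho> (t, i) \<in> A t) \<longrightarrow> subst_poly scale \<rho> f = 0}"

definition multilinear_polys :: "nat \<Rightarrow> ('t, 'f::field) graded_poly set"
  where "multilinear_polys n =
    Modules.module.span poly_scale
      {prod_list (map (\<lambda>j. var (t j) (\<sigma> j)) [1..<n + 1]) | t \<sigma>. \<sigma> permutes {1..n}}"

definition graded_codim ::
    "('f::field \<Rightarrow> 'a::ring \<Rightarrow> 'a) \<Rightarrow> ('t \<Rightarrow> 'a set) \<Rightarrow> nat \<Rightarrow> nat"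
  where "graded_codim scale A n =
    module_dim (quotient_space poly_scale (multilinear_polys n)
      (multilinear_polys n \<inter> graded_identities scale A))"

end

theory Submission
  imports Defs "HOL-Combinatorics.Multiset_Permutations" "HOL-Library.Function_Algebras"
begin

text \<open>
  Since \<open>s t = t\<close>, every \<open>A\<^sup>(\<^sup>t\<^sup>)\<close> is a left ideal, so the elements whose components all lie in \<open>J\<close>
  form a graded ideal, which is zero. Thus \<open>\<pi>\<close> is injective on each \<open>A\<^sup>(\<^sup>t\<^sup>)\<close>, and
  \<open>dim A = 2 |T\<^sub>0| + 4 |T\<^sub>1|\<close>: a variable of degree \<open>t\<close> ranges over the matrices \<open>u w\<^sub>t\<close> with a free column
  \<open>u\<close> and a fixed row \<open>w\<^sub>t\<close> if \<open>t \<in> T\<^sub>0\<close>, and over all matrices, spanned by the \<open>u w\<close>, if \<open>t \<in> T\<^sub>1\<close>.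

  On rank one matrices \<open>u\<^sub>i w\<^sub>i\<close> a product of traces of words becomes a product of contractions
  \<open>w\<^sub>k u\<^sub>i\<close>, and every complete system of contractions arises. The polarized Cayley-Hamilton identity
  reduces any product of traces to products of two traces, and these are sums of entries of values of
  monomials in which eight further variables are fixed matrix units. Hence the values of the multilinear polynomials
  contain all products of minors \<open>det(u\<^sub>i, u\<^sub>j)\<close> over one perfect matching and \<open>det(w\<^sub>k, w\<^sub>l)\<close> over another.
  The hypothesis on \<open>T\<^sub>0\<close> allows matching the variables with fixed rows so that no minor of rows vanishes.

  The matchings of Dyck words give a triangular, hence independent, family of such functions, and
  rotations show that at least \<open>2\<^sup>N / (N + 1)\<^sup>3\<close> of the words of even length \<open>N\<close> are Dyck words. Taking each
  degree \<open>t\<close> exactly \<open>m dim A\<^sup>(\<^sup>t\<^sup>)\<close> times, where \<open>N = m dim A\<close>, and counting the arrangements of these degrees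
  by the mode of the multinomial distribution gives \<open>(dim A)\<^sup>N\<close> up to a polynomial factor.

  Multilinear polynomials modulo identities embed into the functions on \<open>n\<close>-tuples of elements of a
  homogeneous basis, which gives the upper bound.
\<close>


section \<open>Linear algebra\<close>

text \<open>A single word of rank one matrices ties the row of each letter to the column of the next
  one, so rows and columns cannot be varied independently. Products of traces remove this coupling:
  once every complete system of contractions is available, alternating them splits off determinants
  of columns and determinants of rows, and the two can be matched independently.

  The exponent arises as follows. A variable of the wrong degree can be sent to 0, so different
  arrangements of degrees contribute independently. For one arrangement the columns give about 2
  choices per letter and the rows of the letters with degree in T_1 give 2 more; a fixed row gives
  none, but must not annihilate the product. With d_t the dimension of the component of degree t,
  this makes the product of all d_t^(m d_t). The arrangements number about the product of (dim A /
  d_t)^(m d_t), so the d_t cancel. With these multiplicities a class of degrees fills at most half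
  of the positions with fixed rows, which is what a matching across classes requires.\<close>

lemma module_dim_eq:
  fixes V :: "('f::field, 'v) module" and scale :: "'f \<Rightarrow> 'b::ab_group_add \<Rightarrow> 'b"
  assumes vs: "vector_space scale"
    and inj: "inj_on \<phi> (carrier V)"
    and zero: "\<zero>\<^bsub>V\<^esub> \<in> carrier V" "\<phi> \<zero>\<^bsub>V\<^esub> = 0"
    and add: "\<And>x y. x \<in> carrier V \<Longrightarrow> y \<in> carrier V \<Longrightarrow>
      x \<oplus>\<^bsub>V\<^esub> y \<in> carrier V \<and> \<phi> (x \<oplus>\<^bsub>V\<^esub> y) = \<phi> x + \<phi> y"
    and smult: "\<And>c x. x \<in> carrier V \<Longrightarrow>
      c \<odot>\<^bsub>V\<^esub> x \<in> carrier V \<and> \<phi> (c \<odot>\<^bsub>V\<^esub> x) = scale c (\<phi> x)"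
    and fin: "finite B" "\<phi> ` carrier V \<subseteq> module.span scale B"
  shows "module_dim V = vector_space.dim scale (\<phi> ` carrier V)"
proof -
  interpret S: vector_space scale by fact
  \<comment> \<open>Since \<phi> is injective, equations in \<open>V\<close>, the vector space
    axioms included, can be checked on images.\<close>
  have eqI: "x = y" if "x \<in> carrier V" "y \<in> carrier V" "\<phi> x = \<phi> y" for x y
    using inj that by (auto dest: inj_onD)
  have "vectorspace class_ring V"
  proof (rule vs_criteria)
    show "field (class_ring :: 'f ring)" by (rule class_field)
    show "\<forall>v\<in>carrier V. \<exists>w\<in>carrier V. v \<oplus>\<^bsub>V\<^esub> w = \<zero>\<^bsub>V\<^esub>"
    proof
      fix v assume v: "v \<in> carrier V"
      show "\<exists>w\<in>carrier V. v \<oplus>\<^bsub>V\<^esub> w = \<zero>\<^bsub>V\<^esub>"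
        by (rule bexI[of _ "(- 1) \<odot>\<^bsub>V\<^esub> v"], rule eqI)
           (auto simp: v add smult zero)
    qed
  qed (auto simp: zero add smult S.scale_right_distrib S.scale_left_distrib algebra_simps
        intro!: eqI)
  then interpret V: vectorspace class_ring V .
  have lincomb: "\<phi> (V.lincomb a A) = (\<Sum>v\<in>A. scale (a v) (\<phi> v))"
    if "finite A" "A \<subseteq> carrier V" for a A
    using that
  proof (induction A rule: finite_induct)
    case empty
    show ?case by (simp add: V.lincomb_def zero)
  next
    case (insert x A)
    have c: "V.lincomb a A \<in> carrier V"
      using insert by (intro V.lincomb_closed) auto
    have "V.lincomb a (insert x A) = a x \<odot>\<^bsub>V\<^esub> x \<oplus>\<^bsub>V\<^esub> V.lincomb a A"
      using insert by (intro V.lincomb_insert2) auto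
    then show ?case
      using insert c by (simp add: add smult)
  qed
  obtain D where D: "D \<subseteq> \<phi> ` carrier V" "S.independent D" "\<phi> ` carrier V \<subseteq> S.span D"
      "card D = S.dim (\<phi> ` carrier V)"
    using S.basis_exists by blast
  have finD: "finite D"
    using S.independent_span_bound[OF fin(1) D(2)] D(1) fin(2) by blast
  \<comment> \<open>The preimages of a basis of the image form a basis of \<open>V\<close>; it is
    finite because \<open>D\<close> is independent inside the span of the finite set
    \<open>B\<close>.\<close>
  define A where "A = the_inv_into (carrier V) \<phi> ` D"
  have A: "A \<subseteq> carrier V"
    unfolding A_def using D(1) the_inv_into_into[OF inj] by blast
  have fA: "finite A" unfolding A_def using finD by simp
  have \<phi>A: "\<phi> ` A = D"
    unfolding A_def image_image using D(1) f_the_inv_into_f[OF inj] by force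
  have injA: "inj_on \<phi> A" using inj A by (rule inj_on_subset)
  have "V.basis A"
    unfolding V.basis_def
  proof (intro conjI)
    show "V.lin_indpt A"
    proof (rule V.finite_lin_indpt2[OF fA A])
      fix a assume "a \<in> A \<rightarrow> carrier class_ring" and z: "V.lincomb a A = \<zero>\<^bsub>V\<^esub>"
      have "(\<Sum>v\<in>A. scale (a v) (\<phi> v)) = 0"
        using lincomb[OF fA A, of a] z zero by simp
      also have "(\<Sum>v\<in>A. scale (a v) (\<phi> v)) = (\<Sum>u\<in>D. scale (a (the_inv_into A \<phi> u)) u)"
        unfolding \<phi>A[symmetric] by (simp add: sum.reindex injA the_inv_into_f_f)
      finally have "\<forall>u\<in>D. a (the_inv_into A \<phi> u) = 0"
        using D(2) finD S.independentD[of D D "\<lambda>u. a (the_inv_into A \<phi> u)"] by blast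
      then show "\<forall>v\<in>A. a v = \<zero>\<^bsub>class_ring\<^esub>"
        unfolding \<phi>A[symmetric] by (auto simp: the_inv_into_f_f injA)
    qed
    show "V.gen_set A"
    proof
      show "V.span A \<subseteq> carrier V" using A by (rule V.span_is_subset2)
      show "carrier V \<subseteq> V.span A"
      proof
        fix x assume x: "x \<in> carrier V"
        then have "\<phi> x \<in> S.span D" using D(3) by auto
        then obtain r where r: "\<phi> x = (\<Sum>u\<in>D. scale (r u) u)"
          using S.span_finite[OF finD] by auto
        also have "\<dots> = \<phi> (V.lincomb (r \<circ> \<phi>) A)"
          unfolding lincomb[OF fA A] \<phi>A[symmetric] by (simp add: sum.reindex injA)
        finally have "x = V.lincomb (r \<circ> \<phi>) A"
          using x A by (intro eqI) (auto intro!: V.lincomb_closed)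
        then show "x \<in> V.span A"
          unfolding V.span_def using fA by auto
      qed
    qed
  qed (use A in auto)
  then have "V.dim = card A"
    using fA by (intro V.dim_basis) auto
  also have "card A = card D"
    using \<phi>A injA card_image by metis
  finally show ?thesis using D(4) by simp
qed

definition fun_scale :: "'f::field \<Rightarrow> ('x \<Rightarrow> 'f) \<Rightarrow> 'x \<Rightarrow> 'f"
  where "fun_scale c f = (\<lambda>x. c * f x)"

interpretation fun_space: vector_space "fun_scale :: 'f::field \<Rightarrow> ('x \<Rightarrow> 'f) \<Rightarrow> _"
  by unfold_locales (auto simp: fun_scale_def fun_eq_iff algebra_simps)

section \<open>Dimensions of quotients and of spans of indexed families\<close>

context vector_space
begin

lemma coset_eq_iff:
  assumes "subspace W"
  shows "coset W x = coset W y \<longleftrightarrow> x - y \<in> W"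
proof
  assume eq: "coset W x = coset W y"
  have "x \<in> coset W x" using subspace_0[OF assms] by (force simp: coset_def)
  then show "x - y \<in> W" unfolding eq by (auto simp: coset_def)
next
  assume xy: "x - y \<in> W"
  have "coset W x \<subseteq> coset W y" if "x - y \<in> W" for x y
  proof
    fix z assume "z \<in> coset W x"
    then obtain w where "w \<in> W" "z = x + w" by (auto simp: coset_def)
    then show "z \<in> coset W y"
      using subspace_add[OF assms that, of w] by (auto simp: coset_def intro!: exI[of _ "x - y + w"])
  qed
  from this[OF xy] this[of y x] show "coset W x = coset W y"
    using subspace_neg[OF assms xy] by auto
qed

lemma UN_coset_add:
  assumes "subspace W"
  shows "(\<Union>x'\<in>coset W x. \<Union>y'\<in>coset W y. coset W (x' + y')) = coset W (x + y)"
proof -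
  have "coset W (x' + y') = coset W (x + y)" if "x' \<in> coset W x" "y' \<in> coset W y" for x' y'
    using that subspace_add[OF assms] unfolding coset_eq_iff[OF assms]
    by (auto simp: coset_def algebra_simps)
  moreover have "x \<in> coset W x" "y \<in> coset W y"
    using subspace_0[OF assms] by (force simp: coset_def)+
  ultimately show ?thesis by blast
qed

lemma UN_coset_scale:
  assumes "subspace W"
  shows "(\<Union>x'\<in>coset W x. coset W (scale c x')) = coset W (scale c x)"
proof -
  have "coset W (scale c x') = coset W (scale c x)" if "x' \<in> coset W x" for x'
    using that subspace_scale[OF assms] unfolding coset_eq_iff[OF assms]
    by (auto simp: coset_def scale_right_distrib)
  moreover have "x \<in> coset W x"
    using subspace_0[OF assms] by (force simp: coset_def)
  ultimately show ?thesis by blast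
qed

text \<open>By the homomorphism theorem U/W is isomorphic to its image under \<open>E\<close>. Only
  carrier, zero, addition and scaling of \<open>V\<close> are prescribed, so that this serves both
  the quotient defining the codimension and the images of the \<open>A t\<close> inside the algebra
  A/J.\<close>

lemma module_dim_cosets:
  fixes V :: "('a, 'b set) module" and scale' :: "'a \<Rightarrow> 'c::ab_group_add \<Rightarrow> 'c"
  assumes lin: "Vector_Spaces.linear scale scale' E"
    and U: "subspace U" and W: "subspace W"
    and ker: "\<And>w. w \<in> W \<Longrightarrow> E w = 0" "\<And>x. x \<in> U \<Longrightarrow> E x = 0 \<Longrightarrow> x \<in> W"
    and V: "carrier V = coset W ` U" "zero V = W"
      "add V = (\<lambda>X Y. \<Union>x\<in>X. \<Union>y\<in>Y. coset W (x + y))"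
      "module.smult V = (\<lambda>c X. \<Union>x\<in>X. coset W (scale c x))"
    and fin: "finite B" "E ` U \<subseteq> module.span scale' B"
  shows "module_dim V = vector_space.dim scale' (E ` U)"
proof -
  interpret E: Vector_Spaces.linear scale scale' E by fact
  \<comment> \<open>\<open>E\<close> is constant on cosets because \<open>W\<close> lies in its
    kernel, so the chosen representative does not matter.\<close>
  define \<phi> where "\<phi> X = E (SOME x. x \<in> X)" for X
  have \<phi>: "\<phi> (coset W x) = E x" for x
  proof -
    have "x \<in> coset W x" using subspace_0[OF W] by (force simp: coset_def)
    then have "(SOME y. y \<in> coset W x) \<in> coset W x" by (rule someI)
    then show ?thesis unfolding \<phi>_def by (auto simp: coset_def E.add ker(1))
  qed
  have zero: "coset W 0 = W" by (auto simp: coset_def)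
  have im: "\<phi> ` carrier V = E ` U"
    unfolding V(1) image_image \<phi> ..
  have "module_dim V = vector_space.dim scale' (\<phi> ` carrier V)"
  proof (rule module_dim_eq)
    show "vector_space scale'" by (rule E.vs2.vector_space_axioms)
    show "inj_on \<phi> (carrier V)"
      unfolding V(1)
    proof (rule inj_onI, clarify)
      fix x y assume xy: "x \<in> U" "y \<in> U" "\<phi> (coset W x) = \<phi> (coset W y)"
      then have "E (x - y) = 0" by (simp add: \<phi> E.diff)
      then show "coset W x = coset W y"
        using xy U by (simp add: coset_eq_iff[OF W] ker(2) subspace_diff)
    qed
    show "\<zero>\<^bsub>V\<^esub> \<in> carrier V" "\<phi> \<zero>\<^bsub>V\<^esub> = 0"
      using \<phi>[of 0] subspace_0[OF U] unfolding V zero by (auto intro: image_eqI[of _ _ 0] simp: zero)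
    show "x \<oplus>\<^bsub>V\<^esub> y \<in> carrier V \<and> \<phi> (x \<oplus>\<^bsub>V\<^esub> y) = \<phi> x + \<phi> y"
      if "x \<in> carrier V" "y \<in> carrier V" for x y
      using that unfolding V
      by (auto simp: UN_coset_add[OF W] \<phi> E.add intro!: imageI subspace_add[OF U])
    show "c \<odot>\<^bsub>V\<^esub> x \<in> carrier V \<and> \<phi> (c \<odot>\<^bsub>V\<^esub> x) = scale' c (\<phi> x)" if "x \<in> carrier V" for c x
      using that unfolding V
      by (auto simp: UN_coset_scale[OF W] \<phi> E.scale intro!: imageI subspace_scale[OF U])
    show "finite B" "\<phi> ` carrier V \<subseteq> module.span scale' B"
      using fin im by auto
  qed
  then show ?thesis by (simp add: im)
qed

text \<open>\<open>independent\<close> speaks of sets while the families below are indexed;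
  injectivity ensures that no member is lost in the image.\<close>

lemma independent_family:
  assumes "finite S" and ind: "\<And>c. (\<Sum>s\<in>S. scale (c s) (g s)) = 0 \<Longrightarrow> \<forall>s\<in>S. c s = 0"
  shows "inj_on g S" "independent (g ` S)"
proof -
  show inj: "inj_on g S"
  proof (rule inj_onI, rule ccontr)
    fix s s' assume s: "s \<in> S" "s' \<in> S" "g s = g s'" "s \<noteq> s'"
    let ?c = "\<lambda>x. if x = s then 1 else if x = s' then - 1 else (0::'a)"
    have "(\<Sum>x\<in>S. scale (?c x) (g x)) = (\<Sum>x\<in>{s, s'}. scale (?c x) (g x))"
      using assms(1) s by (intro sum.mono_neutral_right) auto
    also have "\<dots> = 0" using s by simp
    finally show False using ind[of ?c] s by auto
  qed
  show "independent (g ` S)"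
    unfolding independent_explicit_module
  proof (intro allI impI)
    fix t u v assume t: "finite t" "t \<subseteq> g ` S" and sum: "(\<Sum>v\<in>t. scale (u v) v) = 0" and v: "v \<in> t"
    let ?c = "\<lambda>s. if g s \<in> t then u (g s) else 0"
    have "(\<Sum>s\<in>S. scale (?c s) (g s)) = (\<Sum>x\<in>g ` S. scale (if x \<in> t then u x else 0) x)"
      by (simp add: sum.reindex[OF inj])
    also have "\<dots> = (\<Sum>x\<in>t. scale (u x) x)"
      using t assms(1) by (intro sum.mono_neutral_cong_right) auto
    finally have "\<forall>s\<in>S. ?c s = 0" using ind[of ?c] sum by simp
    moreover obtain s where "s \<in> S" "v = g s" using v t by auto
    ultimately show "u v = 0" using v by auto
  qed
qed

lemma dim_span_family:
  assumes "finite S" "\<And>c. (\<Sum>s\<in>S. scale (c s) (g s)) = 0 \<Longrightarrow> \<forall>s\<in>S. c s = 0"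
  shows "dim (span (g ` S)) = card S"
  using independent_family[OF assms] by (simp add: dim_span dim_eq_card_independent card_image)

text \<open>The finite set \<open>B\<close> guarantees that a basis of \<open>U\<close> is finite,
  so that its cardinality \<open>dim U\<close> is a genuine bound.\<close>

lemma card_le_dim:
  assumes "independent S" "S \<subseteq> U" "finite B" "U \<subseteq> span B"
  shows "card S \<le> dim U"
proof -
  obtain D where D: "D \<subseteq> U" "independent D" "U \<subseteq> span D" "card D = dim U"
    using basis_exists by blast
  have "finite D" using independent_span_bound[OF assms(3) D(2)] D(1) assms(4) by blast
  then show ?thesis
    using independent_span_bound[OF _ assms(1), of D] assms(2) D by auto
qed

end

lemma sum_fun_apply: "(\<Sum>s\<in>S. f s) x = (\<Sum>s\<in>S. (f s x :: 'b::comm_monoid_add))"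
  by (induction S rule: infinite_finite_induct) auto

lemma fun_space_span_support:
  assumes "finite Y" "\<And>y. y \<notin> Y \<Longrightarrow> f y = (0::'f::field)"
  shows "f \<in> fun_space.span ((\<lambda>y. \<lambda>x. if x = y then 1 else 0) ` Y)"
proof -
  have "f = (\<Sum>y\<in>Y. fun_scale (f y) (\<lambda>x. if x = y then 1 else 0))"
  proof
    fix x
    have "(\<Sum>y\<in>Y. fun_scale (f y) (\<lambda>x. if x = y then 1 else 0)) x
        = (\<Sum>y\<in>Y. fun_scale (f y) (\<lambda>x. if x = y then 1 else 0) x)"
      by (rule sum_fun_apply)
    also have "\<dots> = (\<Sum>y\<in>Y. if y = x then f x else 0)"
      by (intro sum.cong) (auto simp: fun_scale_def)
    finally show "f x = (\<Sum>y\<in>Y. fun_scale (f y) (\<lambda>x. if x = y then 1 else 0)) x"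
      using assms by (auto simp: sum.delta)
  qed
  also have "\<dots> \<in> fun_space.span ((\<lambda>y. \<lambda>x. if x = y then 1 else 0) ` Y)"
    by (intro fun_space.span_sum fun_space.span_scale fun_space.span_base imageI)
  finally show ?thesis .
qed


section \<open>Words of given content\<close>

lemma sum_prod_list_power:
  fixes f :: "'t \<Rightarrow> 'b::comm_semiring_1"
  assumes "finite T"
  shows "(\<Sum>xs | set xs \<subseteq> T \<and> length xs = n. prod_list (map f xs)) = (\<Sum>t\<in>T. f t) ^ n"
proof (induction n)
  case 0
  have "{xs :: 't list. set xs \<subseteq> T \<and> length xs = 0} = {[]}" by auto
  then show ?case by simp
next
  case (Suc n)
  let ?L = "\<lambda>n. {xs. set xs \<subseteq> T \<and> length xs = n}"
  have eq: "?L (Suc n) = (\<lambda>(x, xs). x # xs) ` (T \<times> ?L n)"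
    by (auto simp: length_Suc_conv image_iff)
  have inj: "inj_on (\<lambda>(x, xs). x # xs) (T \<times> ?L n)" by (auto simp: inj_on_def)
  have "(\<Sum>xs\<in>?L (Suc n). prod_list (map f xs))
      = (\<Sum>(x, xs)\<in>T \<times> ?L n. f x * prod_list (map f xs))"
    unfolding eq by (subst sum.reindex[OF inj]) (auto simp: case_prod_unfold)
  also have "\<dots> = (\<Sum>x\<in>T. f x) * (\<Sum>xs\<in>?L n. prod_list (map f xs))"
    by (simp add: sum.cartesian_product[symmetric] sum_product)
  finally show ?case using Suc by simp
qed

text \<open>The quotient of the terms for c + 1 and c is m / (c + 1): they do not decrease while c <
  m and do not increase from c = m on. So m is a mode of these Poisson weights.\<close>

lemma power_div_fact_le_diag: "real m ^ c / fact c \<le> real m ^ m / fact m"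
proof (cases "m \<le> c")
  case True
  have *: "real m ^ d * fact m \<le> fact (m + d)" for d
  proof (induction d)
    case (Suc d)
    have "real m ^ Suc d * fact m = real m * (real m ^ d * fact m)" by simp
    also have "\<dots> \<le> real (m + Suc d) * fact (m + d)"
      using Suc by (intro mult_mono) auto
    also have "\<dots> = fact (m + Suc d)" by simp
    finally show ?case .
  qed simp
  obtain d where "c = m + d" using True le_Suc_ex by blast
  then show ?thesis
    using *[of d] mult_left_mono[OF *[of d], of "real m ^ m"]
    by (simp add: field_simps power_add)
next
  case False
  have *: "d \<le> m \<Longrightarrow> fact m \<le> real m ^ d * fact (m - d)" for d
  proof (induction d)
    case (Suc d)
    have "fact (m - d) = real (m - d) * (fact (m - Suc d) :: real)"
      using Suc.prems by (metis Suc_diff_Suc Suc_le_lessD fact_Suc of_nat_mult of_nat_fact)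
    also have "\<dots> \<le> real m * fact (m - Suc d)" by (intro mult_right_mono) auto
    finally have "real m ^ d * fact (m - d) \<le> real m ^ d * (real m * fact (m - Suc d))"
      by (intro mult_left_mono) auto
    also have "\<dots> = real m ^ Suc d * fact (m - Suc d)" by simp
    finally have "real m ^ d * fact (m - d) \<le> real m ^ Suc d * fact (m - Suc d)" .
    moreover have "fact m \<le> real m ^ d * fact (m - d)" using Suc by simp
    ultimately show ?case by (rule order_trans[rotated])
  qed simp
  obtain d where d: "m = c + d" using False le_Suc_ex nat_le_linear by blast
  have "fact m \<le> real m ^ d * fact c" using *[of d] d by simp
  then have "real m ^ c * fact m \<le> real m ^ c * (real m ^ d * fact c)"
    by (intro mult_left_mono) auto
  also have "\<dots> = real m ^ m * fact c" by (simp add: d power_add)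
  finally show ?thesis by (simp add: field_simps)
qed

lemma prod_list_eq_prod_count:
  fixes f :: "'t \<Rightarrow> 'b::comm_monoid_mult"
  assumes "finite T" "set xs \<subseteq> T"
  shows "prod_list (map f xs) = (\<Prod>t\<in>T. f t ^ count (mset xs) t)"
  using assms(2)
proof (induction xs)
  case (Cons x xs)
  have "(\<Prod>t\<in>T. f t ^ count (mset (x # xs)) t)
      = (\<Prod>t\<in>T. (if t = x then f t else 1) * f t ^ count (mset xs) t)"
    by (intro prod.cong) auto
  also have "\<dots> = f x * (\<Prod>t\<in>T. f t ^ count (mset xs) t)"
    using Cons.prems assms(1) by (simp add: prod.distrib prod.delta)
  finally show ?case using Cons by simp
qed simp

text \<open>Among all contents of words of length \<open>N\<close>, weighting each letter by its frequency in \<open>M\<close>,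
  the content \<open>M\<close> itself carries the largest share of \<open>N ^ N\<close>.\<close>
lemma card_permutations_of_multiset_ge:
  fixes M :: "'t multiset"
  assumes T: "finite T" "set_mset M \<subseteq> T"
  shows "real (size M) ^ size M \<le> real (size M + 1) ^ card T *
    (real (card (permutations_of_multiset M)) * (\<Prod>t\<in>T. real (count M t) ^ count M t))"
proof -
  let ?N = "size M"
  let ?L = "{xs. set xs \<subseteq> T \<and> length xs = ?N}"
  define w where "w Q = real (card (permutations_of_multiset Q)) *
    (\<Prod>t\<in>T. real (count M t) ^ count Q t)" for Q
  have finL: "finite ?L" using T(1) by (rule finite_lists_length_eq)
  have card_perm: "real (card (permutations_of_multiset Q)) = fact ?N / (\<Prod>t\<in>T. fact (count Q t))"
    if "size Q = ?N" "set_mset Q \<subseteq> T" for Q :: "'t multiset"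
  proof -
    have "(\<Prod>t\<in>set_mset Q. fact (count Q t)) = (\<Prod>t\<in>T. fact (count Q t) :: nat)"
      using that T(1) by (intro prod.mono_neutral_left) (auto simp: not_in_iff)
    then have "card (permutations_of_multiset Q) * (\<Prod>t\<in>T. fact (count Q t)) = fact ?N"
      using card_permutations_of_multiset_aux[of Q] that by (simp add: mult.commute)
    then have "real (card (permutations_of_multiset Q) * (\<Prod>t\<in>T. fact (count Q t))) = real (fact ?N)"
      by (rule arg_cong)
    then have "real (card (permutations_of_multiset Q)) * (\<Prod>t\<in>T. fact (count Q t)) = fact ?N"
      by (simp only: of_nat_prod of_nat_mult of_nat_fact)
    moreover have "(\<Prod>t\<in>T. fact (count Q t) :: real) \<noteq> 0" using T(1) by simp
    ultimately show ?thesis by (simp add: field_simps)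
  qed
  have w_le: "w Q \<le> w M" if "size Q = ?N" "set_mset Q \<subseteq> T" for Q
  proof -
    \<comment> \<open>A multinomial coefficient is N! over a product of factorials, so
      \<open>w\<close> factors over the letters, and each factor is largest at the multiplicity
      prescribed by \<open>M\<close>.\<close>
    have w_eq: "w Q = fact ?N * (\<Prod>t\<in>T. real (count M t) ^ count Q t / fact (count Q t))"
      if "size Q = ?N" "set_mset Q \<subseteq> T" for Q
      unfolding w_def card_perm[OF that] by (simp add: prod_dividef)
    show ?thesis
      unfolding w_eq[OF that] w_eq[OF refl T(2)]
      by (intro mult_left_mono prod_mono) (auto intro: power_div_fact_le_diag)
  qed
  have "(\<Sum>t\<in>T. count M t) = ?N"
    unfolding size_multiset_overloaded_eq using T by (intro sum.mono_neutral_right) (auto simp: not_in_iff)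
  then have "real ?N ^ ?N = (\<Sum>xs\<in>?L. prod_list (map (\<lambda>t. real (count M t)) xs))"
    unfolding sum_prod_list_power[OF T(1)] by (simp flip: of_nat_sum)
  also have "\<dots> = (\<Sum>Q\<in>mset ` ?L. \<Sum>xs\<in>{x \<in> ?L. mset x = Q}. prod_list (map (\<lambda>t. real (count M t)) xs))"
    using finL by (rule sum.image_gen)
  also have "\<dots> = (\<Sum>Q\<in>mset ` ?L. w Q)"
  proof (rule sum.cong[OF refl])
    fix Q assume "Q \<in> mset ` ?L"
    then have Q: "size Q = ?N" "set_mset Q \<subseteq> T" by auto
    have "{x \<in> ?L. mset x = Q} = permutations_of_multiset Q"
      using Q by (auto simp: permutations_of_multiset_def)
    moreover have "prod_list (map (\<lambda>t. real (count M t)) xs) = (\<Prod>t\<in>T. real (count M t) ^ count Q t)"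
      if "xs \<in> permutations_of_multiset Q" for xs
      using that Q prod_list_eq_prod_count[OF T(1), of xs]
      by (auto simp: permutations_of_multiset_def)
    ultimately show "(\<Sum>xs\<in>{x \<in> ?L. mset x = Q}. prod_list (map (\<lambda>t. real (count M t)) xs)) = w Q"
      by (simp add: w_def)
  qed
  also have "\<dots> \<le> (\<Sum>Q\<in>mset ` ?L. w M)"
    by (intro sum_mono w_le) auto
  also have "\<dots> = real (card (mset ` ?L)) * w M" by simp
  also have "\<dots> \<le> real (?N + 1) ^ card T * w M"
  proof (rule mult_right_mono)
    have "card (mset ` ?L) \<le> card (T \<rightarrow>\<^sub>E {..?N})"
    proof (rule card_inj_on_le)
      show "inj_on (\<lambda>Q. restrict (count Q) T) (mset ` ?L)"
      proof (rule inj_onI)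
        fix P Q :: "'t multiset"
        assume PQ: "P \<in> mset ` ?L" "Q \<in> mset ` ?L" and eq: "restrict (count P) T = restrict (count Q) T"
        show "P = Q"
        proof (rule multiset_eqI)
          fix t
          show "count P t = count Q t"
          proof (cases "t \<in> T")
            case True
            then show ?thesis using fun_cong[OF eq, of t] by simp
          next
            case False
            then have "t \<notin># P" "t \<notin># Q" using PQ by auto
            then show ?thesis by (simp add: not_in_iff)
          qed
        qed
      qed
      show "(\<lambda>Q. restrict (count Q) T) ` mset ` ?L \<subseteq> T \<rightarrow>\<^sub>E {..?N}"
      proof (intro image_subsetI)
        fix Q assume "Q \<in> mset ` ?L"
        then obtain xs where xs: "Q = mset xs" "length xs = ?N" by auto
        have "count (mset xs) t \<le> ?N" for t
          unfolding count_mset xs(2)[symmetric] count_list_eq_length_filter by (rule length_filter_le)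
        then show "restrict (count Q) T \<in> T \<rightarrow>\<^sub>E {..?N}"
          unfolding xs(1) by (intro restrict_PiE_iff[THEN iffD2]) simp
      qed
    qed (use T(1) in \<open>auto intro: finite_PiE\<close>)
    also have "\<dots> = (?N + 1) ^ card T"
      using T(1) by (simp add: card_PiE)
    finally show "real (card (mset ` ?L)) \<le> real (?N + 1) ^ card T"
      by (metis of_nat_le_iff of_nat_power)
    show "0 \<le> w M" by (simp add: w_def prod_nonneg)
  qed
  finally show ?thesis by (simp add: w_def)
qed


section \<open>Dyck words and matchings\<close>

text \<open>\<open>False\<close> opens and \<open>True\<close> closes. Read as coordinate indices,
  an opening letter and its closing letter give \<open>det2\<close> the value 1.\<close>

definition height :: "bool list \<Rightarrow> int"
  where "height xs = (\<Sum>x\<leftarrow>xs. if x then - 1 else 1)"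

definition dyck :: "bool list \<Rightarrow> bool"
  where "dyck xs \<longleftrightarrow> height xs = 0 \<and> (\<forall>i\<le>length xs. 0 \<le> height (take i xs))"

lemma height_simps [simp]:
  "height [] = 0" "height (x # xs) = (if x then - 1 else 1) + height xs"
  "height (xs @ ys) = height xs + height ys"
  by (auto simp: height_def)

text \<open>Cutting a balanced word at a point of minimal height turns it into a Dyck word.\<close>
lemma balanced_is_rotated_dyck:
  assumes "height xs = 0"
  shows "\<exists>r\<le>length xs. \<exists>ys. dyck ys \<and> length ys = length xs \<and> xs = rotate r ys"
proof -
  let ?h = "\<lambda>i. height (take i xs)"
  have "\<exists>i\<in>{..length xs}. \<forall>j\<in>{..length xs}. ?h i \<le> ?h j"
    using ex_min_if_finite[of "?h ` {..length xs}"] by (auto simp: not_less)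
  then obtain i where i: "i \<le> length xs" and min: "\<And>j. j \<le> length xs \<Longrightarrow> ?h i \<le> ?h j"
    by auto
  define ys where "ys = drop i xs @ take i xs"
  have tot: "?h i + height (drop i xs) = 0"
    using assms height_simps(3)[of "take i xs" "drop i xs"] by simp
  have "dyck ys"
    unfolding dyck_def
  proof (intro conjI allI impI)
    show "height ys = 0" using tot by (simp add: ys_def)
  next
    fix j assume j: "j \<le> length ys"
    show "0 \<le> height (take j ys)"
    proof (cases "j \<le> length xs - i")
      case True
      then have "take (i + j) xs = take i xs @ take j ys"
        using i by (simp add: ys_def take_add)
      then have "?h (i + j) = ?h i + height (take j ys)" by simp
      moreover have "i + j \<le> length xs" using True i by simp
      ultimately show ?thesis using min[of "i + j"] by linarith
    next
      case False
      define k where "k = j - (length xs - i)"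
      have k: "k \<le> i" using j i False by (simp add: k_def ys_def)
      have "take j ys = drop i xs @ take k xs"
        using False k by (simp add: ys_def k_def min_def)
      then show ?thesis using tot min[of k] k i by simp
    qed
  qed
  moreover have "xs = rotate (length xs - i) ys"
    using rotate_append[of "drop i xs" "take i xs"] i by (simp add: ys_def)
  ultimately show ?thesis
    using i by (intro exI[of _ "length xs - i"]) (auto simp: ys_def intro!: exI[of _ ys])
qed

text \<open>The words with k letters of each kind number at least 4^k / (2 k + 1)^2 by the
  multinomial bound for two letters, and each is one of at most 2 k + 1 rotations of some Dyck word;
  hence the cube.\<close>

lemma card_dyck_ge:
  "2 ^ (2 * k) \<le> real (2 * k + 1) ^ 3 * real (card {xs. length xs = 2 * k \<and> dyck xs})"
proof -
  define M where "M = replicate_mset k True + replicate_mset k False"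
  define Dy where "Dy = {xs. length xs = 2 * k \<and> dyck xs}"
  have fin: "finite Dy"
    by (rule finite_subset[OF _ finite_lists_length_eq[of "UNIV :: bool set" "2 * k"]]) (auto simp: Dy_def)
  have size: "size M = 2 * k" by (simp add: M_def)
  define p where "p = real (card (permutations_of_multiset M))"
  have prod: "(\<Prod>t\<in>UNIV. real (count M t) ^ count M t) = real k ^ (2 * k)"
    by (simp add: UNIV_bool M_def mult_2 power_add)
  have "real (2 * k) ^ (2 * k) \<le> real (2 * k + 1) ^ 2 * (p * real k ^ (2 * k))"
    using card_permutations_of_multiset_ge[OF finite_class.finite_UNIV subset_UNIV, of M]
    unfolding size prod p_def by (simp add: UNIV_bool power2_eq_square)
  moreover have "real (2 * k) ^ (2 * k) = 2 ^ (2 * k) * real k ^ (2 * k)"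
    by (simp add: power_mult_distrib)
  ultimately have "2 ^ (2 * k) * real k ^ (2 * k) \<le> (real (2 * k + 1) ^ 2 * p) * real k ^ (2 * k)"
    by (simp only: mult.assoc)
  \<comment> \<open>For k = 0 this is 0^0 = 1.\<close>
  moreover have "0 < real k ^ (2 * k)" by (cases "k = 0") simp_all
  ultimately have "2 ^ (2 * k) \<le> real (2 * k + 1) ^ 2 * p"
    by (rule mult_right_le_imp_le)
  moreover have "card (permutations_of_multiset M) \<le> (2 * k + 1) * card Dy"
  proof -
    have "xs \<in> (\<lambda>(r, ys). rotate r ys) ` ({..2 * k} \<times> Dy)" if "xs \<in> permutations_of_multiset M" for xs
    proof -
      have m: "mset xs = M" using that by (simp add: permutations_of_multiset_def)
      have "height xs = sum_mset (image_mset (\<lambda>x. if x then - 1 else 1) (mset xs))"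
        unfolding height_def by (metis mset_map sum_mset_sum_list)
      then have "height xs = 0" by (simp add: m M_def)
      moreover have "length xs = 2 * k" using m size by (metis size_mset)
      ultimately show ?thesis
        using balanced_is_rotated_dyck[of xs] by (force simp: Dy_def)
    qed
    then have "card (permutations_of_multiset M) \<le> card ((\<lambda>(r, ys). rotate r ys) ` ({..2 * k} \<times> Dy))"
      using fin by (intro card_mono) auto
    also have "\<dots> \<le> card ({..2 * k} \<times> Dy)" using fin by (intro card_image_le) auto
    finally show ?thesis by (simp add: card_cartesian_product)
  qed
  then have "p \<le> real (2 * k + 1) * real (card Dy)"
    unfolding p_def by (metis of_nat_le_iff of_nat_mult)
  then have "real (2 * k + 1) ^ 2 * p \<le> real (2 * k + 1) ^ 2 * (real (2 * k + 1) * real (card Dy))"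
    by (intro mult_left_mono) auto
  also have "\<dots> = real (2 * k + 1) ^ 3 * real (card Dy)"
    by (simp add: power3_eq_cube power2_eq_square mult.assoc)
  finally show ?thesis using \<open>2 ^ (2 * k) \<le> _\<close> unfolding Dy_def by simp
qed

text \<open>For a list without repetitions, equality of multisets says at once that the pairs are
  disjoint and cover it. Pairs stay ordered, which fixes the signs of the minors.\<close>

definition perfect_matching :: "nat list \<Rightarrow> (nat \<times> nat) list \<Rightarrow> bool"
  where "perfect_matching X M \<longleftrightarrow> mset (map fst M @ map snd M) = mset X"

text \<open>Parentheses are matched with a stack: after each prefix, \<open>U\<close> holds the
  positions of unmatched opening letters and its length is the height. A closing letter takes the
  head of \<open>U\<close>, which exists because the height stays nonnegative.\<close>

lemma dyck_matching:
  assumes "dyck xs"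
  shows "\<exists>M. perfect_matching [0..<length xs] M \<and> (\<forall>(i, j)\<in>set M. i < j \<and> \<not> xs ! i \<and> xs ! j)"
proof -
  have "\<exists>M U. mset (map fst M @ map snd M @ U) = mset [0..<length xs] \<and>
      (\<forall>(i, j)\<in>set M. i < j \<and> \<not> xs ! i \<and> xs ! j) \<and> (\<forall>i\<in>set U. \<not> xs ! i) \<and> int (length U) = height xs"
    if "\<forall>i\<le>length xs. 0 \<le> height (take i xs)"
    using that
  proof (induction xs rule: rev_induct)
    case (snoc x xs)
    have "\<forall>i\<le>length xs. 0 \<le> height (take i xs)"
    proof (intro allI impI)
      fix i assume "i \<le> length xs"
      then show "0 \<le> height (take i xs)" using snoc.prems[rule_format, of i] by simp
    qed
    then obtain M U where MU: "mset (map fst M @ map snd M @ U) = mset [0..<length xs]"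
      "\<forall>(i, j)\<in>set M. i < j \<and> \<not> xs ! i \<and> xs ! j" "\<forall>i\<in>set U. \<not> xs ! i"
      "int (length U) = height xs"
      using snoc.IH by blast
    have s: "set (map fst M @ map snd M @ U) = {0..<length xs}"
      using mset_eq_setD[OF MU(1)] by simp
    have lt: "i < length xs" if "i \<in> fst ` set M \<union> snd ` set M \<union> set U" for i
    proof -
      have "i \<in> set (map fst M @ map snd M @ U)" using that by auto
      then show ?thesis unfolding s by simp
    qed
    have nth: "(xs @ [x]) ! i = xs ! i" if "i \<in> fst ` set M \<union> snd ` set M \<union> set U" for i
      using lt[OF that] by (simp add: nth_append)
    have M': "\<forall>(i, j)\<in>set M. i < j \<and> \<not> (xs @ [x]) ! i \<and> (xs @ [x]) ! j"
    proof clarify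
      fix i j assume ij: "(i, j) \<in> set M"
      then have "i \<in> fst ` set M" "j \<in> snd ` set M" by (auto intro: rev_image_eqI)
      then show "i < j \<and> \<not> (xs @ [x]) ! i \<and> (xs @ [x]) ! j"
        using MU(2) ij nth[of i] nth[of j] by auto
    qed
    have U': "\<forall>i\<in>set U. \<not> (xs @ [x]) ! i" using MU(3) nth by auto
    show ?case
    proof (cases x)
      case False
      then show ?thesis
        using MU M' U' by (intro exI[of _ M] exI[of _ "length xs # U"]) auto
    next
      case True
      have "0 \<le> height (xs @ [x])" using snoc.prems[rule_format, of "length (xs @ [x])"] by simp
      then have "U \<noteq> []" using MU(4) True by auto
      then obtain u V where U: "U = u # V" by (cases U) auto
      have "u < length xs" using lt[of u] U by auto
      then show ?thesis
        using MU M' U' U True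
        by (intro exI[of _ "(u, length xs) # M"] exI[of _ V]) auto
    qed
  qed simp
  then obtain M U where "mset (map fst M @ map snd M @ U) = mset [0..<length xs]"
      "\<forall>(i, j)\<in>set M. i < j \<and> \<not> xs ! i \<and> xs ! j" "int (length U) = height xs"
    using assms by (auto simp: dyck_def)
  then show ?thesis using assms by (intro exI[of _ M]) (auto simp: dyck_def perfect_matching_def)
qed

definition weight :: "bool list \<Rightarrow> nat"
  where "weight xs = (\<Sum>i\<leftarrow>[0..<length xs]. if xs ! i then i else 0)"

lemma sum_list_perfect_matching:
  fixes f :: "nat \<Rightarrow> 'b::comm_monoid_add"
  assumes "perfect_matching X M"
  shows "(\<Sum>i\<leftarrow>X. f i) = (\<Sum>(i, j)\<leftarrow>M. f i + f j)"
proof -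
  have "(\<Sum>i\<leftarrow>X. f i) = sum_mset (image_mset f (mset (map fst M @ map snd M)))"
    using assms unfolding perfect_matching_def by (metis mset_map sum_mset_sum_list)
  also have "\<dots> = (\<Sum>i\<leftarrow>map fst M @ map snd M. f i)"
    by (metis mset_map sum_mset_sum_list)
  also have "\<dots> = (\<Sum>(i, j)\<leftarrow>M. f i + f j)"
    by (induction M) (auto simp: ac_simps)
  finally show ?thesis .
qed

text \<open>Exchanging the two letters of a matched pair of a Dyck word moves a \<open>True\<close> to the left.\<close>
lemma weight_triangular:
  assumes M: "perfect_matching [0..<length xs] M" "\<forall>(i, j)\<in>set M. i < j \<and> \<not> xs ! i \<and> xs ! j"
    and ys: "length ys = length xs" "\<forall>(i, j)\<in>set M. ys ! i \<noteq> ys ! j"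
  shows "ys = xs \<or> weight ys < weight xs"
proof -
  let ?g = "\<lambda>zs (i, j). (if zs ! i then i else 0) + (if zs ! j then j else (0::nat))"
  have w: "weight zs = (\<Sum>p\<leftarrow>M. ?g zs p)" if "length zs = length xs" for zs
    unfolding weight_def that sum_list_perfect_matching[OF M(1)] by (simp add: case_prod_unfold)
  \<comment> \<open>Exactly one position of each pair carries \<open>True\<close> in
    \<open>ys\<close>; the pair contributes i or j there, but the larger number j in
    \<open>xs\<close>.\<close>
  have le: "?g ys p \<le> ?g xs p" if "p \<in> set M" for p
  proof (cases p)
    case (Pair i j)
    then have "i < j" "\<not> xs ! i" "xs ! j" "ys ! i \<noteq> ys ! j" using that M(2) ys(2) by auto
    then show ?thesis using Pair by simp
  qed
  show ?thesis
  proof (cases "\<forall>(i, j)\<in>set M. \<not> ys ! i")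
    case True
    have "ys ! i = xs ! i" if "i < length xs" for i
    proof -
      have "i \<in> set (map fst M @ map snd M)"
        using M(1) that mset_eq_setD unfolding perfect_matching_def by fastforce
      then obtain k l where "(k, l) \<in> set M" "i = k \<or> i = l" by auto
      moreover from this have "\<not> ys ! k" "\<not> xs ! k" "ys ! k \<noteq> ys ! l" "xs ! l"
        using True M(2) ys(2) by auto
      ultimately show ?thesis by auto
    qed
    then have "ys = xs" using ys(1) by (intro nth_equalityI) auto
    then show ?thesis ..
  next
    case False
    then obtain p where p: "p \<in> set M" "ys ! fst p" by auto
    have lt: "?g ys p < ?g xs p"
    proof (cases p)
      case (Pair i j)
      then have "i < j" "\<not> xs ! i" "xs ! j" "ys ! i" "\<not> ys ! j" using p M(2) ys(2) by auto
      then show ?thesis using Pair by simp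
    qed
    obtain M1 M2 where M12: "M = M1 @ p # M2" using p(1) by (meson split_list)
    have "(\<Sum>p\<leftarrow>M1. ?g ys p) \<le> (\<Sum>p\<leftarrow>M1. ?g xs p)" "(\<Sum>p\<leftarrow>M2. ?g ys p) \<le> (\<Sum>p\<leftarrow>M2. ?g xs p)"
      using le M12 by (intro sum_list_mono; simp)+
    then have "weight ys < weight xs"
      using lt w[OF ys(1)] w[OF refl] M12 by simp
    then show ?thesis ..
  qed
qed

text \<open>After sorting by \<open>\<kappa>\<close>, an element and the one \<open>k\<close> places further on have different classes,
  because a class fills at most \<open>k\<close> consecutive places.\<close>
lemma ex_matching_different:
  assumes len: "length X = 2 * k" and small: "\<And>c. length (filter (\<lambda>x. \<kappa> x = c) X) \<le> k"
  shows "\<exists>M. perfect_matching X M \<and> (\<forall>(i, j)\<in>set M. \<kappa> i \<noteq> \<kappa> j)"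
proof -
  \<comment> \<open>An arbitrary numbering of the classes, to have an order to sort by.\<close>
  obtain g :: "'a \<Rightarrow> nat" where g: "inj_on g (\<kappa> ` set X)"
    using finite_imp_inj_to_nat_seg[of "\<kappa> ` set X"] by auto
  define Y where "Y = sort_key (g \<circ> \<kappa>) X"
  have mY: "mset Y = mset X" by (simp add: Y_def)
  have sY: "set Y = set X" and lY: "length Y = 2 * k" by (simp_all add: Y_def len)
  have sorted: "g (\<kappa> (Y ! i)) \<le> g (\<kappa> (Y ! j))" if "i \<le> j" "j < 2 * k" for i j
    using sorted_nth_mono[of "map (g \<circ> \<kappa>) Y" i j] that lY by (simp add: Y_def)
  define M where "M = zip (take k Y) (drop k Y)"
  have "map fst M = take k Y" "map snd M = drop k Y" by (simp_all add: M_def lY)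
  then have "map fst M @ map snd M = Y" by simp
  then have "perfect_matching X M" by (simp add: perfect_matching_def mY)
  moreover have "\<kappa> a \<noteq> \<kappa> b" if ab: "(a, b) \<in> set M" for a b
  proof
    assume eq: "\<kappa> a = \<kappa> b"
    obtain i where i: "i < k" "a = Y ! i" "b = Y ! (i + k)"
      using ab by (auto simp: M_def set_zip lY add.commute)
    have same: "\<kappa> x = \<kappa> a" if "x \<in> set (take (k + 1) (drop i Y))" for x
    proof -
      obtain j where j: "j \<le> k" "x = Y ! (i + j)"
        using \<open>x \<in> _\<close> i lY by (auto simp: in_set_conv_nth less_Suc_eq_le)
      have "g (\<kappa> a) \<le> g (\<kappa> x)" "g (\<kappa> x) \<le> g (\<kappa> b)"
        using sorted[of i "i + j"] sorted[of "i + j" "i + k"] i j by simp_all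
      then have "g (\<kappa> x) = g (\<kappa> a)" using eq by simp
      moreover have "x \<in> set X" "a \<in> set X" using i j lY sY[symmetric] by auto
      ultimately show ?thesis using g by (auto dest: inj_onD)
    qed
    have "k + 1 = length (filter (\<lambda>x. \<kappa> x = \<kappa> a) (take (k + 1) (drop i Y)))"
      using same i lY by simp
    also have "\<dots> \<le> length (filter (\<lambda>x. \<kappa> x = \<kappa> a) Y)"
    proof -
      define Y1 Y2 Y3 where "Y1 = take i Y" "Y2 = take (k + 1) (drop i Y)" "Y3 = drop (k + 1) (drop i Y)"
      have "Y = Y1 @ Y2 @ Y3" unfolding Y1_Y2_Y3_def by (simp only: append_take_drop_id)
      then show ?thesis unfolding Y1_Y2_Y3_def(2)[symmetric] by simp
    qed
    also have "\<dots> = length (filter (\<lambda>x. \<kappa> x = \<kappa> a) X)"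
      using mY by (metis mset_filter size_mset)
    also have "\<dots> \<le> k" by (rule small)
    finally show False by simp
  qed
  ultimately show ?thesis by blast
qed


section \<open>Graded codimensions\<close>

lemma lookup_poly_scale [simp]:
  "Poly_Mapping.lookup (poly_scale c f) w = c * Poly_Mapping.lookup f w"
  by (simp add: poly_scale_def Poly_Mapping.map.rep_eq when_def)

interpretation poly_space: vector_space "poly_scale :: 'f::field \<Rightarrow> ('t, 'f) graded_poly \<Rightarrow> _"
  by unfold_locales (auto intro!: poly_mapping_eqI simp: lookup_add algebra_simps)

abbreviation monomial_poly :: "('t \<times> nat) list \<Rightarrow> ('t, 'f::field) graded_poly"
  where "monomial_poly ls \<equiv> Poly_Mapping.single (Monomial ls) 1"

lemma prod_list_var:
  "prod_list (map (\<lambda>j. var (t j) (\<sigma> j)) js) = monomial_poly (map (\<lambda>j. (t j, \<sigma> j)) js)"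
proof (induction js)
  case Nil
  then show ?case by (simp flip: single_one add: zero_monomial_def)
next
  case (Cons j js)
  then show ?case by (simp add: var_def mult_single plus_monomial_def)
qed

text \<open>A permutation with degrees attached to the positions is the same as a list of letters
  whose indices rearrange 1, ..., n and whose degrees are arbitrary.\<close>

lemma multilinear_polys_eq:
  "(multilinear_polys n :: ('t, 'f::field) graded_poly set) =
    poly_space.span {monomial_poly ls | ls. mset (map snd ls) = mset [1..<n + 1]}"
proof -
  have fwd: "mset (map snd (map (\<lambda>j. (t j, \<sigma> j)) [1..<n + 1])) = mset [1..<n + 1]"
    if "\<sigma> permutes {1..n}" for t :: "nat \<Rightarrow> 't" and \<sigma>
  proof -
    have "image_mset \<sigma> (mset_set {1..n}) = mset_set {1..n}"
      using that by (simp add: image_mset_mset_set permutes_inj_on permutes_image)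
    then show ?thesis by (simp add: comp_def atLeastLessThanSuc_atLeastAtMost del: upt_Suc)
  qed
  have bwd: "\<exists>t \<sigma>. \<sigma> permutes {1..n} \<and> ls = map (\<lambda>j. (t j, \<sigma> j)) [1..<n + 1]"
    if "mset (map snd ls) = mset [1..<n + 1]" for ls :: "('t \<times> nat) list"
  proof -
    have len: "length ls = n" using arg_cong[OF that, of size] by simp
    have set: "set (map snd ls) = {1..n}" using mset_eq_setD[OF that] by auto
    have dist: "distinct (map snd ls)" using mset_eq_imp_distinct_iff[OF that] by simp
    \<comment> \<open>Positions count from 1 in the definition and from 0 in a list; off {1..n} a
      permutation has to be the identity.\<close>
    define \<sigma> where "\<sigma> j = (if j \<in> {1..n} then snd (ls ! (j - 1)) else j)" for j
    have "bij_betw \<sigma> {1..n} {1..n}"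
      unfolding bij_betw_def
    proof
      show "inj_on \<sigma> {1..n}"
      proof (rule inj_onI)
        fix i j assume ij: "i \<in> {1..n}" "j \<in> {1..n}" "\<sigma> i = \<sigma> j"
        then have "map snd ls ! (i - 1) = map snd ls ! (j - 1)"
          using len by (auto simp: \<sigma>_def)
        then have "i - 1 = j - 1"
          using dist len ij by (subst (asm) nth_eq_iff_index_eq) auto
        then show "i = j" using ij by auto
      qed
      have "\<sigma> ` {1..n} \<subseteq> {1..n}"
      proof
        fix k assume "k \<in> \<sigma> ` {1..n}"
        then obtain j where "j \<in> {1..n}" "k = map snd ls ! (j - 1)" using len by (auto simp: \<sigma>_def)
        then have "k \<in> set (map snd ls)" using len by (auto intro!: nth_mem)
        then show "k \<in> {1..n}" unfolding set .
      qed
      with \<open>inj_on \<sigma> {1..n}\<close> show "\<sigma> ` {1..n} = {1..n}"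
        by (simp add: endo_inj_surj)
    qed
    then have "\<sigma> permutes {1..n}"
      by (rule bij_imp_permutes) (auto simp: \<sigma>_def)
    moreover have "ls = map (\<lambda>j. (fst (ls ! (j - 1)), \<sigma> j)) [1..<n + 1]"
      using len by (intro nth_equalityI) (auto simp: \<sigma>_def simp del: upt_Suc)
    ultimately show ?thesis
      by (intro exI[of _ "\<lambda>j. fst (ls ! (j - 1))"] exI[of _ \<sigma>] conjI)
  qed
  have "{prod_list (map (\<lambda>j. var (t j) (\<sigma> j)) [1..<n + 1]) | t \<sigma>. \<sigma> permutes {1..n}} =
    {monomial_poly ls :: ('t, 'f) graded_poly | ls. mset (map snd ls) = mset [1..<n + 1]}"
    unfolding prod_list_var
  proof (rule subset_antisym; rule subsetI)
    fix f :: "('t, 'f) graded_poly"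
    assume "f \<in> {monomial_poly (map (\<lambda>j. (t j, \<sigma> j)) [1..<n + 1]) | t \<sigma>. \<sigma> permutes {1..n}}"
    then show "f \<in> {monomial_poly ls | ls. mset (map snd ls) = mset [1..<n + 1]}"
      using fwd by blast
  next
    fix f :: "('t, 'f) graded_poly"
    assume "f \<in> {monomial_poly ls | ls. mset (map snd ls) = mset [1..<n + 1]}"
    then obtain ls where "f = monomial_poly ls" "mset (map snd ls) = mset [1..<n + 1]" by blast
    then show "f \<in> {monomial_poly (map (\<lambda>j. (t j, \<sigma> j)) [1..<n + 1]) | t \<sigma>. \<sigma> permutes {1..n}}"
      using bwd[of ls] by blast
  qed
  then show ?thesis unfolding multilinear_polys_def by simp
qed

lemma monomial_in_multilinear_polys:
  "mset (map snd ls) = mset [1..<n + 1] \<Longrightarrow> monomial_poly ls \<in> multilinear_polys n"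
  unfolding multilinear_polys_eq by (rule poly_space.span_base) blast

lemma subspace_multilinear_polys: "poly_space.subspace (multilinear_polys n)"
  unfolding multilinear_polys_eq by (rule poly_space.subspace_span)

lemma keys_multilinear_polys:
  fixes f :: "('t, 'f::field) graded_poly"
  assumes "f \<in> multilinear_polys n" "Poly_Mapping.lookup f w \<noteq> 0"
  shows "mset (map snd (letters w)) = mset [1..<n + 1]"
proof -
  let ?U = "{f :: ('t, 'f) graded_poly.
    \<forall>w. Poly_Mapping.lookup f w \<noteq> 0 \<longrightarrow> mset (map snd (letters w)) = mset [1..<n + 1]}"
  have "multilinear_polys n \<subseteq> ?U"
    unfolding multilinear_polys_eq
  proof (rule poly_space.span_minimal)
    show "poly_space.subspace ?U"
      unfolding poly_space.subspace_def by (auto simp: lookup_add) (metis add.right_neutral)+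
  qed (auto simp: lookup_single when_def split: if_splits)
  then show ?thesis using assms by blast
qed

context nonunital_algebra
begin

lemma subst_poly_eq:
  assumes "finite K" "\<And>w. Poly_Mapping.lookup f w \<noteq> 0 \<Longrightarrow> w \<in> K"
  shows "subst_poly scale \<rho> f = (\<Sum>w\<in>K. scale (Poly_Mapping.lookup f w) (subst_letters \<rho> (letters w)))"
  unfolding subst_poly_def using assms
  by (intro sum.mono_neutral_left) (auto simp: in_keys_iff)

lemma subst_poly_linear:
  fixes \<rho> :: "'t \<times> nat \<Rightarrow> 'a"
  shows "Vector_Spaces.linear poly_scale scale (subst_poly scale \<rho>)"
proof (intro Vector_Spaces.linear_iff[THEN iffD2] conjI allI)
  show "vector_space poly_scale" by (rule poly_space.vector_space_axioms)
  show "vector_space scale" by (rule vector_space_axioms)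
  fix f g :: "('t, 'f) graded_poly" and c
  let ?K = "Poly_Mapping.keys f \<union> Poly_Mapping.keys g"
  have "subst_poly scale \<rho> h = (\<Sum>w\<in>?K. scale (Poly_Mapping.lookup h w) (subst_letters \<rho> (letters w)))"
    if "h \<in> {f, g, f + g, poly_scale c f}" for h
    using that by (intro subst_poly_eq) (auto simp: in_keys_iff lookup_add)
  then show "subst_poly scale \<rho> (f + g) = subst_poly scale \<rho> f + subst_poly scale \<rho> g"
    "subst_poly scale \<rho> (poly_scale c f) = scale c (subst_poly scale \<rho> f)"
    by (simp_all add: lookup_add scale_left_distrib sum.distrib scale_sum_right)
qed

lemma subst_poly_monomial: "subst_poly scale \<rho> (monomial_poly ls) = subst_letters \<rho> ls"
  by (subst subst_poly_eq[of "{Monomial ls}"]) (auto simp: lookup_single when_def split: if_splits)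

lemma subst_letters_cong:
  "(\<And>x. x \<in> set ls \<Longrightarrow> \<rho> x = \<rho>' x) \<Longrightarrow> subst_letters \<rho> ls = subst_letters \<rho>' (ls :: ('t \<times> nat) list) "
  by (induction \<rho> ls rule: subst_letters.induct) auto

text \<open>The variables with index i are replaced in all degrees together, because the monomials
  of one multilinear polynomial may use this index with different degrees.\<close>

definition set_slot :: "('t \<times> nat \<Rightarrow> 'a) \<Rightarrow> nat \<Rightarrow> ('t \<Rightarrow> 'a) \<Rightarrow> 't \<times> nat \<Rightarrow> 'a"
  where "set_slot \<rho> i \<eta> = (\<lambda>(t, j). if j = i then \<eta> t else \<rho> (t, j))"

text \<open>Index i occurs in exactly one letter, so the value is linear in the family put
  there.\<close>

lemma subst_letters_slot_sum:
  assumes "distinct (map snd ls)" "i \<in> snd ` set ls"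
  shows "subst_letters (set_slot \<rho> i (\<lambda>t. \<Sum>b\<in>B. scale (c b) (\<eta> b t))) ls =
    (\<Sum>b\<in>B. scale (c b) (subst_letters (set_slot \<rho> i (\<eta> b)) ls))"
  using assms
proof (induction ls rule: induct_list012)
  case (2 x)
  then show ?case by (cases x) (simp add: set_slot_def)
next
  case (3 x y xs)
  obtain s j where x: "x = (s, j)" by (cases x)
  show ?case
  proof (cases "j = i")
    case True
    then have "i \<notin> snd ` set (y # xs)" using 3(3) x by auto
    then have "subst_letters (set_slot \<rho> i \<eta>') (y # xs) = subst_letters \<rho> (y # xs)" for \<eta>'
      by (intro subst_letters_cong) (force simp: set_slot_def)
    then have "subst_letters (set_slot \<rho> i \<eta>') (x # y # xs) = \<eta>' s * subst_letters \<rho> (y # xs)" for \<eta>'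
      by (simp add: x True) (simp add: set_slot_def)
    then show ?thesis by (simp only: sum_distrib_right scale_mult_left)
  next
    case False
    then have "i \<in> snd ` set (y # xs)" using 3(4) x by auto
    moreover have "subst_letters (set_slot \<rho> i \<eta>') (x # y # xs) =
        \<rho> (s, j) * subst_letters (set_slot \<rho> i \<eta>') (y # xs)" for \<eta>'
      using False by (simp add: x) (simp add: set_slot_def)
    moreover have "distinct (map snd (y # xs))" using 3(3) by simp
    ultimately show ?thesis
      using 3(2) by (simp only: sum_distrib_left scale_mult_right)
  qed
qed simp

end

section \<open>Evaluation on a homogeneous basis\<close>

locale graded_basis = nonunital_algebra scale
  for scale :: "'f::field \<Rightarrow> 'a::ring \<Rightarrow> 'a" +
  fixes A :: "'t \<Rightarrow> 'a set" and B :: "'a set" and deg :: "'a \<Rightarrow> 't"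
  assumes subspace_A: "subspace (A t)"
    and finite_B: "finite B" and indep_B: "independent B"
    and B_deg: "b \<in> B \<Longrightarrow> b \<in> A (deg b)"
    and A_span: "A t \<subseteq> span {b \<in> B. deg b = t}"
    and span_B: "span B = UNIV"
begin

definition slot :: "'a \<Rightarrow> 't \<Rightarrow> 'a"
  where "slot b t = (if b \<in> B \<and> deg b = t then b else 0)"

text \<open>The families with values in the \<open>A t\<close> form the product of these spaces,
  which the slots of the elements of \<open>B\<close> span. Thus one index costs a single factor dim
  A in the upper bound, for all degrees together.\<close>

lemma family_eq_sum_slot:
  assumes "\<And>t. \<eta> t \<in> A t"
  shows "\<exists>c. \<forall>t. \<eta> t = (\<Sum>b\<in>B. scale (c b) (slot b t))"
proof -
  have "\<exists>r. \<eta> t = (\<Sum>b\<in>{b \<in> B. deg b = t}. scale (r b) b)" for t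
  proof -
    have "\<eta> t \<in> span {b \<in> B. deg b = t}" using assms A_span by blast
    then show ?thesis using span_finite[of "{b \<in> B. deg b = t}"] finite_B by auto
  qed
  then obtain r where r: "\<And>t. \<eta> t = (\<Sum>b\<in>{b \<in> B. deg b = t}. scale (r t b) b)" by metis
  have "\<eta> t = (\<Sum>b\<in>B. scale (r (deg b) b) (slot b t))" for t
    unfolding r[of t] using finite_B
    by (intro sum.mono_neutral_cong_left) (auto simp: slot_def)
  then show ?thesis by (intro exI[of _ "\<lambda>b. r (deg b) b"]) simp
qed

definition basis_subst :: "(nat \<Rightarrow> 'a) \<Rightarrow> 't \<times> nat \<Rightarrow> 'a"
  where "basis_subst \<beta> = (\<lambda>(t, i). slot (\<beta> i) t)"

lemma slot_in: "slot b t \<in> A t"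
  using B_deg subspace_0[OF subspace_A] by (auto simp: slot_def)

lemma vanishes_if_vanishes_on_basis:
  assumes f: "f \<in> multilinear_polys n"
    and zero: "\<And>\<beta>. \<beta> \<in> {1..n} \<rightarrow>\<^sub>E B \<Longrightarrow> subst_poly scale (basis_subst \<beta>) f = 0"
    and \<rho>: "\<forall>t i. \<rho> (t, i) \<in> A t"
  shows "subst_poly scale \<rho> f = 0"
proof -
  have letters: "mset (map snd (letters w)) = mset [1..<n + 1]" if "w \<in> Poly_Mapping.keys f" for w
    using keys_multilinear_polys[OF f] that by (simp add: in_keys_iff)
  \<comment> \<open>Indices above k already carry basis elements. Multilinearity expands the largest
    remaining index over the basis, which lowers k.\<close>
  have "subst_poly scale \<rho> f = 0"
    if "k \<le> n" "\<forall>t i. \<rho> (t, i) \<in> A t" "\<forall>i\<in>{k<..n}. \<exists>b\<in>B. \<forall>t. \<rho> (t, i) = slot b t" for k \<rho>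
    using that
  proof (induction k arbitrary: \<rho>)
    case 0
    then obtain \<beta> where \<beta>: "\<forall>i\<in>{1..n}. \<beta> i \<in> B \<and> (\<forall>t. \<rho> (t, i) = slot (\<beta> i) t)"
      by (metis (no_types, lifting) greaterThanAtMost_iff atLeastAtMost_iff One_nat_def Suc_le_eq)
    have "subst_poly scale \<rho> f = subst_poly scale (basis_subst (restrict \<beta> {1..n})) f"
      unfolding subst_poly_def
    proof (intro sum.cong refl arg_cong[of _ _ "scale _"] subst_letters_cong)
      fix w x assume "w \<in> Poly_Mapping.keys f" and x: "x \<in> set (letters w)"
      then have "set (map snd (letters w)) = {1..n}" using mset_eq_setD[OF letters] by auto
      then have "snd x \<in> {1..n}" using x by auto
      then show "\<rho> x = basis_subst (restrict \<beta> {1..n}) x"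
        using \<beta> by (cases x) (auto simp: basis_subst_def)
    qed
    also have "\<dots> = 0" using \<beta> by (intro zero) auto
    finally show ?case .
  next
    case (Suc k)
    let ?i = "Suc k"
    obtain c where c: "\<And>t. \<rho> (t, ?i) = (\<Sum>b\<in>B. scale (c b) (slot b t))"
      using family_eq_sum_slot[of "\<lambda>t. \<rho> (t, ?i)"] Suc.prems by auto
    have \<rho>: "\<rho> = set_slot \<rho> ?i (\<lambda>t. \<Sum>b\<in>B. scale (c b) (slot b t))"
      by (auto simp: set_slot_def c fun_eq_iff)
    have "subst_letters \<rho> (letters w) =
        (\<Sum>b\<in>B. scale (c b) (subst_letters (set_slot \<rho> ?i (slot b)) (letters w)))"
      if "w \<in> Poly_Mapping.keys f" for w
    proof -
      have "distinct (map snd (letters w))"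
        using mset_eq_imp_distinct_iff[OF letters[OF that]] by simp
      moreover have "set (map snd (letters w)) = {1..n}" using mset_eq_setD[OF letters[OF that]] by auto
      then have "?i \<in> snd ` set (letters w)" using Suc.prems(1) by auto
      ultimately show ?thesis by (subst \<rho>) (rule subst_letters_slot_sum)
    qed
    then have "subst_poly scale \<rho> f = (\<Sum>w\<in>Poly_Mapping.keys f. \<Sum>b\<in>B.
        scale (c b) (scale (Poly_Mapping.lookup f w) (subst_letters (set_slot \<rho> ?i (slot b)) (letters w))))"
      unfolding subst_poly_def by (simp add: scale_sum_right mult.commute)
    also have "\<dots> = (\<Sum>b\<in>B. scale (c b) (subst_poly scale (set_slot \<rho> ?i (slot b)) f))"
      unfolding subst_poly_def by (subst sum.swap) (simp add: scale_sum_right)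
    also have "\<dots> = 0"
    proof (intro sum.neutral ballI)
      fix b assume b: "b \<in> B"
      have "subst_poly scale (set_slot \<rho> ?i (slot b)) f = 0"
      proof (rule Suc.IH)
        show "\<forall>t i. set_slot \<rho> ?i (slot b) (t, i) \<in> A t"
          using Suc.prems(2) slot_in by (simp add: set_slot_def)
        show "\<forall>i\<in>{k<..n}. \<exists>b'\<in>B. \<forall>t. set_slot \<rho> ?i (slot b) (t, i) = slot b' t"
        proof
          fix i assume i: "i \<in> {k<..n}"
          show "\<exists>b'\<in>B. \<forall>t. set_slot \<rho> ?i (slot b) (t, i) = slot b' t"
          proof (cases "i = ?i")
            case True
            then show ?thesis using b by (intro bexI[of _ b]) (simp_all add: set_slot_def)
          next
            case False
            then have "i \<in> {?i<..n}" using i by auto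
            then show ?thesis using Suc.prems(3) False by (simp add: set_slot_def)
          qed
        qed
      qed (use Suc.prems in simp)
      then show "scale (c b) (subst_poly scale (set_slot \<rho> ?i (slot b)) f) = 0" by simp
    qed
    finally show ?case .
  qed
  from this[of n \<rho>] \<rho> show ?thesis by simp
qed

text \<open>A basis element for each of the n indices and one coordinate of the value; the
  coordinate is the origin of the exponent n + 1.\<close>

definition eval_points :: "nat \<Rightarrow> ((nat \<Rightarrow> 'a) \<times> 'a) set"
  where "eval_points n = ({1..n} \<rightarrow>\<^sub>E B) \<times> B"

text \<open>The value 0 off the evaluation points keeps these functions in a finite dimensional
  space.\<close>

definition evaluation :: "nat \<Rightarrow> ('t, 'f) graded_poly \<Rightarrow> (nat \<Rightarrow> 'a) \<times> 'a \<Rightarrow> 'f"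
  where "evaluation n f = (\<lambda>(\<beta>, b). if (\<beta>, b) \<in> eval_points n
    then representation B (subst_poly scale (basis_subst \<beta>) f) b else 0)"

lemma evaluation_linear: "Vector_Spaces.linear poly_scale fun_scale (evaluation n)"
proof -
  interpret S: Vector_Spaces.linear poly_scale scale "subst_poly scale \<rho>" for \<rho> :: "'t \<times> nat \<Rightarrow> 'a"
    by (rule subst_poly_linear)
  show ?thesis
    by (intro Vector_Spaces.linear_iff[THEN iffD2] conjI allI)
      (auto simp: poly_space.vector_space_axioms fun_space.vector_space_axioms evaluation_def
        fun_eq_iff S.add S.scale representation_add[OF indep_B] representation_scale[OF indep_B]
        span_B fun_scale_def)
qed

lemma finite_eval_points: "finite (eval_points n)" and
  card_eval_points: "card (eval_points n) = card B ^ (n + 1)"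
  unfolding eval_points_def using finite_B
  by (auto intro: finite_PiE simp: card_cartesian_product card_PiE)

lemma evaluation_eq_0_iff:
  assumes "1 \<le> n" "f \<in> multilinear_polys n"
  shows "evaluation n f = 0 \<longleftrightarrow> f \<in> graded_identities scale A"
proof
  assume z: "evaluation n f = 0"
  have "subst_poly scale (basis_subst \<beta>) f = 0" if "\<beta> \<in> {1..n} \<rightarrow>\<^sub>E B" for \<beta>
  proof -
    have "representation B (subst_poly scale (basis_subst \<beta>) f) b = 0" if "b \<in> B" for b
      using fun_cong[OF z, of "(\<beta>, b)"] that \<open>\<beta> \<in> _\<close> by (simp add: evaluation_def eval_points_def)
    moreover have "(\<Sum>b\<in>B. scale (representation B x b) b) = x" for x
      using indep_B span_B finite_B by (intro sum_representation_eq) auto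
    ultimately show ?thesis
      by (metis (no_types, lifting) scale_zero_left sum.neutral)
  qed
  then have "\<forall>\<rho>. (\<forall>t i. \<rho> (t, i) \<in> A t) \<longrightarrow> subst_poly scale \<rho> f = 0"
    using vanishes_if_vanishes_on_basis[OF assms(2)] by blast
  \<comment> \<open>Identities must lie in the free algebra without 1; for n \<ge> 1 a multilinear
    polynomial has no constant term.\<close>
  moreover have "Poly_Mapping.lookup f 0 = 0"
  proof (rule ccontr)
    assume "Poly_Mapping.lookup f 0 \<noteq> 0"
    then have "mset (map snd (letters (0 :: ('t \<times> nat) monomial))) = mset [1..<n + 1]"
      by (rule keys_multilinear_polys[OF assms(2)])
    from arg_cong[OF this, of size] show False using assms(1) by (simp add: zero_monomial_def)
  qed
  ultimately show "f \<in> graded_identities scale A"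
    unfolding graded_identities_def free_algebra_def by blast
next
  assume f: "f \<in> graded_identities scale A"
  have "subst_poly scale (basis_subst \<beta>) f = 0" for \<beta>
    using f slot_in unfolding graded_identities_def by (simp add: basis_subst_def)
  then show "evaluation n f = 0" by (auto simp: evaluation_def representation_zero fun_eq_iff)
qed

lemma evaluation_in_span:
  "evaluation n f \<in> fun_space.span ((\<lambda>y. \<lambda>x. if x = y then 1 else 0) ` eval_points n)"
  using finite_eval_points by (intro fun_space_span_support) (auto simp: evaluation_def)

lemma subspace_identities: "poly_space.subspace (multilinear_polys n \<inter> graded_identities scale A)"
proof -
  interpret S: Vector_Spaces.linear poly_scale scale "subst_poly scale \<rho>" for \<rho> :: "'t \<times> nat \<Rightarrow> 'a"
    by (rule subst_poly_linear)
  show ?thesis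
    by (intro poly_space.subspace_inter subspace_multilinear_polys)
      (auto simp: poly_space.subspace_def graded_identities_def free_algebra_def
        S.zero S.add S.scale lookup_add)
qed

lemma graded_codim_eq:
  assumes "1 \<le> n"
  shows "graded_codim scale A n = fun_space.dim (evaluation n ` multilinear_polys n)"
  unfolding graded_codim_def
proof (rule poly_space.module_dim_cosets[OF evaluation_linear subspace_multilinear_polys subspace_identities])
  show "finite ((\<lambda>y. \<lambda>x. if x = y then 1 else (0::'f)) ` eval_points n)"
    using finite_eval_points by simp
qed (use evaluation_eq_0_iff[OF assms] evaluation_in_span in \<open>auto simp: quotient_space_def\<close>)

lemma graded_codim_le:
  assumes "1 \<le> n"
  shows "graded_codim scale A n \<le> card B ^ (n + 1)"
proof -
  have "fun_space.dim (evaluation n ` multilinear_polys n)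
      \<le> card ((\<lambda>y. \<lambda>x. if x = y then 1 else (0::'f)) ` eval_points n)"
    using finite_eval_points evaluation_in_span by (intro fun_space.dim_le_card) auto
  also have "\<dots> \<le> card B ^ (n + 1)"
    unfolding card_eval_points[symmetric] using finite_eval_points by (rule card_image_le)
  finally show ?thesis using graded_codim_eq[OF assms] by simp
qed

text \<open>The polynomials are independent modulo identities because their values at the chosen
  points form a triangular array: in a linear relation, take an \<open>s'\<close> with nonzero
  coefficient and largest \<open>m\<close>; at \<open>\<rho> s'\<close> no other term of the
  relation survives.\<close>

lemma graded_codim_ge:
  fixes f :: "'s \<Rightarrow> ('t, 'f) graded_poly" and m :: "'s \<Rightarrow> nat"
    and \<rho> :: "'s \<Rightarrow> 't \<times> nat \<Rightarrow> 'a"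
  assumes n: "1 \<le> n" and S: "finite S"
    and f: "\<And>s. s \<in> S \<Longrightarrow> f s \<in> multilinear_polys n"
    and \<rho>: "\<And>s t i. s \<in> S \<Longrightarrow> \<rho> s (t, i) \<in> A t"
    and l: "Vector_Spaces.linear scale (*) l"
    and diag: "\<And>s. s \<in> S \<Longrightarrow> l (subst_poly scale (\<rho> s) (f s)) \<noteq> 0"
    and tri: "\<And>s s'. s \<in> S \<Longrightarrow> s' \<in> S \<Longrightarrow> l (subst_poly scale (\<rho> s') (f s)) \<noteq> 0 \<Longrightarrow>
      s' = s \<or> m s' < m s"
  shows "card S \<le> graded_codim scale A n"
proof -
  interpret E: Vector_Spaces.linear poly_scale fun_scale "evaluation n" by (rule evaluation_linear)
  interpret l: Vector_Spaces.linear scale "(*)" l by fact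
  interpret P: Vector_Spaces.linear poly_scale scale "subst_poly scale r" for r :: "'t \<times> nat \<Rightarrow> 'a"
    by (rule subst_poly_linear)
  have ind: "\<forall>s\<in>S. c s = 0" if c: "(\<Sum>s\<in>S. fun_scale (c s) (evaluation n (f s))) = 0" for c
  proof (rule ccontr)
    assume "\<not> ?thesis"
    define g where "g = (\<Sum>s\<in>S. poly_scale (c s) (f s))"
    have "g \<in> multilinear_polys n"
      unfolding g_def using f subspace_multilinear_polys
      by (intro poly_space.subspace_sum poly_space.subspace_scale) auto
    moreover have "evaluation n g = 0" using c by (simp add: g_def E.sum E.scale)
    ultimately have g: "g \<in> graded_identities scale A" using evaluation_eq_0_iff[OF n] by simp
    let ?S = "{s \<in> S. c s \<noteq> 0}"
    have "finite (m ` ?S)" "m ` ?S \<noteq> {}" using S \<open>\<not> _\<close> by auto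
    then have "Max (m ` ?S) \<in> m ` ?S" by (rule Max_in)
    then obtain s' where s': "s' \<in> ?S" "m s' = Max (m ` ?S)" by auto
    have max: "m s \<le> m s'" if "s \<in> ?S" for s using S that s'(2) by simp
    \<comment> \<open>A graded identity vanishes at every homogeneous substitution, not just at
      basis elements.\<close>
    have "0 = l (subst_poly scale (\<rho> s') g)"
      using g \<rho> s' unfolding graded_identities_def by (simp add: l.zero)
    also have "\<dots> = (\<Sum>s\<in>S. c s * l (subst_poly scale (\<rho> s') (f s)))"
      by (simp add: g_def P.sum P.scale l.sum l.scale)
    also have "\<dots> = (\<Sum>s\<in>{s'}. c s * l (subst_poly scale (\<rho> s') (f s)))"
    proof (rule sum.mono_neutral_right)
      show "\<forall>s\<in>S - {s'}. c s * l (subst_poly scale (\<rho> s') (f s)) = 0"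
      proof
        fix s assume s: "s \<in> S - {s'}"
        show "c s * l (subst_poly scale (\<rho> s') (f s)) = 0"
          using tri[of s s'] max[of s] s s' by (cases "c s = 0") auto
      qed
    qed (use S s' in auto)
    finally show False using diag[of s'] s' by simp
  qed
  note fam = fun_space.independent_family[OF S, of "\<lambda>s. evaluation n (f s)", OF ind]
  have "card S = card ((\<lambda>s. evaluation n (f s)) ` S)" using fam(1) by (simp add: card_image)
  also have "\<dots> \<le> fun_space.dim (evaluation n ` multilinear_polys n)"
    using fam(2) f evaluation_in_span finite_eval_points
    by (intro fun_space.card_le_dim[where B = "(\<lambda>y. \<lambda>x. if x = y then 1 else (0::'f)) ` eval_points n"]) auto
  finally show ?thesis by (simp add: graded_codim_eq[OF n])
qed

end


section \<open>Trace functions of two by two matrices\<close>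

type_synonym 'f mat2 = "bool \<Rightarrow> bool \<Rightarrow> 'f"

definition mat2_mult :: "'f::comm_ring_1 mat2 \<Rightarrow> 'f mat2 \<Rightarrow> 'f mat2"
  where "mat2_mult P Q = (\<lambda>i j. P i False * Q False j + P i True * Q True j)"

definition unit2 :: "bool \<Rightarrow> bool \<Rightarrow> 'f::comm_ring_1 mat2"
  where "unit2 i j = (\<lambda>k l. if k = i \<and> l = j then 1 else 0)"

definition trace2 :: "'f::comm_ring_1 mat2 \<Rightarrow> 'f"
  where "trace2 P = P False False + P True True"

definition det2 :: "(bool \<Rightarrow> 'f::comm_ring_1) \<Rightarrow> (bool \<Rightarrow> 'f) \<Rightarrow> 'f"
  where "det2 v w = v False * w True - v True * w False"

fun word2 :: "('i \<Rightarrow> 'f::comm_ring_1 mat2) \<Rightarrow> 'i list \<Rightarrow> 'f mat2"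
  where
    "word2 x [] = (\<lambda>i j. if i = j then 1 else 0)"
  | "word2 x (i # w) = mat2_mult (x i) (word2 x w)"

lemma mat2_eqI: "(\<And>i j. P i j = Q i j) \<Longrightarrow> P = (Q :: 'f mat2)"
  by (intro ext)

lemma mat2_mult_one: "mat2_mult P (\<lambda>i j. if i = j then 1 else 0) = P"
proof (rule mat2_eqI)
  show "mat2_mult P (\<lambda>i j. if i = j then 1 else 0) i j = P i j" for i j
    by (cases j) (simp_all add: mat2_mult_def)
qed

lemma word2_append: "word2 x (v @ w) = mat2_mult (word2 x v) (word2 x w)"
proof (induction v)
  case Nil
  show ?case
    by (rule mat2_eqI) (auto simp: mat2_mult_def)
next
  case (Cons i v)
  then show ?case
    by (intro mat2_eqI) (simp add: mat2_mult_def algebra_simps)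
qed

text \<open>The polarized Cayley-Hamilton identity.\<close>
lemma fundamental_trace_identity:
  "trace2 P * trace2 Q * trace2 R =
    trace2 (mat2_mult P Q) * trace2 R + trace2 (mat2_mult P R) * trace2 Q
    + trace2 (mat2_mult Q R) * trace2 P
    - trace2 (mat2_mult P (mat2_mult Q R)) - trace2 (mat2_mult P (mat2_mult R Q))"
  by (simp add: trace2_def mat2_mult_def algebra_simps)

text \<open>The letters below \<open>N\<close> take rank one values. The eight letters from \<open>N\<close> on are fixed matrix
  units, which two_traces_in_span needs, and the remaining ones only fill up the length \<open>n\<close>.\<close>
locale rank_one_eval =
  fixes X :: "'y \<Rightarrow> nat \<Rightarrow> 'f::field_char_0 mat2" and u v :: "'y \<Rightarrow> nat \<Rightarrow> bool \<Rightarrow> 'f"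
    and N n :: nat
  assumes rank_one: "i < N \<Longrightarrow> X y i = (\<lambda>p q. u y i p * v y i q)"
    and N_le: "N + 8 \<le> n"
    and fixed00: "N \<le> i \<Longrightarrow> i < N + 4 \<or> N + 8 \<le> i \<Longrightarrow> i < n \<Longrightarrow> X y i = unit2 False False"
    and fixed01: "N + 4 \<le> i \<Longrightarrow> i < N + 6 \<Longrightarrow> X y i = unit2 False True"
    and fixed10: "N + 6 \<le> i \<Longrightarrow> i < N + 8 \<Longrightarrow> X y i = unit2 True False"
begin

definition word_span :: "('y \<Rightarrow> 'f) set"
  where "word_span =
    fun_space.span {\<lambda>y. word2 (X y) w False False | w. mset w = mset [0..<n]}"

lemma word_in_span: "mset w = mset [0..<n] \<Longrightarrow> (\<lambda>y. word2 (X y) w False False) \<in> word_span"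
  unfolding word_span_def by (rule fun_space.span_base) blast

lemma word_span_scale: "f \<in> word_span \<Longrightarrow> (\<lambda>y. c * f y) \<in> word_span"
  unfolding word_span_def using fun_space.span_scale[of f _ c] by (simp add: fun_scale_def)

lemma word_span_add: "f \<in> word_span \<Longrightarrow> g \<in> word_span \<Longrightarrow> (\<lambda>y. f y + g y) \<in> word_span"
  unfolding word_span_def using fun_space.span_add[of f _ g] by (simp add: plus_fun_def)

lemma word_span_diff: "f \<in> word_span \<Longrightarrow> g \<in> word_span \<Longrightarrow> (\<lambda>y. f y - g y) \<in> word_span"
  unfolding word_span_def using fun_space.span_diff[of f _ g] by (simp add: fun_diff_def)

text \<open>With matrix units, \<open>tr a * tr b\<close> is the \<open>(0, 0)\<close> entry of the sum over \<open>i\<close> and \<open>j\<close> of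
  \<open>E\<^sub>0\<^sub>i a E\<^sub>i\<^sub>0 E\<^sub>0\<^sub>j b E\<^sub>j\<^sub>0\<close>. Every word has to use each of the fixed letters once, and in each of
  the four cases the units left over can be arranged to multiply to \<open>E\<^sub>0\<^sub>0\<close>.\<close>
lemma two_traces_in_span:
  assumes "mset (a @ b) = mset [0..<N]"
  shows "(\<lambda>y. trace2 (word2 (X y) a) * trace2 (word2 (X y) b)) \<in> word_span"
proof -
  define r where "r = [N + 8..<n]"
  define W where "W = (\<lambda>s1 s2 s3 s4. s1 # a @ s2 @ b @ s3 # s4 @ r)"
  let ?w00 = "W N [N + 1, N + 2] (N + 3) [N + 4, N + 6, N + 5, N + 7]"
  let ?w01 = "W N [N + 1, N + 4] (N + 6) [N + 2, N + 3, N + 5, N + 7]"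
  let ?w10 = "W (N + 4) [N + 6, N] (N + 1) [N + 2, N + 3, N + 5, N + 7]"
  let ?w11 = "W (N + 4) [N + 6, N + 5] (N + 7) [N, N + 1, N + 2, N + 3]"
  have n: "mset [0..<n] = mset a + mset b + {#N, N + 1, N + 2, N + 3, N + 4, N + 5, N + 6, N + 7#} + mset r"
  proof -
    have "[0..<n] = [0..<N] @ [N..<N + 8] @ r"
    proof -
      obtain m where m: "n = N + 8 + m" using N_le le_Suc_ex by blast
      show ?thesis
        unfolding r_def m using upt_add_eq_append[of 0 N "8 + m"] upt_add_eq_append[of N "N + 8" m]
        by (simp add: add.assoc)
    qed
    moreover have "[N..<N + 8] = [N, N + 1, N + 2, N + 3, N + 4, N + 5, N + 6, N + 7]"
      by (simp add: upt_rec)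
    ultimately show ?thesis using assms by simp
  qed
  have "mset w = mset [0..<n]" if "w \<in> {?w00, ?w01, ?w10, ?w11}" for w
    using that unfolding n W_def by auto
  then have in_span: "(\<lambda>y. word2 (X y) w False False) \<in> word_span" if "w \<in> {?w00, ?w01, ?w10, ?w11}" for w
    using that by (intro word_in_span) blast
  \<comment> \<open>The filler letters are all E_00, which a matrix unit with column index 0 on the
    left absorbs.\<close>
  have r: "mat2_mult (unit2 i False) (word2 (X y) r) = unit2 i False" for y i
  proof -
    have "mat2_mult (unit2 i False) (word2 (X y) s) = unit2 i False" if "set s \<subseteq> {N + 8..<n}" for s
      using that
    proof (induction s arbitrary: i)
      case Nil
      show ?case by (rule mat2_eqI) (auto simp: mat2_mult_def unit2_def)
    next
      case (Cons k s)
      then have "X y k = unit2 False False" by (intro fixed00) auto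
      then have "word2 (X y) (k # s) = unit2 False False" using Cons by simp
      then show ?case by (auto simp: mat2_mult_def unit2_def intro!: mat2_eqI)
    qed
    then show ?thesis by (simp add: r_def)
  qed
  have X: "X y N = unit2 False False" "X y (N + 1) = unit2 False False" "X y (N + 2) = unit2 False False"
    "X y (N + 3) = unit2 False False" "X y (N + 4) = unit2 False True" "X y (N + 5) = unit2 False True"
    "X y (N + 6) = unit2 True False" "X y (N + 7) = unit2 True False" for y
    using N_le by (simp_all add: fixed00 fixed01 fixed10)
  have "trace2 (word2 (X y) a) * trace2 (word2 (X y) b) =
      word2 (X y) ?w00 False False + word2 (X y) ?w01 False False
      + word2 (X y) ?w10 False False + word2 (X y) ?w11 False False" for y
    unfolding W_def word2.simps(2) word2_append append_Cons append_Nil X r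
    by (simp add: trace2_def mat2_mult_def unit2_def algebra_simps)
  then show ?thesis
    by (simp only:) (intro word_span_add in_span; simp)
qed

text \<open>The trace identity turns three traces into products of fewer traces in the same letters,
  so the induction stops at two factors; shorter products are padded with empty words.\<close>

lemma traces_in_span:
  assumes "mset (concat C) = mset [0..<N]"
  shows "(\<lambda>y. \<Prod>w\<leftarrow>C. trace2 (word2 (X y) w)) \<in> word_span"
  using assms
proof (induction "length C" arbitrary: C rule: less_induct)
  case less
  \<comment> \<open>The empty word is the identity matrix, of trace 2. Each padding costs a division
    by 2, possible in characteristic 0.\<close>
  have two: "trace2 (word2 x []) = 2" for x :: "nat \<Rightarrow> 'f mat2" by (simp add: trace2_def)
  consider "C = []" | a where "C = [a]" | a b where "C = [a, b]" | a b c D where "C = a # b # c # D"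
    by (metis list.exhaust)
  then show ?case
  proof cases
    case 1
    then show ?thesis
      using word_span_scale[OF two_traces_in_span[of "[]" "[]"], of "1 / 4"] less.prems
      unfolding two by simp
  next
    case (2 a)
    then show ?thesis
      using word_span_scale[OF two_traces_in_span[of a "[]"], of "1 / 2"] less.prems
      unfolding two by simp
  next
    case (3 a b)
    then show ?thesis using two_traces_in_span[of a b] less.prems by simp
  next
    case (4 a b c D)
    let ?t = "\<lambda>C y. \<Prod>w\<leftarrow>C. trace2 (word2 (X y) w)"
    have IH: "?t E \<in> word_span"
      if "E \<in> {(a @ b) # c # D, (a @ c) # b # D, (b @ c) # a # D, (a @ b @ c) # D, (a @ c @ b) # D}" for E
      using that less.prems 4 by (intro less.hyps) (auto simp: ac_simps)
    have "?t C y = ?t ((a @ b) # c # D) y + ?t ((a @ c) # b # D) y + ?t ((b @ c) # a # D) y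
        - ?t ((a @ b @ c) # D) y - ?t ((a @ c @ b) # D) y" for y
    proof -
      let ?a = "word2 (X y) a" and ?b = "word2 (X y) b" and ?c = "word2 (X y) c"
      have "?t C y = (trace2 ?a * trace2 ?b * trace2 ?c) * ?t D y"
        by (simp add: 4 mult.assoc)
      also have "\<dots> = (trace2 (mat2_mult ?a ?b) * trace2 ?c + trace2 (mat2_mult ?a ?c) * trace2 ?b
          + trace2 (mat2_mult ?b ?c) * trace2 ?a - trace2 (mat2_mult ?a (mat2_mult ?b ?c))
          - trace2 (mat2_mult ?a (mat2_mult ?c ?b))) * ?t D y"
        by (simp only: fundamental_trace_identity)
      finally show ?thesis
        by (simp add: word2_append distrib_right left_diff_distrib mult.assoc)
    qed
    then show ?thesis
      by (simp only:) (intro word_span_add word_span_diff IH; simp)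
  qed
qed

section \<open>Contractions of rank one matrices\<close>

definition contract :: "'y \<Rightarrow> nat \<Rightarrow> nat \<Rightarrow> 'f"
  where "contract y k i = v y k False * u y i False + v y k True * u y i True"

text \<open>The scalar by which a word of rank one letters differs from the outer product of its
  first column and last row. The contraction that would close the word to a cycle is left
  out.\<close>

fun inner_contractions :: "'y \<Rightarrow> nat list \<Rightarrow> 'f"
  where
    "inner_contractions y [] = 1"
  | "inner_contractions y [i] = 1"
  | "inner_contractions y (i # j # w) = contract y i j * inner_contractions y (j # w)"

lemma inner_contractions_append:
  "a \<noteq> [] \<Longrightarrow> b \<noteq> [] \<Longrightarrow> inner_contractions y (a @ b) =
    inner_contractions y a * contract y (last a) (hd b) * inner_contractions y b"
proof (induction a rule: induct_list012)
  case (2 i)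
  then show ?case by (cases b) auto
qed auto

lemma word2_rank_one:
  assumes "set w \<subseteq> {..<N}" "w \<noteq> []"
  shows "word2 (X y) w = (\<lambda>p q. inner_contractions y w * (u y (hd w) p * v y (last w) q))"
  using assms
proof (induction w rule: induct_list012)
  case (2 i)
  then show ?case
    by (simp add: rank_one mat2_mult_one)
next
  case (3 i j w)
  then have "word2 (X y) (j # w) = (\<lambda>p q. inner_contractions y (j # w) * (u y j p * v y (last (j # w)) q))"
    by simp
  then show ?case
    unfolding word2.simps(2)[of _ i "j # w"] using 3
    by (intro mat2_eqI) (simp add: rank_one mat2_mult_def contract_def algebra_simps)
qed simp

lemma trace2_word2_rank_one:
  assumes "set w \<subseteq> {..<N}" "w \<noteq> []"
  shows "trace2 (word2 (X y) w) = inner_contractions y w * contract y (last w) (hd w)"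
  by (simp add: word2_rank_one[OF assms] trace2_def contract_def algebra_simps)

text \<open>Performing the contractions one after another glues the letters into open words \<open>P\<close> and
  closes some of these to the traces of \<open>C\<close>.\<close>
lemma contractions_as_words:
  assumes "mset (map fst L) \<subseteq># mset [0..<N]" "mset (map snd L) \<subseteq># mset [0..<N]"
  shows "\<exists>P C. (\<forall>w\<in>#P. w \<noteq> []) \<and>
    image_mset last P + mset (map fst L) = mset [0..<N] \<and>
    image_mset hd P + mset (map snd L) = mset [0..<N] \<and>
    \<Sum>\<^sub># (image_mset mset P) + mset (concat C) = mset [0..<N] \<and>
    (\<forall>y. (\<Prod>(k, i)\<leftarrow>L. contract y k i) =
      prod_mset (image_mset (inner_contractions y) P) * (\<Prod>w\<leftarrow>C. trace2 (word2 (X y) w)))"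
  using assms
proof (induction L)
  case Nil
  have "\<Sum>\<^sub># (image_mset (\<lambda>i. {#i#}) M) = M" for M :: "nat multiset"
    by (induction M) auto
  then show ?case
    by (intro exI[of _ "image_mset (\<lambda>i. [i]) (mset [0..<N])"] exI[of _ "[]"])
      (simp add: image_mset.compositionality comp_def)
next
  case (Cons e L)
  obtain k i where e: "e = (k, i)" by (cases e)
  have "mset (map fst L) \<subseteq># mset [0..<N]" "mset (map snd L) \<subseteq># mset [0..<N]"
    using Cons.prems by (auto simp: insert_subset_eq_iff intro: subset_mset.order_trans)
  then obtain P C where P: "\<forall>w\<in>#P. w \<noteq> []"
    and fst: "image_mset last P + mset (map fst L) = mset [0..<N]"
    and snd: "image_mset hd P + mset (map snd L) = mset [0..<N]"
    and letters: "\<Sum>\<^sub># (image_mset mset P) + mset (concat C) = mset [0..<N]"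
    and val: "\<And>y. (\<Prod>(k, i)\<leftarrow>L. contract y k i) =
      prod_mset (image_mset (inner_contractions y) P) * (\<Prod>w\<leftarrow>C. trace2 (word2 (X y) w))"
    using Cons.IH by blast
  have small: "set w \<subseteq> {..<N}" if "w \<in># P" for w
  proof
    fix j assume "j \<in> set w"
    with that have "j \<in># \<Sum>\<^sub># (image_mset mset P)" by auto
    then have "j \<in># mset [0..<N]" unfolding letters[symmetric] by simp
    then show "j \<in> {..<N}" by simp
  qed
  \<comment> \<open>The open words end in the rows and begin with the columns that are still free,
    so k ends some \<open>a\<close> and i begins some \<open>b\<close>. If \<open>a = b\<close> the
    contraction closes a trace, otherwise it glues \<open>a\<close> to \<open>b\<close>.\<close>
  have "{#k#} + mset (map fst L) \<subseteq># image_mset last P + mset (map fst L)"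
    using Cons.prems(1) unfolding fst by (simp add: e)
  then have "k \<in># image_mset last P" by simp
  then obtain a where a: "a \<in># P" "last a = k" by auto
  have "{#i#} + mset (map snd L) \<subseteq># image_mset hd P + mset (map snd L)"
    using Cons.prems(2) unfolding snd by (simp add: e)
  then have "i \<in># image_mset hd P" by simp
  then obtain b where b: "b \<in># P" "hd b = i" by auto
  have ne: "a \<noteq> []" "b \<noteq> []" using P a b by auto
  show ?case
  proof (cases "a = b")
    case True
    define Q where "Q = P - {#a#}"
    have PQ: "P = add_mset a Q" using a by (simp add: Q_def)
    have tr: "trace2 (word2 (X y) a) = inner_contractions y a * contract y k i" for y
      using trace2_word2_rank_one[OF small[OF a(1)] ne(1)] a b True by simp
    have "hd a = i" using b True by simp
    with a show ?thesis
      using P fst snd letters val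
      by (intro exI[of _ Q] exI[of _ "a # C"]) (simp add: PQ e tr ac_simps)
  next
    case False
    define Q where "Q = P - {#a#} - {#b#}"
    have "b \<in># P - {#a#}" using b False by (simp add: in_diff_count)
    then have PQ: "P = add_mset a (add_mset b Q)"
      unfolding Q_def using insert_DiffM[OF a(1)] insert_DiffM[of b "P - {#a#}"] by simp
    show ?thesis
      using P fst snd letters val a b ne
      by (intro exI[of _ "add_mset (a @ b) Q"] exI[of _ C])
        (simp add: PQ e inner_contractions_append ac_simps add_mset_commute)
  qed
qed

text \<open>When all rows are contracted no open word remains, so the product consists of traces
  only.\<close>

lemma contractions_in_span:
  assumes "mset (map fst L) = mset [0..<N]" "mset (map snd L) = mset [0..<N]"
  shows "(\<lambda>y. \<Prod>(k, i)\<leftarrow>L. contract y k i) \<in> word_span"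
proof -
  obtain P C where P: "image_mset last P + mset (map fst L) = mset [0..<N]"
    and letters: "\<Sum>\<^sub># (image_mset mset P) + mset (concat C) = mset [0..<N]"
    and val: "\<And>y. (\<Prod>(k, i)\<leftarrow>L. contract y k i) =
      prod_mset (image_mset (inner_contractions y) P) * (\<Prod>w\<leftarrow>C. trace2 (word2 (X y) w))"
    using contractions_as_words[of L] assms by auto
  have "P = {#}" using P assms by simp
  then show ?thesis using traces_in_span[of C] letters val by simp
qed

text \<open>Each minor is a difference of two products of two contractions. The induction expands
  one minor at a time, and \<open>L\<close> collects the contractions chosen so far.\<close>

lemma minors_in_span:
  assumes "mset (map (fst \<circ> fst) Q @ map (snd \<circ> fst) Q @ map fst L) = mset [0..<N]"
    and "mset (map (fst \<circ> snd) Q @ map (snd \<circ> snd) Q @ map snd L) = mset [0..<N]"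
  shows "(\<lambda>y. (\<Prod>((k, l), (i, j))\<leftarrow>Q. contract y k i * contract y l j - contract y k j * contract y l i)
    * (\<Prod>(k, i)\<leftarrow>L. contract y k i)) \<in> word_span"
  using assms
proof (induction Q arbitrary: L)
  case Nil
  then show ?case using contractions_in_span[of L] by simp
next
  case (Cons q Q)
  obtain k l i j where q: "q = ((k, l), (i, j))" by (metis prod.exhaust)
  let ?f = "\<lambda>y. \<Prod>((k, l), (i, j))\<leftarrow>Q. contract y k i * contract y l j - contract y k j * contract y l i"
  have "(\<lambda>y. ?f y * (\<Prod>(k, i)\<leftarrow>(k, i) # (l, j) # L. contract y k i)
      - ?f y * (\<Prod>(k, i)\<leftarrow>(k, j) # (l, i) # L. contract y k i)) \<in> word_span"
    using Cons.prems by (intro word_span_diff Cons.IH) (simp_all add: q ac_simps add_mset_commute)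
  then show ?case by (simp add: q algebra_simps)
qed

text \<open>A minor of contractions is the determinant of a product of two matrices, hence a minor
  of rows times a minor of columns. Both matchings have N / 2 pairs and may be zipped in any
  order.\<close>

lemma matchings_in_span:
  assumes "perfect_matching [0..<N] M" "perfect_matching [0..<N] M'"
  shows "(\<lambda>y. (\<Prod>(i, j)\<leftarrow>M. det2 (u y i) (u y j)) * (\<Prod>(k, l)\<leftarrow>M'. det2 (v y k) (v y l))) \<in> word_span"
proof -
  have "size (mset (map fst M @ map snd M)) = size (mset (map fst M' @ map snd M'))"
    using assms unfolding perfect_matching_def by simp
  then have len: "length M = length M'" by simp
  have M: "map fst (zip M' M) = M'" "map snd (zip M' M) = M" using len by simp_all
  have "map (f \<circ> fst) (zip M' M) = map f M'" for f :: "nat \<times> nat \<Rightarrow> nat"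
    using M(1) by (metis map_map)
  moreover have "map (f \<circ> snd) (zip M' M) = map f M" for f :: "nat \<times> nat \<Rightarrow> nat"
    using M(2) by (metis map_map)
  ultimately have "(\<lambda>y. \<Prod>((k, l), (i, j))\<leftarrow>zip M' M.
      contract y k i * contract y l j - contract y k j * contract y l i) \<in> word_span"
    using minors_in_span[of "zip M' M" "[]"] assms by (simp add: perfect_matching_def)
  moreover have "(\<Prod>((k, l), (i, j))\<leftarrow>zip M' M. contract y k i * contract y l j - contract y k j * contract y l i)
      = (\<Prod>(i, j)\<leftarrow>M. det2 (u y i) (u y j)) * (\<Prod>(k, l)\<leftarrow>M'. det2 (v y k) (v y l))" for y
    using len
  proof (induction M M' rule: list_induct2)
    case (Cons p M q M')
    then show ?case
      by (cases p; cases q) (simp add: contract_def det2_def algebra_simps)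
  qed simp
  ultimately show ?thesis by simp
qed

end


section \<open>Structure of the algebra\<close>

context nonunital_algebra
begin

text \<open>\<open>{x. x * a \<in> L}\<close> is the kernel of the map \<open>x \<mapsto> x * a\<close> onto the simple module \<open>A/L\<close>.\<close>
lemma modular_maximal_left_ideal_quotient:
  assumes L: "modular_maximal_left_ideal L" and "\<exists>x. x * a \<notin> L"
  shows "modular_maximal_left_ideal {x. x * a \<in> L}"
proof -
  let ?K = "{x. x * a \<in> L}"
  have subL: "subspace L" and leftL: "\<And>b x. x \<in> L \<Longrightarrow> b * x \<in> L"
    and maxL: "\<And>M. left_ideal M \<Longrightarrow> L \<subseteq> M \<Longrightarrow> M = L \<or> M = UNIV"
    using L by (auto simp: modular_maximal_left_ideal_def left_ideal_def)
  have K: "left_ideal ?K"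
    using subspace_0[OF subL] subspace_add[OF subL] subspace_scale[OF subL] leftL
    by (auto simp: left_ideal_def subspace_def distrib_right scale_mult_left mult.assoc)
  \<comment> \<open>M a + L is a left ideal properly containing L, hence everything.\<close>
  have sum_UNIV: "\<exists>x\<in>M. y - x * a \<in> L" if M: "left_ideal M" and x: "x \<in> M" "x * a \<notin> L" for M x y
  proof -
    let ?N = "{z. \<exists>x\<in>M. z - x * a \<in> L}"
    have M': "subspace M" "\<And>b x. x \<in> M \<Longrightarrow> b * x \<in> M" using M by (auto simp: left_ideal_def)
    have "0 \<in> ?N"
      using subspace_0[OF M'(1)] subspace_0[OF subL] by (auto intro!: bexI[of _ 0])
    moreover have "z + z' \<in> ?N" if zz: "z \<in> ?N" "z' \<in> ?N" for z z'
    proof -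
      obtain x x' where "x \<in> M" "z - x * a \<in> L" "x' \<in> M" "z' - x' * a \<in> L" using zz by blast
      then have "x + x' \<in> M" "z + z' - (x + x') * a \<in> L"
        using subspace_add[OF M'(1), of x x'] subspace_add[OF subL, of "z - x * a" "z' - x' * a"]
        by (simp_all add: algebra_simps)
      then show ?thesis by blast
    qed
    moreover have "scale c z \<in> ?N" if zN: "z \<in> ?N" for c z
    proof -
      obtain x where "x \<in> M" "z - x * a \<in> L" using zN by blast
      then have "scale c x \<in> M" "scale c z - scale c x * a \<in> L"
        using subspace_scale[OF M'(1), of x c] subspace_scale[OF subL, of "z - x * a" c]
        by (simp_all add: scale_mult_left scale_right_diff_distrib)
      then show ?thesis by blast
    qed
    moreover have "b * z \<in> ?N" if zN: "z \<in> ?N" for b z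
    proof -
      obtain x where "x \<in> M" "z - x * a \<in> L" using zN by blast
      then have "b * x \<in> M" "b * z - b * x * a \<in> L"
        using M'(2)[of x b] leftL[of "z - x * a" b] by (simp_all add: right_diff_distrib mult.assoc)
      then show ?thesis by blast
    qed
    ultimately have "left_ideal ?N" unfolding left_ideal_def subspace_def by blast
    moreover have "L \<subseteq> ?N" using subspace_0[OF M'(1)] by (auto intro!: bexI[of _ 0])
    moreover have "x * a \<in> ?N" using x subspace_0[OF subL] by (auto intro!: bexI[of _ x])
    ultimately have "?N = UNIV" using maxL[of ?N] x by blast
    then show ?thesis by blast
  qed
  obtain x where x: "x * a \<notin> L" using assms(2) by blast
  have "left_ideal UNIV" by (simp add: left_ideal_def)
  \<comment> \<open>From A a + L = A, some e is a left unit for a modulo L. Then (y - y e) a = y (a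
    - e a) lies in L, which makes \<open>?K\<close> modular.\<close>
  then obtain e where e: "a - e * a \<in> L" using sum_UNIV[of UNIV x a] x by auto
  have "y - y * e \<in> ?K" for y
    using leftL[OF e, of y] by (simp add: left_diff_distrib right_diff_distrib mult.assoc)
  \<comment> \<open>An x in M outside \<open>?K\<close> gives M a + L = A, so every y differs from
    an element of M by an element of \<open>?K\<close>.\<close>
  moreover have "M = UNIV \<or> M = ?K" if M: "left_ideal M" "?K \<subseteq> M" for M
  proof (rule disjCI)
    assume "M \<noteq> ?K"
    then obtain x where x: "x \<in> M" "x * a \<notin> L" using M(2) by auto
    have "y \<in> M" for y
    proof -
      obtain z where z: "z \<in> M" "y * a - z * a \<in> L" using sum_UNIV[OF M(1) x, of "y * a"] by auto
      then have "y - z \<in> ?K" by (simp add: left_diff_distrib)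
      then have "y - z + z \<in> M" using M z(1) unfolding left_ideal_def by (intro subspace_add) auto
      then show ?thesis by simp
    qed
    then show "M = UNIV" by auto
  qed
  ultimately show ?thesis
    using K x unfolding modular_maximal_left_ideal_def by blast
qed

text \<open>For right multiplication by a and a modular maximal left ideal L: either A a lies in L,
  or the x with x a in L form another modular maximal left ideal, which contains the
  radical.\<close>

lemma jacobson_radical_two_sided: "two_sided_ideal jacobson_radical"
proof -
  have "subspace jacobson_radical"
    unfolding jacobson_radical_def
    by (rule subspace_Inter) (auto simp: modular_maximal_left_ideal_def left_ideal_def)
  moreover have "a * x \<in> jacobson_radical" if "x \<in> jacobson_radical" for a x
    using that unfolding jacobson_radical_def
    by (auto simp: modular_maximal_left_ideal_def left_ideal_def)
  moreover have "x * a \<in> jacobson_radical" if x: "x \<in> jacobson_radical" for a x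
    unfolding jacobson_radical_def
  proof (intro InterI, elim CollectE)
    fix L assume L: "modular_maximal_left_ideal L"
    show "x * a \<in> L"
    proof (cases "\<exists>x. x * a \<notin> L")
      case True
      from modular_maximal_left_ideal_quotient[OF L this] show ?thesis
        using x unfolding jacobson_radical_def by auto
    qed auto
  qed
  ultimately show ?thesis by (simp add: two_sided_ideal_def)
qed

end

section \<open>Gradings by a right zero band\<close>

locale right_zero_graded = nonunital_algebra scale
  for scale :: "'f::field \<Rightarrow> 'a::ring \<Rightarrow> 'a" +
  fixes A :: "'t::semigroup_mult \<Rightarrow> 'a set"
  assumes right_zero: "(s :: 't) * t = t"
    and grading: "grading A"
begin

lemma subspace_A: "subspace (A t)"
  using grading by (simp add: grading_def direct_sum_def)

lemma A_left_ideal: "x \<in> A t \<Longrightarrow> a * x \<in> A t" and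
  ex_components: "\<exists>!f. finite {t. f t \<noteq> 0} \<and> (\<forall>t. f t \<in> A t) \<and> (\<Sum>t | f t \<noteq> 0. f t) = y"
proof -
  let ?F = "{f. finite {t. f t \<noteq> 0} \<and> (\<forall>t. f t \<in> A t)}"
  have bij: "bij_betw (\<lambda>f. \<Sum>t | f t \<noteq> 0. f t) ?F UNIV"
    using grading by (simp add: grading_def direct_sum_def)
  have "\<exists>!f. f \<in> ?F \<and> (\<Sum>t | f t \<noteq> 0. f t) = y" for y
  proof -
    obtain f where f: "f \<in> ?F" "(\<Sum>t | f t \<noteq> 0. f t) = y"
      using bij_betw_imp_surj_on[OF bij] by (metis (mono_tags, lifting) UNIV_I imageE)
    moreover have "g = f" if "g \<in> ?F" "(\<Sum>t | g t \<noteq> 0. g t) = y" for g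
      using inj_onD[OF bij_betw_imp_inj_on[OF bij], of g f] f that by simp
    ultimately show ?thesis by blast
  qed
  then show *: "\<exists>!f. finite {t. f t \<noteq> 0} \<and> (\<forall>t. f t \<in> A t) \<and> (\<Sum>t | f t \<noteq> 0. f t) = y" for y
    by (simp add: conj_assoc)
  assume x: "x \<in> A t"
  obtain f where f: "\<And>t. f t \<in> A t" "(\<Sum>t | f t \<noteq> 0. f t) = a" using *[of a] by auto
  have "f s * x \<in> A t" for s
    using grading f(1)[of s] x by (metis grading_def right_zero)
  then have "(\<Sum>s | f s \<noteq> 0. f s * x) \<in> A t" by (intro subspace_sum subspace_A)
  then show "a * x \<in> A t" by (simp add: f(2)[symmetric] sum_distrib_right)
qed

definition component :: "'a \<Rightarrow> 't \<Rightarrow> 'a"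
  where "component x = (THE f. finite {t. f t \<noteq> 0} \<and> (\<forall>t. f t \<in> A t) \<and> (\<Sum>t | f t \<noteq> 0. f t) = x)"

lemma component_props:
  "finite {t. component x t \<noteq> 0}" "component x t \<in> A t" "(\<Sum>t | component x t \<noteq> 0. component x t) = x"
  using theI'[OF ex_components[of x]] by (simp_all add: component_def)

lemma component_eqI:
  assumes "finite T" "\<And>t. t \<in> T \<Longrightarrow> f t \<in> A t" "(\<Sum>t\<in>T. f t) = x"
  shows "component x = (\<lambda>t. if t \<in> T then f t else 0)"
  unfolding component_def
proof (rule the1_equality[OF ex_components])
  let ?g = "\<lambda>t. if t \<in> T then f t else 0"
  have "(\<Sum>t | ?g t \<noteq> 0. ?g t) = (\<Sum>t\<in>T. f t)"
    using assms(1) by (intro sum.mono_neutral_cong_left) auto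
  moreover have "finite {t. ?g t \<noteq> 0}" using assms(1) by (rule finite_subset[rotated]) auto
  ultimately show "finite {t. ?g t \<noteq> 0} \<and> (\<forall>t. ?g t \<in> A t) \<and> (\<Sum>t | ?g t \<noteq> 0. ?g t) = x"
    using assms(2,3) subspace_0[OF subspace_A] by auto
qed

lemma sum_components:
  assumes "finite T" "{t. component x t \<noteq> 0} \<subseteq> T"
  shows "(\<Sum>t\<in>T. component x t) = x"
proof -
  have "(\<Sum>t\<in>T. component x t) = (\<Sum>t | component x t \<noteq> 0. component x t)"
    using assms by (intro sum.mono_neutral_right) auto
  then show ?thesis by (simp add: component_props(3))
qed

lemma component_add: "component (x + y) t = component x t + component y t"
proof -
  let ?T = "{t. component x t \<noteq> 0} \<union> {t. component y t \<noteq> 0}"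
  have "component (x + y) = (\<lambda>t. if t \<in> ?T then component x t + component y t else 0)"
  proof (rule component_eqI)
    show fin: "finite ?T" by (simp add: component_props)
    show "(\<Sum>t\<in>?T. component x t + component y t) = x + y"
      using fin by (simp only: sum.distrib sum_components Un_upper1 Un_upper2)
  qed (auto intro: subspace_add subspace_A component_props)
  then show ?thesis by auto
qed

lemma component_scale: "component (scale c x) t = scale c (component x t)"
proof -
  let ?T = "{t. component x t \<noteq> 0}"
  have "component (scale c x) = (\<lambda>t. if t \<in> ?T then scale c (component x t) else 0)"
    by (rule component_eqI)
      (auto simp: component_props scale_sum_right[symmetric] intro: subspace_scale subspace_A)
  then show ?thesis by auto
qed

lemma component_mult: "component (a * x) t = a * component x t"
proof -
  let ?T = "{t. component x t \<noteq> 0}"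
  have "component (a * x) = (\<lambda>t. if t \<in> ?T then a * component x t else 0)"
    by (rule component_eqI)
      (auto simp: component_props sum_distrib_left[symmetric] intro: A_left_ideal)
  then show ?thesis by auto
qed

lemma component_0 [simp]: "component 0 t = 0"
  using component_scale[of 0 0 t] by simp

lemma component_homogeneous: "x \<in> A s \<Longrightarrow> component x t = (if t = s then x else 0)"
  using component_eqI[of "{s}" "\<lambda>_. x" x] by auto

text \<open>The elements whose components all lie in \<open>J\<close> form a graded ideal contained in \<open>J\<close>.\<close>
lemma graded_simple_inter_ideal:
  assumes simple: "graded_simple A" and J: "two_sided_ideal J" "J \<noteq> UNIV"
    and x: "x \<in> A t" "x \<in> J"
  shows "x = 0"
proof -
  have subJ: "subspace J" and multJ: "\<And>a x. x \<in> J \<Longrightarrow> a * x \<in> J \<and> x * a \<in> J"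
    using J(1) by (auto simp: two_sided_ideal_def)
  define I where "I = {x. \<forall>t. component x t \<in> J}"
  have I_sub: "I \<subseteq> J"
  proof
    fix x assume "x \<in> I"
    then have "(\<Sum>t | component x t \<noteq> 0. component x t) \<in> J"
      by (intro subspace_sum subJ) (auto simp: I_def)
    then show "x \<in> J" by (simp add: component_props)
  qed
  have subI: "subspace I"
    using subspace_0[OF subJ] subspace_add[OF subJ] subspace_scale[OF subJ]
    by (auto simp: I_def subspace_def component_add component_scale)
  \<comment> \<open>The components of a x are a times those of x. Those of x a are x times the
    components of a, and they lie in J because x does.\<close>
  have "two_sided_ideal I"
    unfolding two_sided_ideal_def
    using subI I_sub multJ by (auto simp: I_def component_mult)
  moreover have "direct_sum (\<lambda>t. I \<inter> A t) I"
    unfolding direct_sum_def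
  proof (intro conjI allI)
    show "subspace (I \<inter> A t)" for t using subI subspace_A by (rule subspace_inter)
    let ?S = "\<lambda>f. \<Sum>t | f t \<noteq> 0. f t"
    let ?F = "{f. finite {t. f t \<noteq> 0} \<and> (\<forall>t. f t \<in> I \<inter> A t)}"
    show "bij_betw ?S ?F I"
      unfolding bij_betw_def
    proof
      have "bij_betw ?S {f. finite {t. f t \<noteq> 0} \<and> (\<forall>t. f t \<in> A t)} UNIV"
        using grading by (simp add: grading_def direct_sum_def)
      then show "inj_on ?S ?F"
        by (intro inj_on_subset[OF bij_betw_imp_inj_on]) auto
      show "?S ` ?F = I"
      proof (rule subset_antisym; rule subsetI)
        show "x \<in> I" if "x \<in> ?S ` ?F" for x
          using that subI by (auto intro!: subspace_sum)
        fix x assume "x \<in> I"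
        then have "component x t \<in> I" for t
          using subspace_0[OF subJ] component_homogeneous[OF component_props(2), of x t]
          by (auto simp: I_def)
        then show "x \<in> ?S ` ?F"
          using component_props by (intro image_eqI[of _ _ "component x"]) auto
      qed
    qed
  qed
  ultimately have "I = {0} \<or> I = UNIV" using simple by (simp add: graded_simple_def)
  then have "I = {0}" using I_sub J(2) by auto
  moreover have "x \<in> I"
    using x subspace_0[OF subJ] by (auto simp: I_def component_homogeneous)
  ultimately show "x = 0" by simp
qed

end

section \<open>Left ideals of the algebra of two by two matrices\<close>

definition outer2 :: "(bool \<Rightarrow> 'f::comm_ring_1) \<Rightarrow> (bool \<Rightarrow> 'f) \<Rightarrow> 'f mat2"
  where "outer2 p w = (\<lambda>i j. p i * w j)"

locale matrix_rep = nonunital_algebra scale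
  for scale :: "'f::field \<Rightarrow> 'a::ring \<Rightarrow> 'a" +
  fixes J :: "'a set" and R :: "'a \<Rightarrow> 'f mat2"
  assumes R_add: "R (x + y) = (\<lambda>i j. R x i j + R y i j)"
    and R_scale: "R (scale c x) = (\<lambda>i j. c * R x i j)"
    and R_mult: "R (x * y) = mat2_mult (R x) (R y)"
    and R_kernel: "R x = (\<lambda>i j. 0) \<longleftrightarrow> x \<in> J"
    and R_surj: "surj R"
begin

lemma R_diff: "R (x - y) = (\<lambda>i j. R x i j - R y i j)"
proof -
  have "R (x - y) = R (x + scale (- 1) y)" by simp
  then show ?thesis unfolding R_add R_scale by simp
qed

lemma R_eq_iff: "R x = R y \<longleftrightarrow> x - y \<in> J"
  unfolding R_kernel[symmetric] R_diff by (auto simp: fun_eq_iff)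

lemma R_0: "R 0 i j = 0"
  using R_scale[of 0 0] by simp

lemma R_sum: "R (\<Sum>s\<in>S. x s) i j = (\<Sum>s\<in>S. R (x s) i j)"
  by (induction S rule: infinite_finite_induct) (simp_all add: R_0 R_add)

text \<open>A matrix with p in column i and zeros elsewhere picks out row i of \<open>R x\<close>
  and spreads it along p.\<close>

lemma row_in_image:
  assumes U: "\<And>a x. x \<in> U \<Longrightarrow> a * x \<in> U" and x: "x \<in> U"
  shows "outer2 p (R x i) \<in> R ` U"
proof -
  obtain a where a: "R a = outer2 p (\<lambda>k. if k = i then 1 else 0)"
    using R_surj by (metis surjD)
  have "R (a * x) = outer2 p (R x i)"
    unfolding R_mult a by (cases i) (auto simp: mat2_mult_def outer2_def)
  then show ?thesis using U[OF x, of a] by (metis imageI)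
qed

text \<open>A left ideal of M_2 is determined by the space of rows of its elements, which is zero, a
  line or the plane.\<close>

lemma left_ideal_cases:
  assumes sub: "subspace U" and U: "\<And>a x. x \<in> U \<Longrightarrow> a * x \<in> U"
  obtains "U \<subseteq> J" | w where "w \<noteq> (\<lambda>_. 0)" "R ` U = range (\<lambda>p. outer2 p w)" | "R ` U = UNIV"
proof (cases "\<forall>x\<in>U. \<forall>i. R x i = (\<lambda>_. 0)")
  case True
  then have "U \<subseteq> J" using R_kernel by (auto simp: fun_eq_iff)
  then show ?thesis by (rule that)
next
  case False
  then obtain x i where x: "x \<in> U" "R x i \<noteq> (\<lambda>_. 0)" by auto
  define w where "w = R x i"
  have w: "outer2 p w \<in> R ` U" for p unfolding w_def using U x(1) by (rule row_in_image)
  show ?thesis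
  proof (cases "\<forall>y\<in>U. \<forall>k. det2 w (R y k) = 0")
    case True
    have "R y \<in> range (\<lambda>p. outer2 p w)" if y: "y \<in> U" for y
    proof -
      have "\<exists>c. \<forall>j. R y k j = c * w j" for k
      proof -
        have d: "w False * R y k True = w True * R y k False" using True y by (simp add: det2_def)
        have "w False \<noteq> 0 \<or> w True \<noteq> 0"
          using x(2) by (auto simp: w_def fun_eq_iff) (metis (full_types))
        then show ?thesis
        proof
          assume nz: "w False \<noteq> 0"
          have "R y k j = R y k False / w False * w j" for j
            using d nz by (cases j) (simp_all add: field_simps)
          then show ?thesis by blast
        next
          assume nz: "w True \<noteq> 0"
          have "R y k j = R y k True / w True * w j" for j
            using d nz by (cases j) (simp_all add: field_simps)
          then show ?thesis by blast
        qed
      qed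
      then obtain c where "\<And>k j. R y k j = c k * w j" by metis
      then have "R y = outer2 c w" by (simp add: outer2_def fun_eq_iff)
      then show ?thesis by blast
    qed
    then have "R ` U = range (\<lambda>p. outer2 p w)" using w by auto
    with x(2) show ?thesis by (intro that(2)[of w]) (auto simp: w_def)
  next
    case False
    then obtain y k where y: "y \<in> U" "det2 w (R y k) \<noteq> 0" by auto
    define r where "r = R y k"
    define d where "d = det2 w r"
    have d: "d \<noteq> 0" using y by (simp add: d_def r_def)
    have "M \<in> R ` U" for M
    proof -
      \<comment> \<open>Cramer's rule for writing row i of \<open>M\<close> as a combination of
        \<open>w\<close> and \<open>r\<close>.\<close>
      define p where "p = (\<lambda>i. (M i False * r True - M i True * r False) / d)"
      define q where "q = (\<lambda>i. (M i True * w False - M i False * w True) / d)"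
      obtain a b where ab: "a \<in> U" "R a = outer2 p w" "b \<in> U" "R b = outer2 q r"
        using w[of p] row_in_image[OF U y(1), of q k] unfolding r_def by auto
      have "p i * w j + q i * r j = M i j" for i j
      proof (cases j)
        case True
        have "p i * w True + q i * r True = M i True * (w False * r True - w True * r False) / d"
          unfolding p_def q_def using d by (simp add: field_simps)
        then show ?thesis using d True by (simp add: d_def det2_def)
      next
        case False
        have "p i * w False + q i * r False = M i False * (w False * r True - w True * r False) / d"
          unfolding p_def q_def using d by (simp add: field_simps)
        then show ?thesis using d False by (simp add: d_def det2_def)
      qed
      then have "R (a + b) = M" unfolding R_add ab by (simp add: outer2_def)
      then show ?thesis using subspace_add[OF sub ab(1,3)] by blast
    qed
    then show ?thesis by (intro that(3)) auto
  qed
qed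

text \<open>Conjugating by the matrix with rows \<open>w\<^sub>0\<close> and \<open>w\<^sub>1\<close>.\<close>
lemma change_of_basis:
  assumes det: "det2 w\<^sub>0 w\<^sub>1 \<noteq> 0"
  shows "\<exists>S. matrix_rep scale J S \<and>
    (\<forall>U. R ` U = range (\<lambda>p. outer2 p w\<^sub>0) \<longrightarrow> (\<forall>i. unit2 i False \<in> S ` U)) \<and>
    (\<forall>U. R ` U = range (\<lambda>p. outer2 p w\<^sub>1) \<longrightarrow> (\<forall>i. unit2 i True \<in> S ` U))"
proof -
  let ?E = "(\<lambda>i j. if i = j then 1 else 0) :: 'f mat2"
  define d where "d = det2 w\<^sub>0 w\<^sub>1"
  have d: "w\<^sub>0 False * w\<^sub>1 True - w\<^sub>0 True * w\<^sub>1 False = d" "d \<noteq> 0" using det by (simp_all add: d_def det2_def)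
  define W where "W = (\<lambda>i. if i then w\<^sub>1 else w\<^sub>0)"
  \<comment> \<open>The inverse of \<open>W\<close>, as adjugate over determinant.\<close>
  define V where "V = (\<lambda>i j. (if i = j then W (\<not> i) (\<not> j) else - W i j) / d)"
  have WV: "mat2_mult W V = ?E" and VW: "mat2_mult V W = ?E"
    using d(2) by (auto intro!: mat2_eqI simp: mat2_mult_def W_def V_def field_simps)
      (use d in \<open>auto simp: algebra_simps\<close>)
  have assoc: "mat2_mult (mat2_mult P Q) M = mat2_mult P (mat2_mult Q M)" for P Q M :: "'f mat2"
    by (rule mat2_eqI) (simp add: mat2_mult_def algebra_simps)
  have one: "mat2_mult (?E) P = P" "mat2_mult P (?E) = P" for P
    using mat2_mult_one[of P] by (auto intro!: mat2_eqI simp: mat2_mult_def)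
  define S where "S x = mat2_mult W (mat2_mult (R x) V)" for x
  have R_S: "R x = mat2_mult V (mat2_mult (S x) W)" for x
  proof -
    have "mat2_mult V (mat2_mult (S x) W) = mat2_mult (mat2_mult V W) (mat2_mult (R x) (mat2_mult V W))"
      by (simp only: S_def assoc)
    then show ?thesis by (simp only: VW one)
  qed
  have "matrix_rep scale J S"
  proof
    show "S (x + y) = (\<lambda>i j. S x i j + S y i j)" for x y
      by (simp add: S_def R_add mat2_mult_def algebra_simps)
    show "S (scale c x) = (\<lambda>i j. c * S x i j)" for c x
      by (simp add: S_def R_scale mat2_mult_def algebra_simps)
    show "S (x * y) = mat2_mult (S x) (S y)" for x y
    proof -
      have "mat2_mult (S x) (S y) = mat2_mult W (mat2_mult (R x) (mat2_mult (mat2_mult V W) (mat2_mult (R y) V)))"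
        by (simp only: S_def assoc)
      then show ?thesis by (simp only: S_def R_mult VW one assoc)
    qed
    show "S x = (\<lambda>i j. 0) \<longleftrightarrow> x \<in> J" for x
    proof -
      have "S x = (\<lambda>i j. 0) \<longleftrightarrow> R x = (\<lambda>i j. 0)"
      proof
        assume "S x = (\<lambda>i j. 0)"
        then show "R x = (\<lambda>i j. 0)" using R_S[of x] by (simp add: mat2_mult_def)
      next
        assume "R x = (\<lambda>i j. 0)"
        then show "S x = (\<lambda>i j. 0)" by (simp add: S_def mat2_mult_def)
      qed
      then show ?thesis by (simp add: R_kernel)
    qed
    show "surj S"
      unfolding surj_def
    proof
      fix M
      obtain x where "R x = mat2_mult V (mat2_mult M W)" using R_surj by (metis surjD)
      then have "S x = mat2_mult (mat2_mult W V) (mat2_mult M (mat2_mult W V))"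
        by (simp only: S_def assoc)
      then have "M = S x" by (simp only: WV one)
      then show "\<exists>x. M = S x" ..
    qed
  qed
  moreover have unit: "unit2 i j \<in> S ` U" if U: "R ` U = range (\<lambda>p. outer2 p (W j))" for U i j
  proof -
    \<comment> \<open>Column i of \<open>V\<close> times row j of \<open>W\<close> is V E_ij W,
      which the conjugation turns into E_ij.\<close>
    have "outer2 (\<lambda>k. V k i) (W j) \<in> R ` U" unfolding U by blast
    then obtain x where x: "x \<in> U" "R x = outer2 (\<lambda>k. V k i) (W j)" by auto
    have "S x k l = mat2_mult W V k i * mat2_mult W V j l" for k l
      unfolding S_def x by (simp add: mat2_mult_def outer2_def algebra_simps)
    then have "S x = unit2 i j" unfolding WV by (auto simp: unit2_def fun_eq_iff)
    then show ?thesis using x(1) by (metis imageI)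
  qed
  have "(\<forall>U. R ` U = range (\<lambda>p. outer2 p w\<^sub>0) \<longrightarrow> (\<forall>i. unit2 i False \<in> S ` U)) \<and>
     (\<forall>U. R ` U = range (\<lambda>p. outer2 p w\<^sub>1) \<longrightarrow> (\<forall>i. unit2 i True \<in> S ` U))"
    using unit[of _ False] unit[of _ True] unfolding W_def by simp
  ultimately show ?thesis by blast
qed

end

section \<open>The matrix representation and the dimensions of images\<close>

context nonunital_algebra
begin

lemma ex_matrix_rep:
  assumes J: "two_sided_ideal J" and iso: "iso_matrix_algebra (quotient_algebra scale J) 2"
  shows "\<exists>R. matrix_rep scale J R"
proof -
  let ?Q = "quotient_algebra scale J"
  have subJ: "subspace J" and multJ: "\<And>a x. x \<in> J \<Longrightarrow> a * x \<in> J \<and> x * a \<in> J"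
    using J by (auto simp: two_sided_ideal_def)
  have carrier: "carrier ?Q = range (coset J)"
    by (simp add: quotient_algebra_def quotient_space_def)
  have add: "coset J x \<oplus>\<^bsub>?Q\<^esub> coset J y = coset J (x + y)" for x y
    by (simp add: quotient_algebra_def quotient_space_def UN_coset_add[OF subJ])
  have smult: "c \<odot>\<^bsub>?Q\<^esub> coset J x = coset J (scale c x)" for c x
    by (simp add: quotient_algebra_def quotient_space_def UN_coset_scale[OF subJ])
  have mult: "coset J x \<otimes>\<^bsub>?Q\<^esub> coset J y = coset J (x * y)" for x y
  proof -
    have "coset J (x' * y') = coset J (x * y)" if x': "x' \<in> coset J x" and y': "y' \<in> coset J y" for x' y'
    proof -
      obtain u v where uv: "x' = x + u" "y' = y + v" "u \<in> J" "v \<in> J"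
        using x' y' by (auto simp: coset_def)
      have "x' * y' - x * y = x * v + (u * y + u * v)" by (simp add: uv algebra_simps)
      also have "\<dots> \<in> J" using uv multJ by (intro subspace_add[OF subJ]) auto
      finally show ?thesis by (simp add: coset_eq_iff[OF subJ])
    qed
    moreover have "x \<in> coset J x" "y \<in> coset J y"
      using subspace_0[OF subJ] by (force simp: coset_def)+
    ultimately have "(\<Union>x'\<in>coset J x. \<Union>y'\<in>coset J y. coset J (x' * y')) = coset J (x * y)" by blast
    then show ?thesis by (simp add: quotient_algebra_def)
  qed
  obtain h where bij: "bij_betw h (range (coset J)) (carrier_mat 2 2)"
    and h_add: "\<And>x y. h (coset J (x + y)) = h (coset J x) + h (coset J y)"
    and h_mult: "\<And>x y. h (coset J (x * y)) = h (coset J x) * h (coset J y)"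
    and h_smult: "\<And>c x. h (coset J (scale c x)) = c \<cdot>\<^sub>m h (coset J x)"
    using iso unfolding iso_matrix_algebra_def carrier by (auto simp: add mult smult)
  have h_carrier: "h (coset J x) \<in> carrier_mat 2 2" for x
    using bij by (auto simp: bij_betw_def)
  then have dim: "dim_row (h (coset J x)) = 2" "dim_col (h (coset J x)) = 2" for x by (metis carrier_matD)+
  define ix where "ix b = (if b then 1 else 0 :: nat)" for b
  have ix: "ix b < 2" for b by (simp add: ix_def)
  define R where "R x = (\<lambda>i j. h (coset J x) $$ (ix i, ix j))" for x
  have R_eq: "R x = R y \<longleftrightarrow> coset J x = coset J y" for x y
  proof
    assume eq: "R x = R y"
    have "h (coset J x) = h (coset J y)"
    proof (rule eq_matI)
      fix i j assume "i < dim_row (h (coset J y))" "j < dim_col (h (coset J y))"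
      then have "i = ix (i = 1)" "j = ix (j = 1)" by (auto simp: dim ix_def)
      then show "h (coset J x) $$ (i, j) = h (coset J y) $$ (i, j)"
        using fun_cong[OF fun_cong[OF eq, of "i = 1"], of "j = 1"] by (simp add: R_def)
    qed (simp_all add: dim)
    then show "coset J x = coset J y" using bij by (auto simp: bij_betw_def dest: inj_onD)
  qed (simp add: R_def)
  have R_scale: "R (scale c x) = (\<lambda>i j. c * R x i j)" for c x
    by (simp add: R_def h_smult dim ix)
  have "matrix_rep scale J R"
  proof
    show "R (x + y) = (\<lambda>i j. R x i j + R y i j)" for x y
      by (simp add: R_def h_add dim ix)
    show "R (scale c x) = (\<lambda>i j. c * R x i j)" for c x by (rule R_scale)
    show "R (x * y) = mat2_mult (R x) (R y)" for x y
      by (auto simp: R_def h_mult mat2_mult_def dim ix scalar_prod_def ix_def numeral_2_eq_2 fun_eq_iff)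
    show "R x = (\<lambda>i j. 0) \<longleftrightarrow> x \<in> J" for x
    proof -
      have "R 0 = (\<lambda>i j. 0)" using R_scale[of 0 0] by simp
      then show ?thesis using R_eq[of x 0] by (simp add: coset_eq_iff[OF subJ])
    qed
    show "surj R"
      unfolding surj_def
    proof
      fix M :: "'f mat2"
      have "mat 2 2 (\<lambda>(i, j). M (i = 1) (j = 1)) \<in> h ` range (coset J)"
        using bij by (auto simp: bij_betw_def)
      then obtain x where "h (coset J x) = mat 2 2 (\<lambda>(i, j). M (i = 1) (j = 1))" by auto
      then have "M = R x" by (auto simp: R_def ix_def fun_eq_iff)
      then show "\<exists>x. M = R x" ..
    qed
  qed
  then show ?thesis by blast
qed

end

context matrix_rep
begin

text \<open>Matrices become functions of an index pair, so that dimensions of images are taken in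
  the function space used for the codimensions.\<close>

definition flat :: "'a \<Rightarrow> bool \<times> bool \<Rightarrow> 'f"
  where "flat x = (\<lambda>(i, j). R x i j)"

lemma flat_linear: "Vector_Spaces.linear scale fun_scale flat"
  by (intro Vector_Spaces.linear_iff[THEN iffD2] conjI allI)
    (auto simp: vector_space_axioms fun_space.vector_space_axioms flat_def R_add R_scale fun_scale_def fun_eq_iff)

lemma module_dim_image:
  assumes J: "subspace J" and U: "subspace U"
  shows "module_dim ((quotient_algebra scale J)\<lparr>carrier := coset J ` U\<rparr>) = fun_space.dim (flat ` U)"
proof (rule module_dim_cosets[OF flat_linear U J])
  show "flat w = 0" if "w \<in> J" for w
    using that unfolding R_kernel[symmetric] by (simp add: flat_def fun_eq_iff)
  show "x \<in> J" if "flat x = 0" for x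
    using that unfolding R_kernel[symmetric] by (simp add: flat_def fun_eq_iff)
  show "finite ((\<lambda>y. \<lambda>x. if x = y then 1 else (0::'f)) ` (UNIV :: (bool \<times> bool) set))" by simp
  show "flat ` U \<subseteq> fun_space.span ((\<lambda>y. \<lambda>x. if x = y then 1 else 0) ` UNIV)"
    by (auto intro!: fun_space_span_support)
qed (simp_all add: quotient_algebra_def quotient_space_def)

lemma flat_image: "flat ` U = (\<lambda>M (i, j). M i j) ` R ` U"
  by (simp add: flat_def image_image)

lemma dim_image_zero: "U \<subseteq> J \<Longrightarrow> fun_space.dim (flat ` U) = 0"
proof -
  assume "U \<subseteq> J"
  then have "R x = (\<lambda>i j. 0)" if "x \<in> U" for x using R_kernel that by blast
  then have "flat ` U \<subseteq> {0}" by (auto simp: flat_def fun_eq_iff)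
  then show ?thesis using fun_space.dim_le_card[of "flat ` U" "{}"] by simp
qed

lemma dim_image_row:
  assumes w: "w \<noteq> (\<lambda>_. 0)" and U: "R ` U = range (\<lambda>p. outer2 p w)"
  shows "fun_space.dim (flat ` U) = 2"
proof -
  define g where "g k = (\<lambda>(i, j). if i = k then w j else 0)" for k :: bool
  have sum: "(\<Sum>k\<in>UNIV. fun_scale (c k) (g k)) = (\<lambda>(i, j). c i * w j)" for c
  proof -
    have "(\<Sum>k\<in>UNIV. fun_scale (c k) (g k)) (i, j) = c i * w j" for i j
      unfolding sum_fun_apply by (cases i) (simp_all add: UNIV_bool fun_scale_def g_def)
    then show ?thesis by auto
  qed
  have "flat ` U = fun_space.span (g ` UNIV)"
  proof (rule subset_antisym; rule subsetI)
    fix f assume "f \<in> flat ` U"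
    then obtain p where "f = (\<lambda>M (i, j). M i j) (outer2 p w)"
      unfolding flat_image U by blast
    then have "f = (\<lambda>(i, j). p i * w j)" by (simp add: outer2_def)
    also have "\<dots> = (\<Sum>k\<in>UNIV. fun_scale (p k) (g k))" by (rule sum[symmetric])
    also have "\<dots> \<in> fun_space.span (g ` UNIV)"
      by (intro fun_space.span_sum fun_space.span_scale fun_space.span_base imageI UNIV_I)
    finally show "f \<in> fun_space.span (g ` UNIV)" .
  next
    fix f assume "f \<in> fun_space.span (g ` UNIV)"
    moreover have "inj g"
    proof (rule injI)
      fix k l assume eq: "g k = g l"
      obtain j where j: "w j \<noteq> 0" using w by auto
      have "g k (k, j) = g l (k, j)" using eq by simp
      then show "k = l" using j by (simp add: g_def split: if_splits)
    qed
    ultimately obtain r where "f = (\<Sum>k\<in>UNIV. fun_scale (r (g k)) (g k))"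
      using fun_space.span_finite[of "g ` UNIV"] by (auto simp: sum.reindex)
    then have "f = (\<lambda>M (i, j). M i j) (outer2 (\<lambda>k. r (g k)) w)" unfolding sum by (simp add: outer2_def)
    then show "f \<in> flat ` U" unfolding flat_image U by blast
  qed
  moreover have "fun_space.dim (fun_space.span (g ` UNIV)) = card (UNIV :: bool set)"
  proof (rule fun_space.dim_span_family)
    fix c assume "(\<Sum>k\<in>UNIV. fun_scale (c k) (g k)) = 0"
    then have "c i * w j = 0" for i j unfolding sum by (auto dest: fun_cong[of _ _ "(i, j)"])
    then show "\<forall>k\<in>UNIV. c k = 0" using w by (metis mult_eq_0_iff ext)
  qed simp
  ultimately show ?thesis by simp
qed

lemma dim_image_full:
  assumes U: "R ` U = UNIV"
  shows "fun_space.dim (flat ` U) = 4"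
proof -
  define g where "g = (\<lambda>(y :: bool \<times> bool) x. if x = y then 1 else (0::'f))"
  have "f \<in> fun_space.span (g ` UNIV)" for f
    unfolding g_def by (rule fun_space_span_support) auto
  moreover have "f \<in> flat ` U" for f
    unfolding flat_image U by (intro image_eqI[of _ _ "\<lambda>i j. f (i, j)"]) auto
  ultimately have "flat ` U = fun_space.span (g ` UNIV)" by auto
  moreover have "fun_space.dim (fun_space.span (g ` UNIV)) = card (UNIV :: (bool \<times> bool) set)"
  proof (rule fun_space.dim_span_family)
    fix c assume z: "(\<Sum>k\<in>UNIV. fun_scale (c k) (g k)) = 0"
    have "(\<Sum>k\<in>UNIV. fun_scale (c k) (g k) x) = 0" for x
      using fun_cong[OF z, of x] by (simp only: sum_fun_apply zero_fun_apply)
    moreover have "(\<Sum>k\<in>UNIV. fun_scale (c k) (g k) x) = (\<Sum>k\<in>UNIV. if k = x then c x else 0)" for x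
      by (intro sum.cong) (auto simp: fun_scale_def g_def)
    ultimately show "\<forall>k\<in>UNIV. c k = 0" by (simp add: sum.delta)
  qed simp
  moreover have "card (UNIV :: (bool \<times> bool) set) = 4"
    by (simp add: card_cartesian_product flip: UNIV_Times_UNIV)
  ultimately show ?thesis by simp
qed

end

abbreviation delta2 :: "bool \<Rightarrow> bool \<Rightarrow> 'f::comm_ring_1"
  where "delta2 a \<equiv> (\<lambda>k. if k = a then 1 else 0)"

lemma det2_delta2 [simp]:
  "det2 (delta2 False) (delta2 True) = 1" "det2 (delta2 a) (delta2 a) = 0"
  by (cases a; simp add: det2_def)+

text \<open>Nonzero rows with vanishing determinant are proportional, and the scalar can be moved
  into the column. Contraposed, degrees in different classes have linearly independent rows.\<close>

lemma det2_eq_0_imp_range_outer2_eq: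
  fixes w w' :: "bool \<Rightarrow> 'f::field"
  assumes "det2 w w' = 0" "w \<noteq> (\<lambda>_. 0)" "w' \<noteq> (\<lambda>_. 0)"
  shows "range (\<lambda>p. outer2 p w) = range (\<lambda>p. outer2 p w')"
proof -
  have "\<exists>c. v = (\<lambda>j. c * u j)" if uv: "det2 u v = 0" "u \<noteq> (\<lambda>_. 0)" for u v :: "bool \<Rightarrow> 'f"
  proof -
    have d: "u False * v True = u True * v False" using uv(1) by (simp add: det2_def)
    obtain k where k: "u k \<noteq> 0" using uv(2) by auto
    have "v j = v k / u k * u j" for j
      using d k by (cases j; cases k) (simp_all add: field_simps)
    then show ?thesis by blast
  qed
  note parallel = this
  have "range (\<lambda>p. outer2 p v) \<subseteq> range (\<lambda>p. outer2 p u)" if uv: "det2 u v = 0" "u \<noteq> (\<lambda>_. 0)" for u v :: "bool \<Rightarrow> 'f"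
  proof -
    obtain c where c: "v = (\<lambda>j. c * u j)" using parallel[OF uv] by auto
    have "outer2 p v = outer2 (\<lambda>i. p i * c) u" for p by (simp add: c outer2_def mult.assoc)
    then show ?thesis by auto
  qed
  from this[of w w'] this[of w' w] show ?thesis
    using assms by (auto simp: det2_def algebra_simps)
qed

section \<open>A homogeneous basis of rank one elements\<close>

locale graded_matrix_rep = right_zero_graded scale A + matrix_rep scale J R
  for scale :: "'f::field_char_0 \<Rightarrow> 'a::ring \<Rightarrow> 'a"
    and A :: "'t::semigroup_mult \<Rightarrow> 'a set" and J :: "'a set" and R :: "'a \<Rightarrow> 'f mat2" +
  assumes A_inter_J: "x \<in> A t \<Longrightarrow> x \<in> J \<Longrightarrow> x = 0"
begin

definition T_full :: "'t set"
  where "T_full = {t. R ` A t = UNIV}"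

definition T_row :: "'t set"
  where "T_row = {t. \<exists>w. w \<noteq> (\<lambda>_. 0) \<and> R ` A t = range (\<lambda>p. outer2 p w)}"

definition row :: "'t \<Rightarrow> bool \<Rightarrow> 'f"
  where "row t = (SOME w. w \<noteq> (\<lambda>_. 0) \<and> R ` A t = range (\<lambda>p. outer2 p w))"

lemma row:
  assumes "t \<in> T_row"
  shows "row t \<noteq> (\<lambda>_. 0)" "R ` A t = range (\<lambda>p. outer2 p (row t))"
proof -
  have "\<exists>w. w \<noteq> (\<lambda>_. 0) \<and> R ` A t = range (\<lambda>p. outer2 p w)"
    using assms by (simp add: T_row_def)
  from someI_ex[OF this] have "row t \<noteq> (\<lambda>_. 0) \<and> R ` A t = range (\<lambda>p. outer2 p (row t))"
    unfolding row_def .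
  then show "row t \<noteq> (\<lambda>_. 0)" "R ` A t = range (\<lambda>p. outer2 p (row t))"
    by (rule conjunct1, rule conjunct2)
qed

lemma R_inj_on_A: "x \<in> A t \<Longrightarrow> R x = (\<lambda>i j. 0) \<Longrightarrow> x = 0"
  using A_inter_J R_kernel by blast

text \<open>\<open>R\<close> maps \<open>A t\<close> onto a left ideal of M_2; if the image is zero,
  \<open>A t\<close> lies in J and is therefore zero.\<close>

lemma A_cases:
  obtains "A t = {0}" "t \<notin> T_row" "t \<notin> T_full" | "t \<in> T_row" "t \<notin> T_full" | "t \<in> T_full" "t \<notin> T_row"
proof -
  have not_full: "range (\<lambda>p. outer2 p w) \<noteq> UNIV" for w :: "bool \<Rightarrow> 'f"
  proof
    assume eq: "range (\<lambda>p. outer2 p w) = UNIV"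
    then have "unit2 False False \<in> range (\<lambda>p. outer2 p w)" "unit2 False True \<in> range (\<lambda>p. outer2 p w)"
      by auto
    then obtain p q where pq: "unit2 False False = outer2 p w" "unit2 False True = outer2 q w"
      by (elim rangeE)
    have "p False * w False = 1" "p False * w True = 0" "q False * w True = 1"
      using fun_cong[OF fun_cong[OF pq(1), of False], of False]
        fun_cong[OF fun_cong[OF pq(1), of False], of True]
        fun_cong[OF fun_cong[OF pq(2), of False], of True]
      by (simp_all add: unit2_def outer2_def)
    then show False by auto
  qed
  consider "A t \<subseteq> J" | w where "w \<noteq> (\<lambda>_. 0)" "R ` A t = range (\<lambda>p. outer2 p w)" | "R ` A t = UNIV"
    using left_ideal_cases[OF subspace_A[of t] A_left_ideal] by blast
  then show ?thesis
  proof cases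
    case 1
    have A0: "A t = {0}" using 1 A_inter_J subspace_0[OF subspace_A] by blast
    have R0: "R ` A t = {\<lambda>i j. 0}" unfolding A0 by (auto simp: R_0 fun_eq_iff)
    have "unit2 False False \<noteq> (\<lambda>i j. 0 :: 'f)"
      by (auto simp: unit2_def fun_eq_iff)
    moreover have "unit2 False False \<in> R ` A t" if "t \<in> T_full" using that by (simp add: T_full_def)
    ultimately have "t \<notin> T_full" unfolding R0 by blast
    moreover have "t \<notin> T_row"
    proof
      assume t: "t \<in> T_row"
      have "outer2 (\<lambda>_. 1) (row t) \<in> R ` A t" unfolding row(2)[OF t] by blast
      then have "outer2 (\<lambda>_. 1) (row t) = (\<lambda>i j. 0)" unfolding R0 by simp
      then have "row t j = 0" for j
        by (auto simp: outer2_def dest: fun_cong[of _ _ True] fun_cong[of _ _ j])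
      then show False using row(1)[OF t] by auto
    qed
    ultimately show ?thesis using A0 that by blast
  next
    case 2
    then have "t \<in> T_row" by (auto simp: T_row_def)
    moreover have "t \<notin> T_full" using 2 not_full by (simp add: T_full_def)
    ultimately show ?thesis using that by blast
  next
    case 3
    then have "t \<notin> T_row" using not_full by (auto simp: T_row_def)
    with 3 show ?thesis using that by (auto simp: T_full_def)
  qed
qed

text \<open>For a degree of rank one the index \<open>b\<close> is kept at \<open>False\<close>.\<close>
definition row_vec :: "'t \<Rightarrow> bool \<Rightarrow> bool \<Rightarrow> 'f"
  where "row_vec t b = (if t \<in> T_full then delta2 b else row t)"

definition basis_index :: "('t \<times> bool \<times> bool) set"
  where "basis_index = {(t, a, b). t \<in> T_full \<or> t \<in> T_row \<and> \<not> b}"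

text \<open>Such an element is unique because \<open>R\<close> is injective on \<open>A t\<close>;
  it exists for the triples in \<open>basis_index\<close>.\<close>

definition elem :: "'t \<times> bool \<times> bool \<Rightarrow> 'a"
  where "elem = (\<lambda>(t, a, b). SOME x. x \<in> A t \<and> R x = outer2 (delta2 a) (row_vec t b))"

lemma elem:
  assumes "(t, a, b) \<in> basis_index"
  shows "elem (t, a, b) \<in> A t" "R (elem (t, a, b)) = outer2 (delta2 a) (row_vec t b)"
proof -
  have "outer2 (delta2 a) (row_vec t b) \<in> R ` A t"
  proof (cases "t \<in> T_full")
    case True
    then show ?thesis by (simp add: T_full_def)
  next
    case False
    then have "t \<in> T_row" using assms by (auto simp: basis_index_def)
    then show ?thesis using False by (simp add: row_vec_def row(2))
  qed
  then obtain x where x: "outer2 (delta2 a) (row_vec t b) = R x" "x \<in> A t" by (rule imageE)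
  have "\<exists>x. x \<in> A t \<and> R x = outer2 (delta2 a) (row_vec t b)"
    using x(2) x(1)[symmetric] by (intro exI conjI)
  from someI_ex[OF this]
  have "elem (t, a, b) \<in> A t \<and> R (elem (t, a, b)) = outer2 (delta2 a) (row_vec t b)"
    unfolding elem_def prod.case .
  then show "elem (t, a, b) \<in> A t" "R (elem (t, a, b)) = outer2 (delta2 a) (row_vec t b)"
    by (rule conjunct1, rule conjunct2)
qed

lemma sum_A_eq_0:
  assumes T: "finite T" "\<And>t. t \<in> T \<Longrightarrow> x t \<in> A t" and sum: "(\<Sum>t\<in>T. x t) = 0" and t: "t \<in> T"
  shows "x t = 0"
proof -
  have "component 0 = (\<lambda>t. if t \<in> T then x t else 0)" by (rule component_eqI[OF T sum])
  from fun_cong[OF this, of t] show ?thesis using t by simp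
qed

text \<open>The grading separates the degrees. Within one degree a single entry of the matrix
  isolates a coefficient: (a, b) for a full degree, and (a, j) with
  \<open>row t j \<noteq> 0\<close> otherwise.\<close>

lemma elem_independent:
  assumes S: "finite S" "S \<subseteq> basis_index" and sum: "(\<Sum>s\<in>S. scale (c s) (elem s)) = 0"
  shows "\<forall>s\<in>S. c s = 0"
proof
  fix s assume s: "s \<in> S"
  obtain t a b where s_eq: "s = (t, a, b)" by (cases s)
  let ?S = "\<lambda>t. {s \<in> S. fst s = t}"
  have "(\<Sum>t\<in>fst ` S. \<Sum>s\<in>?S t. scale (c s) (elem s)) = 0"
    using sum.image_gen[OF S(1), of "\<lambda>s. scale (c s) (elem s)" fst] sum by simp
  moreover have "(\<Sum>s\<in>?S t. scale (c s) (elem s)) \<in> A t" for t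
  proof (intro subspace_sum subspace_scale subspace_A)
    fix s assume "s \<in> ?S t"
    then show "elem s \<in> A t" using S(2) elem(1) by (cases s) auto
  qed
  moreover have "finite (fst ` S)" "t \<in> fst ` S" using S(1) s s_eq by force+
  ultimately have "(\<Sum>s\<in>?S t. scale (c s) (elem s)) = 0"
    using sum_A_eq_0[where T = "fst ` S" and x = "\<lambda>t. \<Sum>s\<in>?S t. scale (c s) (elem s)"] by blast
  then have R0: "(\<Sum>s\<in>?S t. R (scale (c s) (elem s)) a j) = 0" for j
    using R_sum[of "\<lambda>s. scale (c s) (elem s)" "?S t" a j] by (simp add: R_0)
  have idx: "(t, a, b) \<in> basis_index" using s s_eq S(2) by auto
  show "c s = 0"
  proof (cases "t \<in> T_full")
    case True
    have "(\<Sum>s\<in>?S t. R (scale (c s) (elem s)) a b) = (\<Sum>s'\<in>?S t. if s' = s then c s else 0)"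
    proof (rule sum.cong)
      fix s' assume s': "s' \<in> ?S t"
      then obtain a' b' where s'_eq: "s' = (t, a', b')" "(t, a', b') \<in> basis_index"
        using S(2) by (cases s') auto
      then show "R (scale (c s') (elem s')) a b = (if s' = s then c s else 0)"
        using True by (simp add: s'_eq(1) s_eq R_scale elem(2)[OF s'_eq(2)] outer2_def row_vec_def)
    qed simp
    then show ?thesis using R0[of b] S(1) s s_eq by (simp add: sum.delta)
  next
    case False
    then have t: "t \<in> T_row" and b: "\<not> b" using idx by (auto simp: basis_index_def)
    obtain j where j: "row t j \<noteq> 0" using row(1)[OF t] by auto
    have "(\<Sum>s\<in>?S t. R (scale (c s) (elem s)) a j) = (\<Sum>s'\<in>?S t. if s' = s then c s * row t j else 0)"
    proof (rule sum.cong)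
      fix s' assume s': "s' \<in> ?S t"
      then obtain a' b' where s'_eq: "s' = (t, a', b')" "(t, a', b') \<in> basis_index"
        using S(2) by (cases s') auto
      have "R (elem s') a j = (if a = a' then row t j else 0)"
        using False by (simp add: s'_eq(1) elem(2)[OF s'_eq(2)] outer2_def row_vec_def)
      moreover have "\<not> b'" using s'_eq(2) False by (auto simp: basis_index_def)
      ultimately show "R (scale (c s') (elem s')) a j = (if s' = s then c s * row t j else 0)"
        using b by (auto simp: s'_eq(1) s_eq R_scale)
    qed simp
    then show ?thesis using R0[of j] S(1) s s_eq j by (simp add: sum.delta)
  qed
qed

lemma A_subset_span_elem: "A t \<subseteq> span (elem ` {s \<in> basis_index. fst s = t})"
proof
  fix x assume x: "x \<in> A t"
  let ?K = "elem ` {s \<in> basis_index. fst s = t}"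
  have eq: "x = y" if "y \<in> A t" "R x = R y" for y
  proof -
    have "x - y = 0"
      using that x by (intro R_inj_on_A[of _ t] subspace_diff subspace_A) (auto simp: R_diff)
    then show ?thesis by simp
  qed
  have in_K: "elem (t, a, b) \<in> span ?K" if "(t, a, b) \<in> basis_index" for a b
    using that by (intro span_base imageI) simp
  show "x \<in> span ?K"
  proof (cases t rule: A_cases)
    case 1
    then show ?thesis using x by (simp add: span_zero)
  next
    case 2
    obtain p where p: "R x = outer2 p (row t)" using x row(2)[OF 2(1)] by blast
    have idx: "(t, a, False) \<in> basis_index" for a using 2 by (simp add: basis_index_def)
    let ?y = "scale (p False) (elem (t, False, False)) + scale (p True) (elem (t, True, False))"
    have "R ?y i j = R x i j" for i j
      using 2 by (cases i) (simp_all add: R_add R_scale elem(2)[OF idx] outer2_def row_vec_def p)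
    then have "x = ?y"
      using elem(1)[OF idx] by (intro eq subspace_add subspace_scale subspace_A) (auto intro!: ext)
    also have "?y \<in> span ?K" by (intro span_add span_scale in_K idx)
    finally show ?thesis .
  next
    case 3
    have idx: "(t, a, b) \<in> basis_index" for a b using 3 by (simp add: basis_index_def)
    let ?y = "scale (R x False False) (elem (t, False, False)) + scale (R x False True) (elem (t, False, True))
      + (scale (R x True False) (elem (t, True, False)) + scale (R x True True) (elem (t, True, True)))"
    have "R ?y i j = R x i j" for i j
      using 3 by (cases i; cases j) (simp_all add: R_add R_scale elem(2)[OF idx] outer2_def row_vec_def)
    then have "x = ?y"
      using elem(1)[OF idx] by (intro eq subspace_add subspace_scale subspace_A) (auto intro!: ext)
    also have "?y \<in> span ?K" by (intro span_add span_scale in_K idx)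
    finally show ?thesis .
  qed
qed

lemma span_elem: "span (elem ` basis_index) = UNIV"
proof -
  have "x \<in> span (elem ` basis_index)" for x
  proof -
    have "component x t \<in> span (elem ` basis_index)" for t
    proof -
      have "span (elem ` {s \<in> basis_index. fst s = t}) \<subseteq> span (elem ` basis_index)"
        by (intro span_mono image_mono) auto
      then show ?thesis using A_subset_span_elem component_props(2) by blast
    qed
    then have "(\<Sum>t | component x t \<noteq> 0. component x t) \<in> span (elem ` basis_index)"
      by (intro span_sum)
    then show ?thesis by (simp add: component_props)
  qed
  then show ?thesis by auto
qed

lemma finite_basis_index:
  assumes "finite_dimensional_vector_space scale D"
  shows "finite basis_index"
proof (rule ccontr)
  interpret FD: finite_dimensional_vector_space scale D by fact
  assume "infinite basis_index"
  then obtain S where S: "S \<subseteq> basis_index" "finite S" "card S = Suc (card D)"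
    by (metis infinite_arbitrarily_large)
  have fam: "inj_on elem S" "independent (elem ` S)"
    using independent_family[OF S(2), of elem] elem_independent[OF S(2,1)] by blast+
  have "card (elem ` S) \<le> card D"
    using independent_span_bound[OF FD.finite_Basis fam(2)] FD.span_Basis by auto
  then show False using S(3) fam(1) by (simp add: card_image)
qed

text \<open>Even if the band is infinite, only finitely many degrees carry anything nonzero: two
  columns for a fixed row, four matrix units for a full degree.\<close>

lemma card_basis_index:
  assumes "finite basis_index"
  shows "finite T_full" "finite T_row" "card basis_index = 2 * card T_row + 4 * card T_full"
proof -
  have eq: "basis_index = T_full \<times> UNIV \<union> T_row \<times> UNIV \<times> {False}"
    by (auto simp: basis_index_def)
  have "T_full \<subseteq> fst ` basis_index" "T_row \<subseteq> fst ` basis_index"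
    by (force simp: basis_index_def)+
  then show fin: "finite T_full" "finite T_row" using assms by (auto intro: finite_subset)
  have "T_full \<inter> T_row = {}" by (metis A_cases disjoint_iff)
  then have "card basis_index = card (T_full \<times> (UNIV :: (bool \<times> bool) set))
      + card (T_row \<times> (UNIV :: bool set) \<times> {False})"
    unfolding eq using fin by (intro card_Un_disjoint) auto
  moreover have "card (UNIV :: (bool \<times> bool) set) = 4"
    by (simp add: card_cartesian_product flip: UNIV_Times_UNIV)
  ultimately show "card basis_index = 2 * card T_row + 4 * card T_full"
    by (simp add: card_cartesian_product)
qed

lemma elem_basis:
  assumes fin: "finite basis_index"
  shows "inj_on elem basis_index" "independent (elem ` basis_index)" "dim UNIV = card basis_index"
proof -
  show fam: "inj_on elem basis_index" "independent (elem ` basis_index)"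
    using independent_family[OF fin, of elem] elem_independent[OF fin] by blast+
  have "dim UNIV = dim (span (elem ` basis_index))" by (simp add: span_elem)
  also have "\<dots> = card (elem ` basis_index)" using fam(2) by (simp add: dim_span dim_eq_card_independent)
  finally show "dim UNIV = card basis_index" using fam(1) by (simp add: card_image)
qed

lemma graded_basis_elem:
  assumes fin: "finite basis_index"
  shows "graded_basis scale A (elem ` basis_index) (\<lambda>x. fst (the_inv_into basis_index elem x))"
proof
  let ?deg = "\<lambda>x. fst (the_inv_into basis_index elem x)"
  have deg: "?deg (elem s) = fst s" if "s \<in> basis_index" for s
    using that by (simp add: the_inv_into_f_f elem_basis(1)[OF fin])
  show "subspace (A t)" for t by (rule subspace_A)
  show "finite (elem ` basis_index)" using fin by simp
  show "independent (elem ` basis_index)" by (rule elem_basis(2)[OF fin])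
  show "x \<in> A (?deg x)" if x: "x \<in> elem ` basis_index" for x
  proof -
    obtain t a b where "(t, a, b) \<in> basis_index" "x = elem (t, a, b)" using x by auto
    then show ?thesis using deg[of "(t, a, b)"] elem(1) by simp
  qed
  show "A t \<subseteq> span {x \<in> elem ` basis_index. ?deg x = t}" for t
  proof -
    have "elem ` {s \<in> basis_index. fst s = t} \<subseteq> {x \<in> elem ` basis_index. ?deg x = t}"
      using deg by auto
    from span_mono[OF this] show ?thesis using A_subset_span_elem by blast
  qed
  show "span (elem ` basis_index) = UNIV" by (rule span_elem)
qed

end


section \<open>Bounds for the codimensions\<close>

lemma mset_map_perfect_matching:
  assumes "perfect_matching [0..<length P] M"
  shows "mset (map ((!) P \<circ> fst) M @ map ((!) P \<circ> snd) M) = mset P"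
proof -
  have "mset (map ((!) P) (map fst M @ map snd M)) = mset (map ((!) P) [0..<length P])"
    unfolding mset_map using assms by (simp only: perfect_matching_def)
  then show ?thesis by (simp add: map_nth)
qed

text \<open>The fixed letters need homogeneous elements over the matrix units, and a degree with a
  fixed row can provide at most one column of these: \<open>s\<^sub>0\<close> provides the E_i0 and
  \<open>s\<^sub>1\<close> the E_i1. The last assumption is the hypothesis on T0 with the size of
  the class added to both sides.\<close>

locale unit_graded = graded_matrix_rep scale A J R
  for scale :: "'f::field_char_0 \<Rightarrow> 'a::ring \<Rightarrow> 'a"
    and A :: "'t::semigroup_mult \<Rightarrow> 'a set" and J :: "'a set" and R :: "'a \<Rightarrow> 'f mat2" +
  fixes s\<^sub>0 s\<^sub>1 :: 't
  assumes fin: "finite basis_index"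
    and units: "unit2 i False \<in> R ` A s\<^sub>0" "unit2 i True \<in> R ` A s\<^sub>1"
    and balanced: "t\<^sub>0 \<in> T_row \<Longrightarrow> 2 * card {t \<in> T_row. R ` A t = R ` A t\<^sub>0} \<le> card T_row"
begin

definition matrix_unit :: "bool \<Rightarrow> bool \<Rightarrow> 'a"
  where "matrix_unit i j = (SOME x. x \<in> A (if j then s\<^sub>1 else s\<^sub>0) \<and> R x = unit2 i j)"

lemma matrix_unit: "matrix_unit i j \<in> A (if j then s\<^sub>1 else s\<^sub>0)" "R (matrix_unit i j) = unit2 i j"
proof -
  have "unit2 i j \<in> R ` A (if j then s\<^sub>1 else s\<^sub>0)" using units by (cases j) auto
  then obtain x where x: "unit2 i j = R x" "x \<in> A (if j then s\<^sub>1 else s\<^sub>0)" by (rule imageE)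
  have "\<exists>x. x \<in> A (if j then s\<^sub>1 else s\<^sub>0) \<and> R x = unit2 i j"
    using x(2) x(1)[symmetric] by (intro exI conjI)
  from someI_ex[OF this] have "matrix_unit i j \<in> A (if j then s\<^sub>1 else s\<^sub>0) \<and> R (matrix_unit i j) = unit2 i j"
    unfolding matrix_unit_def .
  then show "matrix_unit i j \<in> A (if j then s\<^sub>1 else s\<^sub>0)" "R (matrix_unit i j) = unit2 i j"
    by (rule conjunct1, rule conjunct2)
qed

sublocale B: graded_basis scale A "elem ` basis_index" "\<lambda>x. fst (the_inv_into basis_index elem x)"
  using fin by (rule graded_basis_elem)

abbreviation T_all :: "'t set"
  where "T_all \<equiv> T_row \<union> T_full"

lemma T_disjoint: "t \<in> T_row \<Longrightarrow> t \<notin> T_full"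
  by (metis A_cases)

lemmas finite_T = card_basis_index(1,2)[OF fin]

definition degree_dim :: "'t \<Rightarrow> nat"
  where "degree_dim t = (if t \<in> T_full then 4 else 2)"

definition content :: "nat \<Rightarrow> 't multiset"
  where "content m = (\<Sum>t\<in>T_all. replicate_mset (m * degree_dim t) t)"

lemma count_content: "count (content m) t = (if t \<in> T_all then m * degree_dim t else 0)"
proof -
  have "count (content m) t = (\<Sum>s\<in>T_all. if s = t then m * degree_dim s else 0)"
    unfolding content_def count_sum by (intro sum.cong) auto
  then show ?thesis using finite_T by (simp add: sum.delta)
qed

lemma set_content: "set_mset (content m) \<subseteq> T_all"
proof
  fix t assume "t \<in># content m"
  then have "count (content m) t \<noteq> 0" by simp
  then show "t \<in> T_all" unfolding count_content by (metis)
qed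

lemma size_filter_content:
  "size (filter_mset P (content m)) = m * (\<Sum>t\<in>{t \<in> T_all. P t}. degree_dim t)"
proof -
  have "size (filter_mset P (content m)) = (\<Sum>t\<in>{t \<in> T_all. P t}. count (filter_mset P (content m)) t)"
    unfolding size_multiset_overloaded_eq
    using finite_T set_content[of m] by (intro sum.mono_neutral_left) (auto simp: not_in_iff)
  also have "\<dots> = (\<Sum>t\<in>{t \<in> T_all. P t}. m * degree_dim t)"
    by (intro sum.cong) (auto simp: count_content)
  finally show ?thesis by (simp add: sum_distrib_left)
qed

lemma sum_degree_dim_row: "S \<subseteq> T_row \<Longrightarrow> (\<Sum>t\<in>S. degree_dim t) = 2 * card S"
  using T_disjoint by (subst sum.cong[OF refl, of _ _ "\<lambda>_. 2"]) (auto simp: degree_dim_def)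

lemma sum_degree_dim_full: "(\<Sum>t\<in>T_full. degree_dim t) = 4 * card T_full"
  by (subst sum.cong[OF refl, of _ _ "\<lambda>_. 4"]) (auto simp: degree_dim_def)

lemma size_content: "size (content m) = m * card basis_index"
proof -
  have "size (content m) = m * (\<Sum>t\<in>T_all. degree_dim t)"
    using size_filter_content[of "\<lambda>_. True" m] by (simp add: Un_def)
  also have "(\<Sum>t\<in>T_all. degree_dim t) = (\<Sum>t\<in>T_row. degree_dim t) + (\<Sum>t\<in>T_full. degree_dim t)"
    using finite_T T_disjoint by (intro sum.union_disjoint) auto
  finally show ?thesis
    by (simp add: sum_degree_dim_row sum_degree_dim_full card_basis_index(3)[OF fin])
qed

definition full_positions :: "'t list \<Rightarrow> nat list"
  where "full_positions \<tau> = filter (\<lambda>i. \<tau> ! i \<in> T_full) [0..<length \<tau>]"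

definition row_positions :: "'t list \<Rightarrow> nat list"
  where "row_positions \<tau> = filter (\<lambda>i. \<tau> ! i \<notin> T_full) [0..<length \<tau>]"

lemma length_filter_nth:
  "length (filter (\<lambda>i. P (xs ! i)) [0..<length xs]) = size (filter_mset P (mset xs))"
proof -
  have "filter P xs = map ((!) xs) (filter (\<lambda>i. P (xs ! i)) [0..<length xs])"
    using filter_map[of P "(!) xs" "[0..<length xs]"] by (simp add: map_nth comp_def)
  then show ?thesis by (metis length_map mset_filter size_mset)
qed

lemma length_full_positions:
  assumes "mset \<tau> = content m"
  shows "length (full_positions \<tau>) = 4 * m * card T_full"
proof -
  have "length (full_positions \<tau>) = size (filter_mset (\<lambda>t. t \<in> T_full) (content m))"
    unfolding full_positions_def length_filter_nth[of "\<lambda>t. t \<in> T_full"] assms ..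
  also have "{t \<in> T_all. t \<in> T_full} = T_full" by auto
  ultimately show ?thesis
    by (simp add: size_filter_content sum_degree_dim_full)
qed

text \<open>Every degree in \<open>T_row\<close> occurs 2 m times, so a class of c degrees fills 2 m
  c of the 2 m \<open>card T_row\<close> positions, at most half of them by
  \<open>balanced\<close>.\<close>

lemma row_matching:
  assumes \<tau>: "mset \<tau> = content m"
  shows "\<exists>M. perfect_matching (row_positions \<tau>) M \<and> (\<forall>(i, j)\<in>set M. R ` A (\<tau> ! i) \<noteq> R ` A (\<tau> ! j))"
proof (rule ex_matching_different)
  have "length (row_positions \<tau>) = size (filter_mset (\<lambda>t. t \<notin> T_full) (content m))"
    unfolding row_positions_def length_filter_nth[of "\<lambda>t. t \<notin> T_full"] \<tau> ..
  also have "{t \<in> T_all. t \<notin> T_full} = T_row" using T_disjoint by auto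
  ultimately show "length (row_positions \<tau>) = 2 * (m * card T_row)"
    by (simp add: size_filter_content sum_degree_dim_row)
next
  fix c
  have "length (filter (\<lambda>i. R ` A (\<tau> ! i) = c) (row_positions \<tau>))
      = size (filter_mset (\<lambda>t. t \<notin> T_full \<and> R ` A t = c) (content m))"
    unfolding row_positions_def filter_filter
      length_filter_nth[of "\<lambda>t. t \<notin> T_full \<and> R ` A t = c"] \<tau> ..
  also have "{t \<in> T_all. t \<notin> T_full \<and> R ` A t = c} = {t \<in> T_row. R ` A t = c}" using T_disjoint by auto
  ultimately have eq: "length (filter (\<lambda>i. R ` A (\<tau> ! i) = c) (row_positions \<tau>)) = m * (2 * card {t \<in> T_row. R ` A t = c})"
    using sum_degree_dim_row[of "{t \<in> T_row. R ` A t = c}"] by (simp add: size_filter_content)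
  have "2 * card {t \<in> T_row. R ` A t = c} \<le> card T_row"
  proof (cases "\<exists>t\<^sub>0\<in>T_row. R ` A t\<^sub>0 = c")
    case True
    then show ?thesis using balanced by blast
  next
    case False
    then have empty: "{t \<in> T_row. R ` A t = c} = {}" by auto
    show ?thesis unfolding empty by simp
  qed
  then show "length (filter (\<lambda>i. R ` A (\<tau> ! i) = c) (row_positions \<tau>)) \<le> m * card T_row"
    unfolding eq by (rule mult_left_mono) simp
qed

text \<open>\<open>b\<close> has an entry for each position of full degree. Elsewhere the lookup
  fails and the value is \<open>False\<close>, as \<open>basis_index\<close> demands for degrees in
  \<open>T_row\<close>.\<close>

definition column :: "'t list \<Rightarrow> bool list \<Rightarrow> nat \<Rightarrow> bool"
  where "column \<tau> b i \<longleftrightarrow> map_of (zip (full_positions \<tau>) b) i = Some True"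

lemma column_imp_full: "column \<tau> b i \<Longrightarrow> \<tau> ! i \<in> T_full"
  unfolding column_def by (auto dest!: map_of_SomeD set_zip_leftD simp: full_positions_def)

lemma column_nth:
  assumes "length b = length (full_positions \<tau>)" "j < length b"
  shows "column \<tau> b (full_positions \<tau> ! j) \<longleftrightarrow> b ! j"
  using assms by (simp add: column_def map_of_zip_nth full_positions_def)

end

section \<open>The triangular family of polynomials\<close>

locale lower_bound = unit_graded scale A J R s\<^sub>0 s\<^sub>1
  for scale :: "'f::field_char_0 \<Rightarrow> 'a::ring \<Rightarrow> 'a"
    and A :: "'t::semigroup_mult \<Rightarrow> 'a set" and J :: "'a set" and R :: "'a \<Rightarrow> 'f mat2"
    and s\<^sub>0 s\<^sub>1 :: 't +
  fixes m e N n :: nat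
  assumes N_def: "N = m * card basis_index" and n_def: "n = N + 8 + e"
begin

definition fixed_index :: "nat \<Rightarrow> bool \<times> bool"
  where "fixed_index i = (if i \<in> {N + 4, N + 5} then (False, True)
    else if i \<in> {N + 6, N + 7} then (True, False) else (False, False))"

text \<open>From N on the column index of the matrix unit decides the degree; this includes the
  fillers from N + 8 on, which are E_00.\<close>

definition degree_at :: "'t list \<Rightarrow> nat \<Rightarrow> 't"
  where "degree_at \<tau> i = (if i < N then \<tau> ! i else if snd (fixed_index i) then s\<^sub>1 else s\<^sub>0)"

definition letter :: "'t list \<Rightarrow> bool list \<times> bool list \<Rightarrow> nat \<Rightarrow> 'a"
  where "letter \<tau> = (\<lambda>(a, b) i. if i < N then elem (\<tau> ! i, a ! i, column \<tau> b i)
    else case_prod matrix_unit (fixed_index i))"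

text \<open>Letters are counted from \<open>0\<close> but variables from \<open>1\<close>.\<close>
definition point :: "'t list \<Rightarrow> bool list \<times> bool list \<Rightarrow> 't \<times> nat \<Rightarrow> 'a"
  where "point \<tau> y = (\<lambda>(t, j). if 1 \<le> j \<and> degree_at \<tau> (j - 1) = t then letter \<tau> y (j - 1) else 0)"

lemma degrees:
  assumes "\<tau> \<in> permutations_of_multiset (content m)"
  shows "mset \<tau> = content m" "length \<tau> = N" "i < N \<Longrightarrow> \<tau> ! i \<in> T_all"
proof -
  show \<tau>: "mset \<tau> = content m" using assms by (simp add: permutations_of_multiset_def)
  show len: "length \<tau> = N" using arg_cong[OF \<tau>, of size] by (simp add: size_content N_def)
  assume "i < N"
  then have "\<tau> ! i \<in># mset \<tau>" using len by simp
  then show "\<tau> ! i \<in> T_all" unfolding \<tau> using set_content by blast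
qed

lemma index_in:
  assumes "\<tau> \<in> permutations_of_multiset (content m)" "i < N"
  shows "(\<tau> ! i, a, column \<tau> b i) \<in> basis_index"
  using degrees(3)[OF assms] column_imp_full[of \<tau> b i] by (auto simp: basis_index_def)

lemma letter_in:
  assumes "\<tau> \<in> permutations_of_multiset (content m)"
  shows "letter \<tau> y i \<in> A (degree_at \<tau> i)"
proof (cases "i < N")
  case True
  then show ?thesis
    using elem(1)[OF index_in[OF assms True]] by (simp add: letter_def degree_at_def case_prod_unfold)
next
  case False
  then show ?thesis
    using matrix_unit(1) by (simp add: letter_def degree_at_def case_prod_unfold)
qed

lemma point_in:
  assumes "\<tau> \<in> permutations_of_multiset (content m)"
  shows "point \<tau> y (t, j) \<in> A t"
  using letter_in[OF assms, of y "j - 1"] subspace_0[OF subspace_A]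
  by (cases "1 \<le> j \<and> degree_at \<tau> (j - 1) = t") (auto simp: point_def)

lemma rank_one_eval_letters:
  assumes "\<tau> \<in> permutations_of_multiset (content m)"
  shows "rank_one_eval (\<lambda>y i. R (letter \<tau> y i)) (\<lambda>y i. delta2 (fst y ! i))
    (\<lambda>y i. row_vec (\<tau> ! i) (column \<tau> (snd y) i)) N n"
proof
  show "R (letter \<tau> y i) = (\<lambda>p q. delta2 (fst y ! i) p * row_vec (\<tau> ! i) (column \<tau> (snd y) i) q)"
    if "i < N" for y i
    using elem(2)[OF index_in[OF assms that]] that
    by (simp add: letter_def case_prod_unfold outer2_def)
  show "N + 8 \<le> n" by (simp add: n_def)
qed (auto simp: letter_def fixed_index_def matrix_unit)

lemma subst_letters_eq_0:
  "x \<in> set ls \<Longrightarrow> \<rho> x = 0 \<Longrightarrow> subst_letters \<rho> ls = (0 :: 'a)" for \<rho> :: "'t \<times> nat \<Rightarrow> 'a"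
  by (induction \<rho> ls rule: subst_letters.induct) auto

lemma R_subst_letters:
  "w \<noteq> [] \<Longrightarrow> R (subst_letters (point \<tau> y) (map (\<lambda>i. (degree_at \<tau> i, Suc i)) w)) =
    word2 (\<lambda>i. R (letter \<tau> y i)) w"
proof (induction w rule: induct_list012)
  case (2 i)
  then show ?case by (simp add: point_def mat2_mult_one)
next
  case (3 i j w)
  then show ?case by (simp add: R_mult) (simp add: point_def)
qed simp

text \<open>Each word lifts to a monomial in which the letter of index i + 1 has degree
  \<open>degree_at \<tau> i\<close>. The vanishing at points of other arrangements lets the
  arrangements contribute independently.\<close>

lemma ex_poly_of_word_span:
  assumes \<tau>: "\<tau> \<in> permutations_of_multiset (content m)"
    and g: "g \<in> rank_one_eval.word_span (\<lambda>y i. R (letter \<tau> y i)) n"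
  shows "\<exists>f\<in>multilinear_polys n. (\<forall>y. R (subst_poly scale (point \<tau> y) f) False False = g y) \<and>
    (\<forall>\<tau>' y. length \<tau>' = N \<longrightarrow> \<tau>' \<noteq> \<tau> \<longrightarrow> subst_poly scale (point \<tau>' y) f = 0)"
proof -
  interpret E: rank_one_eval "\<lambda>y i. R (letter \<tau> y i)" "\<lambda>y i. delta2 (fst y ! i)"
    "\<lambda>y i. row_vec (\<tau> ! i) (column \<tau> (snd y) i)" N n
    using \<tau> by (rule rank_one_eval_letters)
  interpret S: Vector_Spaces.linear poly_scale scale "subst_poly scale \<rho>" for \<rho> :: "'t \<times> nat \<Rightarrow> 'a"
    by (rule subst_poly_linear)
  let ?P = "\<lambda>f g. (\<forall>y. R (subst_poly scale (point \<tau> y) f) False False = g y) \<and>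
    (\<forall>\<tau>' y. length \<tau>' = N \<longrightarrow> \<tau>' \<noteq> \<tau> \<longrightarrow> subst_poly scale (point \<tau>' y) f = 0)"
  let ?U = "{g. \<exists>f\<in>multilinear_polys n. ?P f g}"
  have "fun_space.subspace ?U"
    unfolding fun_space.subspace_def mem_Collect_eq
  proof (intro conjI ballI allI)
    show "\<exists>f\<in>multilinear_polys n. ?P f 0"
      using poly_space.subspace_0[OF subspace_multilinear_polys]
      by (intro bexI[of _ 0]) (auto simp: S.zero R_0)
  next
    fix g g' assume "g \<in> ?U" "g' \<in> ?U"
    then obtain f f' where "f \<in> multilinear_polys n" "?P f g" "f' \<in> multilinear_polys n" "?P f' g'" by blast
    then show "\<exists>f\<in>multilinear_polys n. ?P f (g + g')"
      using poly_space.subspace_add[OF subspace_multilinear_polys]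
      by (intro bexI[of _ "f + f'"]) (auto simp: S.add R_add)
  next
    fix c g assume "g \<in> ?U"
    then obtain f where "f \<in> multilinear_polys n" "?P f g" by blast
    then show "\<exists>f\<in>multilinear_polys n. ?P f (fun_scale c g)"
      using poly_space.subspace_scale[OF subspace_multilinear_polys]
      by (intro bexI[of _ "poly_scale c f"]) (auto simp: S.scale R_scale fun_scale_def)
  qed
  moreover have "{\<lambda>y. word2 (\<lambda>i. R (letter \<tau> y i)) w False False | w. mset w = mset [0..<n]} \<subseteq> ?U"
  proof clarify
    fix w assume w: "mset w = mset [0..<n]"
    let ?ls = "map (\<lambda>i. (degree_at \<tau> i, Suc i)) w"
    have "mset (map snd ?ls) = mset (map Suc [0..<n])" unfolding mset_map w by (simp add: image_mset.compositionality comp_def)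
    then have "mset (map snd ?ls) = mset [1..<n + 1]" by (simp add: map_Suc_upt del: upt_Suc)
    then have in_P: "monomial_poly ?ls \<in> multilinear_polys n" by (rule monomial_in_multilinear_polys)
    have ne: "w \<noteq> []" using arg_cong[OF w, of size] by (auto simp: n_def)
    have "?P (monomial_poly ?ls) (\<lambda>y. word2 (\<lambda>i. R (letter \<tau> y i)) w False False)"
    proof (intro conjI allI impI)
      fix y show "R (subst_poly scale (point \<tau> y) (monomial_poly ?ls)) False False
          = word2 (\<lambda>i. R (letter \<tau> y i)) w False False"
        by (simp only: subst_poly_monomial R_subst_letters[OF ne])
    next
      \<comment> \<open>Where the arrangements differ, the monomial contains a variable whose degree
        is not the one served by the point, so it is sent to 0.\<close>
      fix \<tau>' y assume \<tau>': "length \<tau>' = N" "\<tau>' \<noteq> \<tau>"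
      then obtain i where i: "i < N" "\<tau>' ! i \<noteq> \<tau> ! i"
        using degrees(2)[OF \<tau>] nth_equalityI[of \<tau>' \<tau>] by auto
      then have "i \<in> set w" using mset_eq_setD[OF w] by (simp add: n_def)
      then have "(degree_at \<tau> i, Suc i) \<in> set ?ls" by auto
      moreover have "point \<tau>' y (degree_at \<tau> i, Suc i) = 0" using i by (simp add: point_def degree_at_def)
      ultimately show "subst_poly scale (point \<tau>' y) (monomial_poly ?ls) = 0"
        unfolding subst_poly_monomial by (rule subst_letters_eq_0)
    qed
    with in_P show "\<exists>f\<in>multilinear_polys n. ?P f (\<lambda>y. word2 (\<lambda>i. R (letter \<tau> y i)) w False False)" by blast
  qed
  ultimately have "E.word_span \<subseteq> ?U"
    unfolding E.word_span_def by (rule fun_space.span_minimal[rotated])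
  then show ?thesis using g by blast
qed

text \<open>The number of positions of full degree: each such degree occurs 4 m times.\<close>

definition N\<^sub>1 :: nat
  where "N\<^sub>1 = 4 * m * card T_full"

definition indices :: "('t list \<times> bool list \<times> bool list) set"
  where "indices = permutations_of_multiset (content m) \<times>
    {a. length a = N \<and> dyck a} \<times> {b. length b = N\<^sub>1 \<and> dyck b}"

text \<open>The row vectors of the degrees in \<open>T_row\<close> are not at our disposal, so their positions are matched
  across \<open>\<sim>\<close>-classes to make the minors nonzero. This is where the hypothesis on \<open>T\<^sub>0\<close> enters.\<close>
lemma ex_triangular_poly:
  assumes \<tau>: "\<tau> \<in> permutations_of_multiset (content m)"
    and a: "length a = N" "dyck a" and b: "length b = N\<^sub>1" "dyck b"
  shows "\<exists>f\<in>multilinear_polys n. R (subst_poly scale (point \<tau> (a, b)) f) False False \<noteq> 0 \<and>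
    (\<forall>(\<tau>', a', b')\<in>indices. R (subst_poly scale (point \<tau>' (a', b')) f) False False \<noteq> 0 \<longrightarrow>
      (\<tau>', a', b') = (\<tau>, a, b) \<or> weight a' + weight b' < weight a + weight b)"
proof -
  interpret E: rank_one_eval "\<lambda>y i. R (letter \<tau> y i)" "\<lambda>y i. delta2 (fst y ! i)"
    "\<lambda>y i. row_vec (\<tau> ! i) (column \<tau> (snd y) i)" N n
    using \<tau> by (rule rank_one_eval_letters)
  note deg = degrees[OF \<tau>]
  let ?F = "full_positions \<tau>"
  have lenF: "length ?F = N\<^sub>1" using length_full_positions[OF deg(1)] by (simp add: N\<^sub>1_def)
  obtain Ma where Ma: "perfect_matching [0..<N] Ma" "\<forall>(i, j)\<in>set Ma. i < j \<and> \<not> a ! i \<and> a ! j"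
    using dyck_matching[OF a(2)] a(1) by auto
  obtain Mb where Mb: "perfect_matching [0..<N\<^sub>1] Mb" "\<forall>(i, j)\<in>set Mb. i < j \<and> \<not> b ! i \<and> b ! j"
    using dyck_matching[OF b(2)] b(1) by auto
  obtain Mr where Mr: "perfect_matching (row_positions \<tau>) Mr"
    "\<forall>(i, j)\<in>set Mr. R ` A (\<tau> ! i) \<noteq> R ` A (\<tau> ! j)"
    using row_matching[OF deg(1)] by blast
  \<comment> \<open>\<open>Mb\<close> matches ranks among the full positions; \<open>?F\<close>
    translates them to positions in the whole word.\<close>
  define Mf where "Mf = map (\<lambda>(i, j). (?F ! i, ?F ! j)) Mb"
  have "mset (map fst (Mf @ Mr) @ map snd (Mf @ Mr)) = mset ?F + mset (row_positions \<tau>)"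
    using mset_map_perfect_matching[of ?F Mb] Mb(1) Mr(1)
    by (simp add: Mf_def lenF perfect_matching_def comp_def case_prod_unfold ac_simps)
  also have "\<dots> = mset [0..<N]"
    unfolding full_positions_def row_positions_def mset_filter deg(2) by (rule multiset_partition[symmetric])
  finally have M': "perfect_matching [0..<N] (Mf @ Mr)" by (simp add: perfect_matching_def)
  let ?v = "\<lambda>b i. row_vec (\<tau> ! i) (column \<tau> b i)"
  let ?g = "\<lambda>y. (\<Prod>(i, j)\<leftarrow>Ma. det2 (delta2 (fst y ! i)) (delta2 (fst y ! j))) *
    (\<Prod>(k, l)\<leftarrow>Mf @ Mr. det2 (?v (snd y) k) (?v (snd y) l))"
  obtain f where f: "f \<in> multilinear_polys n"
    "\<And>y. R (subst_poly scale (point \<tau> y) f) False False = ?g y"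
    "\<And>\<tau>' y. length \<tau>' = N \<Longrightarrow> \<tau>' \<noteq> \<tau> \<Longrightarrow> subst_poly scale (point \<tau>' y) f = 0"
    using ex_poly_of_word_span[OF \<tau> E.matchings_in_span[OF Ma(1) M']] by blast
  have in_full: "\<tau> ! (?F ! j) \<in> T_full" if "j < N\<^sub>1" for j
    using nth_mem[of j ?F] that lenF by (auto simp: full_positions_def)
  have Mb_lt: "i < N\<^sub>1" "j < N\<^sub>1" if "(i, j) \<in> set Mb" for i j
  proof -
    have "set (map fst Mb @ map snd Mb) = {0..<N\<^sub>1}"
      using mset_eq_setD[of "map fst Mb @ map snd Mb" "[0..<N\<^sub>1]"] Mb(1) by (simp add: perfect_matching_def)
    moreover have "i \<in> set (map fst Mb @ map snd Mb)" "j \<in> set (map fst Mb @ map snd Mb)"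
      using that by force+
    ultimately show "i < N\<^sub>1" "j < N\<^sub>1" by auto
  qed
  have v: "?v b' (?F ! j) = delta2 (b' ! j)" if "length b' = N\<^sub>1" "j < N\<^sub>1" for b' j
    using in_full[OF that(2)] column_nth[of b' \<tau> j] that lenF by (simp add: row_vec_def)
  have "?g (a, b) \<noteq> 0"
  proof -
    have "det2 (delta2 (a ! i)) (delta2 (a ! j)) \<noteq> (0 :: 'f)" if "(i, j) \<in> set Ma" for i j
    proof -
      have "\<not> a ! i" "a ! j" using Ma(2) that by auto
      then show ?thesis by (simp add: det2_def)
    qed
    moreover have "det2 (?v b k) (?v b l) \<noteq> 0" if kl: "(k, l) \<in> set Mf" for k l
    proof -
      obtain i j where ij: "(i, j) \<in> set Mb" "k = ?F ! i" "l = ?F ! j" using kl by (auto simp: Mf_def)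
      then have "\<not> b ! i" "b ! j" using Mb(2) by auto
      then show ?thesis using v[OF b(1)] Mb_lt[OF ij(1)] ij by (simp add: det2_def)
    qed
    moreover have "det2 (?v b k) (?v b l) \<noteq> 0" if kl: "(k, l) \<in> set Mr" for k l
    proof -
      have "set (map fst Mr @ map snd Mr) = set (row_positions \<tau>)"
        using mset_eq_setD[of "map fst Mr @ map snd Mr" "row_positions \<tau>"] Mr(1)
        by (simp add: perfect_matching_def)
      moreover have "k \<in> set (map fst Mr @ map snd Mr)" "l \<in> set (map fst Mr @ map snd Mr)"
        using kl by force+
      ultimately have "k < N" "l < N" "\<tau> ! k \<notin> T_full" "\<tau> ! l \<notin> T_full"
        using deg(2) by (auto simp: row_positions_def)
      then have row_kl: "\<tau> ! k \<in> T_row" "\<tau> ! l \<in> T_row" using deg(3) by blast+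
      have "det2 (row (\<tau> ! k)) (row (\<tau> ! l)) \<noteq> 0"
      proof
        assume "det2 (row (\<tau> ! k)) (row (\<tau> ! l)) = 0"
        then have "R ` A (\<tau> ! k) = R ` A (\<tau> ! l)"
          unfolding row(2)[OF row_kl(1)] row(2)[OF row_kl(2)]
          using row(1)[OF row_kl(1)] row(1)[OF row_kl(2)] by (rule det2_eq_0_imp_range_outer2_eq)
        then show False using Mr(2) kl by auto
      qed
      then show ?thesis using \<open>\<tau> ! k \<notin> T_full\<close> \<open>\<tau> ! l \<notin> T_full\<close> by (simp add: row_vec_def)
    qed
    ultimately show ?thesis by (auto simp: prod_list_zero_iff)
  qed
  moreover have "(\<tau>', a', b') = (\<tau>, a, b) \<or> weight a' + weight b' < weight a + weight b"
    if idx: "(\<tau>', a', b') \<in> indices"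
      and nz: "R (subst_poly scale (point \<tau>' (a', b')) f) False False \<noteq> 0" for \<tau>' a' b'
  proof -
    have len: "length \<tau>' = N" "length a' = N" "length b' = N\<^sub>1"
      using idx degrees(2)[of \<tau>'] by (auto simp: indices_def)
    have \<tau>': "\<tau>' = \<tau>"
    proof (rule ccontr)
      assume "\<tau>' \<noteq> \<tau>"
      from f(3)[OF len(1) this, of "(a', b')"] nz show False by (simp add: R_0)
    qed
    have g: "?g (a', b') \<noteq> 0" using nz unfolding \<tau>' f(2) .
    \<comment> \<open>A nonzero product has no vanishing minor, so matched letters differ, as
      \<open>weight_triangular\<close> requires.\<close>
    have "a' ! i \<noteq> a' ! j" if "(i, j) \<in> set Ma" for i j
    proof
      assume "a' ! i = a' ! j"
      then have "det2 (delta2 (a' ! i)) (delta2 (a' ! j)) = (0 :: 'f)" by simp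
      then show False using g that by (force simp: prod_list_zero_iff)
    qed
    then have wa: "a' = a \<or> weight a' < weight a"
      using Ma a len by (intro weight_triangular[of a Ma a']) auto
    have "b' ! i \<noteq> b' ! j" if "(i, j) \<in> set Mb" for i j
    proof
      assume "b' ! i = b' ! j"
      then have "det2 (?v b' (?F ! i)) (?v b' (?F ! j)) = 0"
        using v[OF len(3)] Mb_lt[OF that] by simp
      moreover have "(?F ! i, ?F ! j) \<in> set (Mf @ Mr)" using that by (force simp: Mf_def)
      ultimately show False using g by (force simp: prod_list_zero_iff)
    qed
    then have wb: "b' = b \<or> weight b' < weight b"
      using Mb b len by (intro weight_triangular[of b Mb b']) auto
    show ?thesis using wa wb \<tau>' by auto
  qed
  ultimately show ?thesis using f(1,2) by (intro bexI[of _ f]) auto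
qed

lemma card_indices_le_codim: "card indices \<le> graded_codim scale A n"
proof -
  have fin_lists: "finite {a. length a = k \<and> dyck a}" for k
    by (rule finite_subset[OF _ finite_lists_length_eq[of "UNIV :: bool set" k]]) auto
  have fin_idx: "finite indices" unfolding indices_def by (intro finite_cartesian_product fin_lists) simp
  have "\<exists>f. \<forall>s\<in>indices. f s \<in> multilinear_polys n \<and>
      (R (subst_poly scale (point (fst s) (snd s)) (f s)) False False \<noteq> 0 \<and>
      (\<forall>(\<tau>', a', b')\<in>indices. R (subst_poly scale (point \<tau>' (a', b')) (f s)) False False \<noteq> 0 \<longrightarrow>
        (\<tau>', a', b') = s \<or> weight a' + weight b' < weight (fst (snd s)) + weight (snd (snd s))))"
  proof (intro bchoice ballI)
    fix s assume "s \<in> indices"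
    then obtain \<tau> a b where "s = (\<tau>, a, b)" "\<tau> \<in> permutations_of_multiset (content m)"
      "length a = N" "dyck a" "length b = N\<^sub>1" "dyck b" by (auto simp: indices_def)
    then show "\<exists>f. f \<in> multilinear_polys n \<and>
      (R (subst_poly scale (point (fst s) (snd s)) f) False False \<noteq> 0 \<and>
      (\<forall>(\<tau>', a', b')\<in>indices. R (subst_poly scale (point \<tau>' (a', b')) f) False False \<noteq> 0 \<longrightarrow>
        (\<tau>', a', b') = s \<or> weight a' + weight b' < weight (fst (snd s)) + weight (snd (snd s))))"
      using ex_triangular_poly[of \<tau> a b] by (simp add: Bex_def)
  qed
  then obtain f where f: "\<And>s. s \<in> indices \<Longrightarrow> f s \<in> multilinear_polys n"
    "\<And>s. s \<in> indices \<Longrightarrow> R (subst_poly scale (point (fst s) (snd s)) (f s)) False False \<noteq> 0"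
    "\<And>s \<tau>' a' b'. s \<in> indices \<Longrightarrow> (\<tau>', a', b') \<in> indices \<Longrightarrow>
      R (subst_poly scale (point \<tau>' (a', b')) (f s)) False False \<noteq> 0 \<Longrightarrow>
      (\<tau>', a', b') = s \<or> weight a' + weight b' < weight (fst (snd s)) + weight (snd (snd s))"
    by fast
  show ?thesis
  proof (rule B.graded_codim_ge[where f = f and \<rho> = "\<lambda>s. point (fst s) (snd s)" and l = "\<lambda>x. R x False False"
        and m = "\<lambda>s. weight (fst (snd s)) + weight (snd (snd s))"])
    show "1 \<le> n" by (simp add: n_def)
    show "finite indices" by (rule fin_idx)
    show "f s \<in> multilinear_polys n" if "s \<in> indices" for s using that by (rule f(1))
    show "point (fst s) (snd s) (t, i) \<in> A t" if "s \<in> indices" for s t i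
      using that by (intro point_in) (auto simp: indices_def)
    show "Vector_Spaces.linear scale (*) (\<lambda>x. R x False False)"
      by (intro Vector_Spaces.linear_iff[THEN iffD2] conjI allI)
        (auto simp: vector_space_axioms R_add R_scale vector_space_def algebra_simps)
    show "R (subst_poly scale (point (fst s) (snd s)) (f s)) False False \<noteq> 0" if "s \<in> indices" for s
      using that by (rule f(2))
    show "s' = s \<or> weight (fst (snd s')) + weight (snd (snd s')) < weight (fst (snd s)) + weight (snd (snd s))"
      if "s \<in> indices" "s' \<in> indices" "R (subst_poly scale (point (fst s') (snd s')) (f s)) False False \<noteq> 0" for s s'
      using f(3)[OF that(1), of "fst s'" "fst (snd s')" "snd (snd s')"] that by simp
  qed
qed

text \<open>With D = dim A, the multinomial bound compares N^N = m^N D^N with m^N times the product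
  of the d_t^(m d_t), which is \<open>2 ^ N * 2 ^ N\<^sub>1\<close>. The Dyck words of lengths N and
  \<open>N\<^sub>1\<close> attain these powers of 2 up to a factor (N + 1)^3 each, hence the
  6.\<close>

lemma power_le_codim:
  "real (card basis_index) ^ N \<le> real (N + 1) ^ (card T_all + 6) * real (graded_codim scale A n)"
proof (cases "m = 0")
  case True
  have "1 \<le> graded_codim scale A n"
  proof -
    have "content 0 = {#}" using size_content[of 0] by simp
    then have "([], [], []) \<in> indices"
      unfolding indices_def N\<^sub>1_def using True by (simp add: N_def dyck_def)
    moreover have "finite indices"
    proof -
      have "finite {a. length a = k \<and> dyck a}" for k
        by (rule finite_subset[OF _ finite_lists_length_eq[of "UNIV :: bool set" k]]) auto
      then show ?thesis unfolding indices_def by (intro finite_cartesian_product) simp_all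
    qed
    ultimately have "card indices \<ge> 1" by (metis One_nat_def Suc_leI card_gt_0_iff empty_iff)
    then show ?thesis using card_indices_le_codim by linarith
  qed
  then show ?thesis using True by (simp add: N_def)
next
  case False
  define D where "D = card basis_index"
  define p where "p = real (card (permutations_of_multiset (content m)))"
  define d where "d k = real (card {a. length a = k \<and> dyck a})" for k
  have D: "D = 2 * card T_row + 4 * card T_full" unfolding D_def by (rule card_basis_index(3)[OF fin])
  have even: "\<exists>k. N = 2 * k" "\<exists>k. N\<^sub>1 = 2 * k"
    using D by (auto simp: N_def D_def[symmetric] N\<^sub>1_def intro: exI[of _ "m * (card T_row + 2 * card T_full)"]
      exI[of _ "2 * m * card T_full"])
  have N1_le: "N\<^sub>1 \<le> N" using D by (simp add: N_def D_def[symmetric] N\<^sub>1_def algebra_simps)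
  have d_ge: "2 ^ l \<le> real (l + 1) ^ 3 * d l" if l: "\<exists>k. l = 2 * k" for l
  proof -
    obtain k where "l = 2 * k" using l by blast
    then show ?thesis using card_dyck_ge[of k] by (simp only: d_def)
  qed
  note dN = d_ge[OF even(1)]
  have "2 ^ N\<^sub>1 \<le> real (N\<^sub>1 + 1) ^ 3 * d N\<^sub>1" by (rule d_ge[OF even(2)])
  also have "\<dots> \<le> real (N + 1) ^ 3 * d N\<^sub>1"
    using N1_le by (intro mult_right_mono power_mono) (auto simp: d_def)
  finally have dN1: "2 ^ N\<^sub>1 \<le> real (N + 1) ^ 3 * d N\<^sub>1" .
  have size: "size (content m) = N" by (simp add: size_content N_def)
  have "(\<Prod>t\<in>T_all. real (count (content m) t) ^ count (content m) t)
      = (\<Prod>t\<in>T_all. real m ^ count (content m) t * real (degree_dim t) ^ (m * degree_dim t))"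
    by (intro prod.cong) (simp_all add: count_content power_mult_distrib)
  also have "\<dots> = real m ^ N * (\<Prod>t\<in>T_all. real (degree_dim t) ^ (m * degree_dim t))"
  proof -
    have "N = (\<Sum>t\<in>T_all. count (content m) t)"
      unfolding size[symmetric] size_multiset_overloaded_eq
      using finite_T set_content[of m] by (intro sum.mono_neutral_left) (auto simp: not_in_iff)
    then show ?thesis by (simp only: prod.distrib power_sum[symmetric])
  qed
  \<comment> \<open>A factor 2 for each of the N letters, and a second one for each of the
    \<open>N\<^sub>1\<close> letters with d_t = 4.\<close>
  also have "(\<Prod>t\<in>T_all. real (degree_dim t) ^ (m * degree_dim t)) = 2 ^ N * 2 ^ N\<^sub>1"
  proof -
    have "(\<Prod>t\<in>T_all. real (degree_dim t) ^ (m * degree_dim t)) =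
        (\<Prod>t\<in>T_row. real (degree_dim t) ^ (m * degree_dim t)) * (\<Prod>t\<in>T_full. real (degree_dim t) ^ (m * degree_dim t))"
      using finite_T T_disjoint by (intro prod.union_disjoint) auto
    also have "(\<Prod>t\<in>T_row. real (degree_dim t) ^ (m * degree_dim t)) = (\<Prod>t\<in>T_row. 2 ^ (m * 2))"
      using T_disjoint by (intro prod.cong) (auto simp: degree_dim_def)
    also have "(\<Prod>t\<in>T_full. real (degree_dim t) ^ (m * degree_dim t)) = (\<Prod>t\<in>T_full. 2 ^ (m * 8))"
    proof (intro prod.cong refl)
      fix t assume "t \<in> T_full"
      then have "real (degree_dim t) ^ (m * degree_dim t) = (2 ^ 2) ^ (m * 4)" by (simp add: degree_dim_def)
      also have "\<dots> = 2 ^ (m * 8)" by (simp only: power_mult[symmetric]) simp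
      finally show "real (degree_dim t) ^ (m * degree_dim t) = 2 ^ (m * 8)" .
    qed
    also have "(\<Prod>t\<in>T_row. 2 ^ (m * 2)) * (\<Prod>t\<in>T_full. 2 ^ (m * 8)) = (2 :: real) ^ (m * 2 * card T_row + m * 8 * card T_full)"
      by (simp only: prod_constant power_mult[symmetric] power_add)
    also have "m * 2 * card T_row + m * 8 * card T_full = N + N\<^sub>1"
      by (simp add: N_def D_def[symmetric] D N\<^sub>1_def algebra_simps)
    finally show ?thesis by (simp only: power_add)
  qed
  finally have prod: "(\<Prod>t\<in>T_all. real (count (content m) t) ^ count (content m) t) = real m ^ N * (2 ^ N * 2 ^ N\<^sub>1)" .
  have "real N ^ N \<le> real (N + 1) ^ card T_all * (p * (real m ^ N * (2 ^ N * 2 ^ N\<^sub>1)))"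
    using card_permutations_of_multiset_ge[of T_all "content m"] finite_T set_content[of m]
    unfolding size prod p_def by simp
  moreover have "real N ^ N = real m ^ N * real D ^ N" by (simp add: N_def D_def power_mult_distrib)
  ultimately have "real m ^ N * real D ^ N \<le> real m ^ N * (real (N + 1) ^ card T_all * p * (2 ^ N * 2 ^ N\<^sub>1))"
    by (simp only: mult.left_commute mult.assoc)
  then have "real D ^ N \<le> real (N + 1) ^ card T_all * p * (2 ^ N * 2 ^ N\<^sub>1)"
    using False by (subst (asm) mult_le_cancel_left_pos) auto
  also have "\<dots> \<le> real (N + 1) ^ card T_all * p * ((real (N + 1) ^ 3 * d N) * (real (N + 1) ^ 3 * d N\<^sub>1))"
    using dN dN1 by (intro mult_left_mono mult_mono) (auto simp: p_def d_def)
  also have "\<dots> = real (N + 1) ^ (card T_all + 6) * (p * d N * d N\<^sub>1)"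
    by (simp add: power_add eval_nat_numeral mult_ac)
  also have "p * d N * d N\<^sub>1 = real (card indices)"
    by (simp add: p_def d_def indices_def card_cartesian_product)
  also have "real (N + 1) ^ (card T_all + 6) * \<dots> \<le> real (N + 1) ^ (card T_all + 6) * real (graded_codim scale A n)"
    using card_indices_le_codim by (intro mult_left_mono) auto
  finally show ?thesis by (simp add: D_def)
qed

end

context unit_graded
begin

lemma card_basis_index_pos: "0 < card basis_index"
proof -
  have "basis_index \<noteq> {}"
  proof
    assume "basis_index = {}"
    then have "matrix_unit False False = 0" using span_elem by auto
    then have "unit2 False False False False = (0 :: 'f)" using matrix_unit(2)[of False False] R_0 by metis
    then show False by (simp add: unit2_def)
  qed
  then show ?thesis using fin by (simp add: card_gt_0_iff)
qed

text \<open>The element over E_00 is idempotent modulo J, so the product of n variables of degree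
  \<open>s\<^sub>0\<close> is not an identity. This settles lengths too short for the eight fixed
  letters.\<close>

lemma codim_pos:
  assumes "1 \<le> n"
  shows "1 \<le> graded_codim scale A n"
proof -
  define \<rho> where "\<rho> = (\<lambda>(t, j :: nat). if t = s\<^sub>0 then matrix_unit False False else 0)"
  let ?f = "monomial_poly (map (\<lambda>i. (s\<^sub>0, i)) [1..<n + 1]) :: ('t, 'f) graded_poly"
  have "R (subst_letters \<rho> (map (\<lambda>i. (s\<^sub>0, i)) w)) = unit2 False False" if "w \<noteq> []" for w
    using that
  proof (induction w rule: induct_list012)
    case (2 i)
    then show ?case by (simp add: \<rho>_def matrix_unit)
  next
    case (3 i j w)
    then have "R (subst_letters \<rho> (map (\<lambda>i. (s\<^sub>0, i)) (i # j # w))) = mat2_mult (R (\<rho> (s\<^sub>0, i))) (unit2 False False)"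
      by (simp add: R_mult)
    also have "\<dots> = unit2 False False"
      by (simp add: \<rho>_def matrix_unit) (simp add: mat2_mult_def unit2_def fun_eq_iff)
    finally show ?case .
  qed simp
  then have val: "R (subst_poly scale \<rho> ?f) = unit2 False False"
    using assms by (simp add: subst_poly_monomial del: upt_Suc)
  have "card {()} \<le> graded_codim scale A n"
  proof (rule B.graded_codim_ge[where f = "\<lambda>_. ?f" and \<rho> = "\<lambda>_. \<rho>" and l = "\<lambda>x. R x False False" and m = "\<lambda>_. 0"])
    show "?f \<in> multilinear_polys n"
      by (rule monomial_in_multilinear_polys) (simp add: comp_def del: upt_Suc)
    show "\<rho> (t, i) \<in> A t" for t i
      using matrix_unit(1)[of False False] subspace_0[OF subspace_A] by (simp add: \<rho>_def)
    show "Vector_Spaces.linear scale (*) (\<lambda>x. R x False False)"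
      by (intro Vector_Spaces.linear_iff[THEN iffD2] conjI allI)
        (auto simp: vector_space_axioms R_add R_scale vector_space_def algebra_simps)
    show "R (subst_poly scale \<rho> ?f) False False \<noteq> 0" unfolding val by (simp add: unit2_def)
  qed (use assms in auto)
  then show ?thesis by simp
qed

text \<open>For n = m D + 8 + e with e < D, the powers D^n and D^(m D) differ by at most the factor
  D^(8 + D), and m D + 1 \<le> 2 n yields 2^k. For n < 8 the constant already dominates D^n.\<close>

lemma power_le_codim_all:
  fixes D k :: nat
  defines "D \<equiv> card basis_index" and "k \<equiv> card T_all + 6"
  assumes n: "1 \<le> n"
  shows "real D ^ n \<le> real D ^ (8 + D) * 2 ^ k * real n ^ k * real (graded_codim scale A n)"
proof (cases "8 \<le> n")
  case True
  define m e where "m = (n - 8) div D" and "e = (n - 8) mod D"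
  have D: "0 < D" unfolding D_def by (rule card_basis_index_pos)
  have n_eq: "n = m * D + 8 + e" using True by (simp add: m_def e_def)
  interpret L: lower_bound scale A J R s\<^sub>0 s\<^sub>1 m e "m * D" n
    by unfold_locales (simp_all add: D_def[symmetric] n_eq)
  have e: "e < D" using D by (simp add: e_def)
  have le: "real (m * D + 1) \<le> 2 * real n" using n_eq by simp
  have "real D ^ n = real D ^ (8 + e) * real D ^ (m * D)"
    by (simp add: n_eq power_add mult_ac)
  also have "\<dots> \<le> real D ^ (8 + D) * (real (m * D + 1) ^ k * real (graded_codim scale A n))"
    using L.power_le_codim D e unfolding D_def[symmetric] k_def[symmetric]
    by (intro mult_mono power_increasing) auto
  also have "\<dots> \<le> real D ^ (8 + D) * ((2 * real n) ^ k * real (graded_codim scale A n))"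
    using le by (intro mult_left_mono mult_right_mono power_mono) auto
  finally show ?thesis by (simp add: power_mult_distrib mult_ac)
next
  case False
  have D: "1 \<le> real D" using card_basis_index_pos unfolding D_def by linarith
  have "real D ^ n \<le> real D ^ (8 + D) * 1" using D False by (simp add: power_increasing)
  also have "\<dots> \<le> real D ^ (8 + D) * (2 ^ k * real n ^ k * real (graded_codim scale A n))"
  proof (intro mult_left_mono)
    have "1 \<le> real (graded_codim scale A n)" using codim_pos[OF n] by linarith
    moreover have "1 \<le> (2 :: real) ^ k" "1 \<le> real n ^ k" using n by simp_all
    ultimately have "1 * 1 * 1 \<le> 2 ^ k * real n ^ k * real (graded_codim scale A n)"
      by (intro mult_mono) auto
    then show "1 \<le> 2 ^ k * real n ^ k * real (graded_codim scale A n)" by simp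
  qed simp
  finally show ?thesis by (simp add: mult_ac)
qed

end

text \<open>C = 1 / K and r = - k. The limit follows by squeezing, since n-th roots of n and of
  positive constants tend to 1.\<close>

lemma growth_from_bounds:
  fixes c :: "nat \<Rightarrow> nat" and D k :: nat and K :: real
  assumes D: "0 < D" and K: "0 < K"
    and lower: "\<And>n. 1 \<le> n \<Longrightarrow> real D ^ n \<le> K * real n ^ k * real (c n)"
    and upper: "\<And>n. 1 \<le> n \<Longrightarrow> c n \<le> D ^ (n + 1)"
  shows "(\<exists>C r :: real. C > 0 \<and> (\<forall>n\<ge>1. C * real n powr r * real D ^ n \<le> real (c n) \<and> c n \<le> D ^ (n + 1))) \<and>
    (\<lambda>n. root n (real (c n))) \<longlonglongrightarrow> real D"
proof
  have low: "1 / K * real n powr - real k * real D ^ n \<le> real (c n)" if n: "1 \<le> n" for n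
  proof -
    have "real n powr - real k = 1 / real n ^ k"
      using n by (simp add: powr_minus powr_realpow divide_inverse)
    moreover have "0 < K * real n ^ k" using K n by simp
    ultimately show ?thesis using lower[OF n] by (simp add: field_simps)
  qed
  show "\<exists>C r :: real. C > 0 \<and> (\<forall>n\<ge>1. C * real n powr r * real D ^ n \<le> real (c n) \<and> c n \<le> D ^ (n + 1))"
    using low upper K by (intro exI[of _ "1 / K"] exI[of _ "- real k"]) auto
  have lim_low: "(\<lambda>n. root n (1 / K) * (1 / root n (real n) ^ k) * real D) \<longlonglongrightarrow> 1 * (1 / 1 ^ k) * real D"
    using K by (intro tendsto_mult tendsto_divide tendsto_power LIMSEQ_root LIMSEQ_root_const tendsto_const) auto
  have lim_up: "(\<lambda>n. root n (real D) * real D) \<longlonglongrightarrow> 1 * real D"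
    using D by (intro tendsto_mult LIMSEQ_root_const tendsto_const) auto
  show "(\<lambda>n. root n (real (c n))) \<longlonglongrightarrow> real D"
  proof (rule tendsto_sandwich)
    show "\<forall>\<^sub>F n in sequentially. root n (1 / K) * (1 / root n (real n) ^ k) * real D \<le> root n (real (c n))"
      using eventually_ge_at_top[of 1]
    proof eventually_elim
      case (elim n)
      have "root n (1 / K) * (1 / root n (real n) ^ k) * real D = root n (1 / K * (1 / real n ^ k) * real D ^ n)"
        using elim K by (simp add: real_root_mult real_root_divide real_root_power real_root_power_cancel)
      also have "\<dots> = root n (1 / K * real n powr - real k * real D ^ n)"
        using elim by (simp add: powr_minus powr_realpow divide_inverse)
      also have "\<dots> \<le> root n (real (c n))"
        using elim by (intro real_root_le_mono low) auto
      finally show ?case .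
    qed
    show "\<forall>\<^sub>F n in sequentially. root n (real (c n)) \<le> root n (real D) * real D"
      using eventually_ge_at_top[of 1]
    proof eventually_elim
      case (elim n)
      have "real (c n) \<le> real D * real D ^ n"
        using upper[OF elim] by (metis of_nat_le_iff of_nat_power power_Suc Suc_eq_plus1)
      then have "root n (real (c n)) \<le> root n (real D * real D ^ n)"
        using elim by (intro real_root_le_mono) auto
      also have "\<dots> = root n (real D) * real D"
        using elim by (simp add: real_root_mult real_root_power_cancel)
      finally show ?case .
    qed
  qed (use lim_low lim_up in simp_all)
qed

context graded_matrix_rep
begin

lemma coset_image_eq_iff:
  assumes "subspace J"
  shows "coset J ` A s = coset J ` A t \<longleftrightarrow> R ` A s = R ` A t"
proof -
  have "coset J x \<in> coset J ` V \<longleftrightarrow> R x \<in> R ` V" for x V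
    unfolding image_iff coset_eq_iff[OF assms] R_eq_iff ..
  then have "coset J ` U \<subseteq> coset J ` V \<longleftrightarrow> R ` U \<subseteq> R ` V" for U V
    by (simp only: image_subset_iff)
  then show ?thesis by (simp only: set_eq_subset)
qed

lemma module_dim_eq_2_iff:
  assumes "subspace J"
  shows "module_dim ((quotient_algebra scale J)\<lparr>carrier := coset J ` A t\<rparr>) = 2 \<longleftrightarrow> t \<in> T_row"
proof (cases t rule: A_cases)
  case 1
  then have "A t \<subseteq> J" using subspace_0[OF assms] by simp
  then show ?thesis
    unfolding module_dim_image[OF assms subspace_A] using 1(2) dim_image_zero by simp
next
  case 2
  then show ?thesis
    unfolding module_dim_image[OF assms subspace_A] using 2(1) dim_image_row[OF row[OF 2(1)]] by simp
next
  case 3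
  then show ?thesis
    unfolding module_dim_image[OF assms subspace_A] using dim_image_full[of "A t"]
    by (simp add: T_full_def)
qed

text \<open>\<open>T_row\<close> is the disjoint union of its classes, so the sizes of a class and
  of all the others add up to \<open>card T_row\<close>.\<close>

lemma class_card_le:
  assumes J: "subspace J" and fin: "finite T_row"
    and sim: "sim = {(s, t). s \<in> T_row \<and> t \<in> T_row \<and> coset J ` A s = coset J ` A t}"
    and cond: "T_row = {} \<or> (\<forall>c\<^sub>0 \<in> T_row // sim. card c\<^sub>0 \<le> (\<Sum>c \<in> T_row // sim - {c\<^sub>0}. card c))"
    and t\<^sub>0: "t\<^sub>0 \<in> T_row"
  shows "2 * card {t \<in> T_row. R ` A t = R ` A t\<^sub>0} \<le> card T_row"
proof -
  let ?c = "{t \<in> T_row. R ` A t = R ` A t\<^sub>0}"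
  have eq: "equiv T_row sim"
    by (auto simp: equiv_def refl_on_def sym_def trans_def sim)
  have "sim `` {t\<^sub>0} = ?c" using t\<^sub>0 unfolding sim coset_image_eq_iff[OF J] by auto
  with quotientI[OF t\<^sub>0, of sim] have c: "?c \<in> T_row // sim" by (simp only:)
  have fin_quot: "finite (T_row // sim)"
    using fin by (rule finite_quotient) (auto simp: sim)
  have "card T_row = card (\<Union> (T_row // sim))" by (simp add: Union_quotient[OF eq])
  also have "\<dots> = (\<Sum>c\<in>T_row // sim. card c)"
  proof (rule card_Union_disjoint)
    show "disjoint (T_row // sim)" using quotient_disj[OF eq] by (auto simp: disjoint_def pairwise_def disjnt_def)
    show "finite c" if "c \<in> T_row // sim" for c
      using that fin in_quotient_imp_subset[OF eq] by (meson finite_subset)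
  qed
  also have "\<dots> = card ?c + (\<Sum>c \<in> T_row // sim - {?c}. card c)"
    using fin_quot c by (rule sum.remove)
  finally show ?thesis using cond c t\<^sub>0 by fastforce
qed

end

theorem theorem10p5:
  fixes scale :: "'f::field_char_0 \<Rightarrow> 'a::ring \<Rightarrow> 'a"
    and A :: "'t::semigroup_mult \<Rightarrow> 'a set"
    and J :: "'a set"
    and I :: "'t \<Rightarrow> 'a set set"
    and dimI :: "'t \<Rightarrow> nat"
    and T0 T1 :: "'t set"
    and sim :: "('t \<times> 't) set"
    and dimA :: nat
  assumes "nonunital_algebra scale"
    and "\<exists>B. finite_dimensional_vector_space scale B"
    and "\<forall>s t :: 't. s * t = t"
    and "nonunital_algebra.grading scale A"
    and "nonunital_algebra.graded_simple scale A"
    and "J = nonunital_algebra.jacobson_radical scale"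
    and "iso_matrix_algebra (quotient_algebra scale J) 2"
    and "\<forall>t. I t = coset J ` A t"
    and "\<forall>t. dimI t = module_dim ((quotient_algebra scale J)\<lparr>carrier := I t\<rparr>)"
    and "T0 = {t. dimI t = 2}"
    and "T1 = {t. I t = carrier (quotient_algebra scale J)}"
    and "sim = {(s, t). s \<in> T0 \<and> t \<in> T0 \<and> I s = I t}"
    and "T0 = {} \<or>
      (\<forall>c\<^sub>0 \<in> T0 // sim. card c\<^sub>0 \<le> (\<Sum>c \<in> T0 // sim - {c\<^sub>0}. card c))"
    and "dimA = vector_space.dim scale UNIV"
  shows "(\<exists>C r :: real. C > 0 \<and>
      (\<forall>n\<ge>1. C * real n powr r * real dimA ^ n \<le> real (graded_codim scale A n) \<and>
        graded_codim scale A n \<le> dimA ^ (n + 1))) \<and>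
    (\<lambda>n. root n (real (graded_codim scale A n))) \<longlonglongrightarrow> real dimA"
proof -
  interpret nonunital_algebra scale by fact
  interpret right_zero_graded scale A
    using assms(3,4) by unfold_locales auto
  obtain B where B: "finite_dimensional_vector_space scale B" using assms(2) by blast
  have J: "two_sided_ideal J" using assms(6) jacobson_radical_two_sided by simp
  then have subJ: "subspace J" by (simp add: two_sided_ideal_def)
  obtain R where R: "matrix_rep scale J R" using ex_matrix_rep[OF J assms(7)] by blast
  \<comment> \<open>Stated for every representation with kernel J, since the one obtained from the
    isomorphism may be replaced after a change of basis.\<close>
  have rep: "graded_matrix_rep scale A J S" if S: "matrix_rep scale J S" for S
  proof -
    interpret S: matrix_rep scale J S by fact
    have "J \<noteq> UNIV"
    proof
      assume "J = UNIV"
      obtain x where x: "S x = unit2 False False" using S.R_surj by (metis surjD)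
      have "S x = (\<lambda>i j. 0)" using S.R_kernel \<open>J = UNIV\<close> by blast
      then have "unit2 False False False False = (0 :: 'f)" unfolding x by (rule fun_cong[OF fun_cong])
      then show False by (simp add: unit2_def)
    qed
    then show ?thesis
      using graded_simple_inter_ideal[OF assms(5) J] by unfold_locales
  qed
  have T_row: "graded_matrix_rep.T_row A S = T0" if S: "matrix_rep scale J S" for S
    using graded_matrix_rep.module_dim_eq_2_iff[OF rep[OF S] subJ] assms(8,9,10) by auto
  have class_le: "2 * card {t \<in> T0. S ` A t = S ` A t\<^sub>0} \<le> card T0"
    if S: "matrix_rep scale J S" and "t\<^sub>0 \<in> T0" for S t\<^sub>0
  proof -
    interpret S: graded_matrix_rep scale A J S using S by (rule rep)
    show ?thesis
      using S.class_card_le[OF subJ S.card_basis_index(2)[OF S.finite_basis_index[OF B]], of sim t\<^sub>0]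
        assms(8,12,13) \<open>t\<^sub>0 \<in> T0\<close> unfolding T_row[OF S] by simp
  qed
  obtain S s\<^sub>0 s\<^sub>1 where S: "matrix_rep scale J S"
    and units: "\<And>i. unit2 i False \<in> S ` A s\<^sub>0" "\<And>i. unit2 i True \<in> S ` A s\<^sub>1"
  proof -
    interpret R: graded_matrix_rep scale A J R using R by (rule rep)
    have fin: "finite R.basis_index" using B by (rule R.finite_basis_index)
    show thesis
    proof (cases "R.T_full = {}")
      case False
      then obtain t where "R ` A t = UNIV" by (auto simp: R.T_full_def)
      then show thesis using R by (intro that[of R t t]) auto
    next
      case True
      \<comment> \<open>With neither full degrees nor degrees of rank one, A would be zero.\<close>
      have "T0 \<noteq> {}"
      proof
        assume "T0 = {}"
        then have "R.basis_index = {}" using True T_row[OF R] by (auto simp: R.basis_index_def)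
        then have "(x :: 'a) = 0" for x using R.span_elem by auto
        then show False using assms(5) unfolding graded_simple_def by metis
      qed
      then obtain t\<^sub>0 where t\<^sub>0: "t\<^sub>0 \<in> T0" by blast
      have "finite T0" using R.card_basis_index(2)[OF fin] T_row[OF R] by simp
      \<comment> \<open>A class is at most half of the nonempty finite set T0, so there are two
        classes; their rows are linearly independent and serve as the new basis.\<close>
      have "{t \<in> T0. R ` A t = R ` A t\<^sub>0} \<noteq> T0"
      proof
        assume "{t \<in> T0. R ` A t = R ` A t\<^sub>0} = T0"
        then have "2 * card T0 \<le> card T0" using class_le[OF R t\<^sub>0] by simp
        then show False using \<open>finite T0\<close> t\<^sub>0 by auto
      qed
      then obtain t\<^sub>1 where t\<^sub>1: "t\<^sub>1 \<in> T0" "R ` A t\<^sub>1 \<noteq> R ` A t\<^sub>0" by blast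
      have rows: "t\<^sub>0 \<in> R.T_row" "t\<^sub>1 \<in> R.T_row" using t\<^sub>0 t\<^sub>1 T_row[OF R] by simp_all
      have "det2 (R.row t\<^sub>0) (R.row t\<^sub>1) \<noteq> 0"
        using det2_eq_0_imp_range_outer2_eq[OF _ R.row(1)[OF rows(1)] R.row(1)[OF rows(2)]] t\<^sub>1(2)
        unfolding R.row(2)[OF rows(1)] R.row(2)[OF rows(2)] by blast
      from R.change_of_basis[OF this] obtain S where S: "matrix_rep scale J S"
        and S\<^sub>0: "\<forall>U. R ` U = range (\<lambda>p. outer2 p (R.row t\<^sub>0)) \<longrightarrow> (\<forall>i. unit2 i False \<in> S ` U)"
        and S\<^sub>1: "\<forall>U. R ` U = range (\<lambda>p. outer2 p (R.row t\<^sub>1)) \<longrightarrow> (\<forall>i. unit2 i True \<in> S ` U)"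
        by (elim exE conjE)
      show thesis
        using S S\<^sub>0[THEN spec, THEN mp, OF R.row(2)[OF rows(1)], THEN spec]
          S\<^sub>1[THEN spec, THEN mp, OF R.row(2)[OF rows(2)], THEN spec]
        by (rule that)
    qed
  qed
  interpret S: graded_matrix_rep scale A J S using S by (rule rep)
  interpret U: unit_graded scale A J S s\<^sub>0 s\<^sub>1
    using S.finite_basis_index[OF B] units class_le[OF S] by unfold_locales (simp_all add: T_row[OF S])
  have dimA: "dimA = card S.basis_index" using assms(14) S.elem_basis(3)[OF U.fin] by simp
  have "card (S.elem ` S.basis_index) = dimA"
    using S.elem_basis(1)[OF U.fin] by (simp add: card_image dimA)
  then have upper: "graded_codim scale A n \<le> dimA ^ (n + 1)" if "1 \<le> n" for n
    using U.B.graded_codim_le[OF that] by simp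
  have D: "0 < dimA" unfolding dimA by (rule U.card_basis_index_pos)
  show ?thesis
  proof (rule growth_from_bounds[OF D _ _ upper])
    show "0 < real dimA ^ (8 + dimA) * 2 ^ (card U.T_all + 6)" using D by simp
    show "real dimA ^ n \<le> real dimA ^ (8 + dimA) * 2 ^ (card U.T_all + 6) * real n ^ (card U.T_all + 6)
        * real (graded_codim scale A n)" if "1 \<le> n" for n
      using U.power_le_codim_all[OF that] unfolding dimA .
  qed
qed

end
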